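(* Let $(\mathcal E,\mathcal C)$ be an admissible form on $X$ of martingale dimension one, let $B\subset X$ be closed and an $(\mathcal E,\mathcal C)$-null set, let $(\mathcal E,\mathcal C)$ be complete (with respect to a fixed point $p\in X\setminus B$), and let $b\in\ker\partial_B^\ast$ be minimal energy-dominant. All operators below are taken with respect to the measure $\nu_b$. (i) A function $f\in L^2(X,\nu_b)$ is an element of $\mathcal D(\partial_B^\bot)$ if and only if it admits a representation $$f=g+\star_b^{-1}\partial u+w,$$ where $g\in\mathcal C$, $u\in\mathcal D(\Delta_B)$ is a weak solution of the Neumann problem $$\Delta_Bu=\partial_B^\bot f-\star_b^{-1}\partial g\ \text{ on }X\setminus B,\qquad (du)_B=n_B(fb)-n_Bb(g\,\cdot)\ \text{ on }B,$$ and $w\in\ker\partial^\bot$. (ii) If $f=\widetilde g+\star_b^{-1}\partial\widetilde u+\widetilde w$ is another such representation of $f\in\mathcal D(\partial_B^\bot)$, then there is a single constant $c\in\mathbb R$ such that $$\widetilde g=g+c,\qquad \star_b^{-1}\partial\widetilde u=\star_b^{-1}\partial u-c\star_b^{-1}\partial h,\qquad \widetilde w=w-c\star_b^{-1}v,$$ where $b=\partial h+v$, $h\in\mathcal C$, $v\in\ker\partial^\ast$, is the unique orthogonal decomposition of $b$ in $\mathcal H=\partial(\mathcal C)\oplus\ker\partial^\ast$. (iii) For any $f\in\mathcal D(\partial_B^\bot)$ the class modulo constants of $g$ is the orthogonal projection in $\hat{\mathcal D}(\partial_B^\bot)$ onto $\mathcal C/\mathbb R$ of the class of $f$ modulo 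$\ker\partial_B^\bot$.
   Context: **Admissible forms.** $(X,\varrho)$ is a locally compact separable metric space, $C_c(X)$ the space of continuous compactly supported real functions with norm $\|\cdot\|_{\sup}$. An admissible form is a pair $(\mathcal E,\mathcal C)$, $\mathcal C\subset C_c(X)$ a subalgebra, $\mathcal E:\mathcal C\times\mathcal C\to\mathbb R$ nonnegative definite symmetric bilinear, $\mathcal E(f):=\mathcal E(f,f)$, such that: (1) $\mathcal C$ is dense in $C_c(X)$; (2) $\mathcal C$ is separable for the seminorm $\mathcal E^{1/2}$; (3) $u\in\mathcal C$ implies $(u\wedge1)\vee0\in\mathcal C$ and $\mathcal E((u\wedge1)\vee0)\le\mathcal E(u)$; (4) for $f\in\mathcal C$ the functional $g\mapsto\mathcal E(fg,f)-\frac12\mathcal E(f^2,g)$ is positive on $\mathcal C$ and bounded w.r.t. $\|\cdot\|_{\sup}$; (5) $\mathcal E(f,g)=0$ for all $f,g\in\mathcal C$ such that $g$ is constant on a neighborhood of $\operatorname{supp}f$. **First order structure.** For $f_1,f_2\in\mathcal C$, $\nu_{f_1,f_2}$ is the unique finite signed Radon measure with $\int g\,d\nu_{f_1,f_2}=\frac12\{\mathcal E(f_1g,f_2)+\mathcal E(f_1,f_2g)-\mathcal E(f_1f_2,g)\}$, $g\in\mathcal C$; $\nu_f:=\nu_{f,f}$. Put $d_uf(x,y)=f(x)-f(y)$, $\overline g(x,y)=\frac12(g(x)+g(y))$. $\mathcal H$ is the Hilbert space obtained from the span of all $\overline g\,d_uf$ ($g\in C_c(X)$, $f\in\mathcal C$)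 with the nonnegative definite form $\langle\overline g_1d_uf_1,\overline g_2d_uf_2\rangle_{\mathcal H}=\int g_1g_2\,d\nu_{f_1,f_2}$ by factoring out null elements and completing. $\partial f$ is the class of $d_uf$, $g\,\partial f$ the class of $\overline g\,d_uf$; this extends to a bounded action of $C_c(X)$ on $\mathcal H$. One has $\|\partial f\|_{\mathcal H}^2=\mathcal E(f)$ and $\partial(fg)=f\partial g+g\partial f$. For $v,w\in\mathcal H$, $\nu_{v,w}$ is the finite signed measure determined by bilinear continuous extension of $\nu_{g_1\partial f_1,g_2\partial f_2}=g_1g_2\nu_{f_1,f_2}$; $\nu_v:=\nu_{v,v}\ge0$, $\nu_{v,w}(X)=\langle v,w\rangle_{\mathcal H}$. The map $g\mapsto gv$ extends to an isometry $L^2(X,\nu_v)\to\mathcal H$. $\mathcal C$ is normed by $\|f\|_{\mathcal C}=\mathcal E(f)^{1/2}+\|f\|_{\sup}$, with dual $\mathcal C^\ast$. **Energy dominance, martingale dimension.** A $\sigma$-finite Borel measure $\nu$ is energy-dominant if $\nu_f\ll\nu$ for all $f\in\mathcal C$; minimal if moreover $\nu\ll\nu'$ for every energy-dominant $\nu'$. $v\in\mathcal H$ is minimal energy-dominant if $\nu_v$ is. A Borel set is an $(\mathcal E,\mathcal C)$-null set if it is null for some (hence all) minimal energy-dominant measures. For a minimal energy-dominant $\nu$, the pointwise index is the ($\nu$-a.e. unique) minimal Borel function $p(\cdot):X\to\mathbb N\cup\{\infty\}$ with $\operatorname{rank}\big(\frac{d\nu_{f_i,f_j}}{d\nu}(x)\big)_{i,j=1}^N\le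 p(x)$ for $\nu$-a.e. $x$, for all $N$ and $f_1,\dots,f_N\in\mathcal C$. The martingale dimension is $\nu\text{-}\operatorname{ess\,sup}p(\cdot)$ (independent of $\nu$). **Duality and operators.** If the martingale dimension is one and $b$ is minimal energy-dominant, $\star_b:L^2(X,\nu_b)\to\mathcal H$, $\star_bg:=gb$, is an isometric isomorphism. $\mathcal C_B:=\{f\in\mathcal C:f|_B\equiv0\}$, $\partial_B:=\partial|_{\mathcal C_B}$. For $v\in\mathcal H$, $v\in\ker\partial_B^\ast$ (resp. $v\in\ker\partial^\ast$) means $\langle v,\partial\varphi\rangle_{\mathcal H}=0$ for all $\varphi\in\mathcal C_B$ (resp. $\varphi\in\mathcal C$). $(\partial^\ast,\mathcal D(\partial^\ast))$ and $(\partial_B^\ast,\mathcal D(\partial_B^\ast))$ are the adjoints (from $\mathcal H$ to $L^2(X,\nu_b)$) of the densely defined operators $(\partial,\mathcal C)$, $(\partial_B,\mathcal C_B)$ from $L^2(X,\nu_b)$ to $\mathcal H$. $\mathcal D(\partial^\bot):=\star_b^{-1}\mathcal D(\partial^\ast)$, $\partial^\bot f:=-\partial^\ast\star_bf$; $\mathcal D(\partial_B^\bot):=\star_b^{-1}\mathcal D(\partial_B^\ast)$, $\partial_B^\bot f:=-\partial_B^\ast\star_bf$. If $b\in\ker\partial_B^\ast$, then $\mathcal C\subset\mathcal D(\partial_B^\bot)$ and $\partial_B^\bot f=\star_b^{-1}\partial f$ for $f\in\mathcal C$. **Completeness.** The form is complete with respect to $p\in X\setminus B$ if $\mathbf 1\in\mathcal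 C$, $\ker\partial=\mathbb R$ (constants), $\mathcal C_p:=\{f\in\mathcal C:f(p)=0\}$ is a Hilbert space with scalar product $\mathcal E$, and $\|f\|_{\sup}\le c_p\mathcal E(f)^{1/2}$ for $f\in\mathcal C_p$ with some $c_p>0$. Then $X$ is compact and $\mathcal H=\partial(\mathcal C)\oplus\ker\partial^\ast$ orthogonally. **Laplacian, normal parts, Neumann problem** (with $\nu=\nu_b$). $u\in\mathcal C$ is in $\mathcal D(\Delta_B)$ with $\Delta_Bu=f\in L^2(X,\nu)$ if $\mathcal E(u,\varphi)=-\int_Xf\varphi\,d\nu$ for all $\varphi\in\mathcal C_B$; equivalently, $\partial u\in\mathcal D(\partial_B^\ast)$ and $\Delta_Bu=-\partial_B^\ast\partial u$. Hence any $f=g+\star_b^{-1}\partial u+w$ with $g\in\mathcal C$, $u\in\mathcal D(\Delta_B)$, $w\in\ker\partial^\bot$ lies in $\mathcal D(\partial_B^\bot)$, so that $\partial_B^\bot f$ and $n_B(fb)$ are meaningful for it. For $B\ne\emptyset$ and $v\in\mathcal D(\partial_B^\ast)$ the normal part $n_Bv\in\mathcal C^\ast$ is $n_Bv(\varphi):=\langle v,\partial\varphi\rangle_{\mathcal H}-\int_X(\partial_B^\ast v)\varphi\,d\nu$, $\varphi\in\mathcal C$; for $B=\emptyset$, $n_Bv:=0$. $(du)_B:=n_B\partial u$ for $u\in\mathcal D(\Delta_B)$. $n_Bb(g\,\cdot)$ is the functional $\varphi\mapsto n_Bb(g\varphi)$. For $f\in L^2(X,\nu)$ and $G\in\mathcal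 C^\ast$ vanishing on $\mathcal C_B$, $u\in\mathcal C$ is a weak solution of $\Delta_Bu=f$ on $X\setminus B$, $(du)_B=G$ on $B$, if $\mathcal E(u,\varphi)=G(\varphi)-\int_Xf\varphi\,d\nu$ for all $\varphi\in\mathcal C$. For $B=\emptyset$ this is read as the Poisson equation $\Delta u=f$ on $X$ (with $G=0$). **The space $\hat{\mathcal D}(\partial_B^\bot)$** is the completion of $\mathcal D(\partial_B^\bot)/\ker\partial_B^\bot$ in the norm $\|\partial_B^\bot f\|_{L^2(X,\nu_b)}$. Since $\mathcal C\cap\ker\partial_B^\bot=\mathbb R$, $\mathcal C/\mathbb R$ is regarded as a (closed) subspace of it.
   Formalization: In (i) every g in C occurs, so (ii), (iii) fail literally (X=[0,1], B={0,1}, b=dx, f=x: g=x or g=0); here (iii) says some representation has g projecting f onto C/R, and (ii) compares only representations whose g and g-tilde are both such projections. *)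

theory Defs
  imports "HOL-Analysis.Analysis" "Jordan_Normal_Form.DL_Rank"
begin

section \<open>Admissible forms\<close>

definition Cc :: "('x::metric_space \<Rightarrow> real) set" where
  "Cc = {f. continuous_on UNIV f \<and> compact (closure {x. f x \<noteq> 0})}"

definition sup_norm :: "('x \<Rightarrow> real) \<Rightarrow> real" where
  "sup_norm f = (SUP x. \<bar>f x\<bar>)"

definition fun_subspace :: "('i \<Rightarrow> real) set \<Rightarrow> bool" where
  "fun_subspace V \<longleftrightarrow> (\<lambda>x. 0) \<in> V
     \<and> (\<forall>f\<in>V. \<forall>g\<in>V. (\<lambda>x. f x + g x) \<in> V)
     \<and> (\<forall>c. \<forall>f\<in>V. (\<lambda>x. c * f x) \<in> V)"

definition fun_linear_on :: "('i \<Rightarrow> real) set \<Rightarrow> (('i \<Rightarrow> real) \<Rightarrow> 'v::real_vector) \<Rightarrow> bool" where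
  "fun_linear_on V T \<longleftrightarrow> (\<forall>f\<in>V. \<forall>g\<in>V. T (\<lambda>x. f x + g x) = T f + T g)
     \<and> (\<forall>c. \<forall>f\<in>V. T (\<lambda>x. c * f x) = c *\<^sub>R T f)"

definition admissible_form ::
  "('x::metric_space \<Rightarrow> real) set \<Rightarrow> (('x \<Rightarrow> real) \<Rightarrow> ('x \<Rightarrow> real) \<Rightarrow> real) \<Rightarrow> bool" where
  "admissible_form C E \<longleftrightarrow>
     C \<subseteq> Cc \<and> fun_subspace C \<and> (\<forall>f\<in>C. \<forall>g\<in>C. (\<lambda>x. f x * g x) \<in> C)
   \<and> (\<forall>f\<in>C. fun_linear_on C (E f)) \<and> (\<forall>f\<in>C. \<forall>g\<in>C. E f g = E g f) \<and> (\<forall>f\<in>C. 0 \<le> E f f)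
   \<and> (\<forall>f\<in>Cc. \<forall>\<epsilon>>0. \<exists>g\<in>C. sup_norm (\<lambda>x. f x - g x) < \<epsilon>)
   \<and> (\<exists>D\<subseteq>C. countable D \<and>
        (\<forall>f\<in>C. \<forall>\<epsilon>>0. \<exists>g\<in>D. sqrt (E (\<lambda>x. f x - g x) (\<lambda>x. f x - g x)) < \<epsilon>))
   \<and> (\<forall>u\<in>C. (\<lambda>x. max (min (u x) 1) 0) \<in> C
        \<and> E (\<lambda>x. max (min (u x) 1) 0) (\<lambda>x. max (min (u x) 1) 0) \<le> E u u)
   \<and> (\<forall>f\<in>C. let L = (\<lambda>g. E (\<lambda>x. f x * g x) f - 1/2 * E (\<lambda>x. (f x)\<^sup>2) g) in
        (\<forall>g\<in>C. (\<forall>x. 0 \<le> g x) \<longrightarrow> 0 \<le> L g) \<and> (\<exists>K. \<forall>g\<in>C. \<bar>L g\<bar> \<le> K * sup_norm g))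
   \<and> (\<forall>f\<in>C. \<forall>g\<in>C.
        (\<exists>U a. open U \<and> closure {x. f x \<noteq> 0} \<subseteq> U \<and> (\<forall>x\<in>U. g x = a)) \<longrightarrow> E f g = 0)"


section \<open>Finite signed Borel measures\<close>

text \<open>A finite signed measure is a set function that is the difference of two finite Borel
  measures; it vanishes off the Borel sets because \<^const>\<open>measure\<close> does. On a locally compact
  separable metric space all of them are Radon.\<close>

definition is_decomposition ::
  "('x::topological_space set \<Rightarrow> real) \<Rightarrow> 'x measure \<Rightarrow> 'x measure \<Rightarrow> bool" where
  "is_decomposition \<sigma> M N \<longleftrightarrow> finite_measure M \<and> finite_measure N
     \<and> sets M = sets borel \<and> sets N = sets borel \<and> \<sigma> = (\<lambda>A. measure M A - measure N A)"

definition finite_signed_measure :: "('x::topological_space set \<Rightarrow> real) \<Rightarrow> bool" where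
  "finite_signed_measure \<sigma> \<longleftrightarrow> (\<exists>M N. is_decomposition \<sigma> M N)"

text \<open>Only used for bounded Borel integrands, where the value does not depend on the
  decomposition.\<close>

definition signed_integral ::
  "('x::topological_space set \<Rightarrow> real) \<Rightarrow> ('x \<Rightarrow> real) \<Rightarrow> real" where
  "signed_integral \<sigma> g = (THE r. \<exists>M N. is_decomposition \<sigma> M N \<and>
     r = integral\<^sup>L M g - integral\<^sup>L N g)"

text \<open>The measure belonging to a nonnegative set function.\<close>

definition to_measure :: "('x::topological_space set \<Rightarrow> real) \<Rightarrow> 'x measure" where
  "to_measure \<sigma> = measure_of UNIV (sets borel) (\<lambda>A. ennreal (\<sigma> A))"

text \<open>A version of the Radon-Nikodym derivative of \<open>\<sigma>\<close> with respect to \<open>\<nu>\<close>.\<close>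

definition signed_density ::
  "'x::topological_space measure \<Rightarrow> ('x set \<Rightarrow> real) \<Rightarrow> 'x \<Rightarrow> real" where
  "signed_density \<nu> \<sigma> = (SOME d. integrable \<nu> d \<and>
     (\<forall>A\<in>sets borel. \<sigma> A = (LINT x:A|\<nu>. d x)))"


section \<open>First order structure\<close>

text \<open>The data built from a form: \<open>Alg\<close> and \<open>Form\<close> are \<open>\<C>\<close> and \<open>\<E>\<close>, \<open>Nu f\<^sub>1 f\<^sub>2\<close> is the mutual
  energy measure, \<open>Cls\<close> maps an element of the span of all \<open>avg g * du f\<close> to its class in the
  Hilbert space \<open>\<H>\<close>, realized as the type \<open>'h\<close>, and \<open>NuH v w\<close> is the measure of two vectors.
  \<open>first_order_structure\<close> states the properties that determine \<open>Nu\<close> and \<open>NuH\<close> uniquely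
  and \<open>\<H>\<close> with \<open>Cls\<close> up to an isometric isomorphism.\<close>

record ('x, 'h) form_structure =
  Alg :: "('x \<Rightarrow> real) set"
  Form :: "('x \<Rightarrow> real) \<Rightarrow> ('x \<Rightarrow> real) \<Rightarrow> real"
  Nu :: "('x \<Rightarrow> real) \<Rightarrow> ('x \<Rightarrow> real) \<Rightarrow> 'x set \<Rightarrow> real"
  Cls :: "('x \<times> 'x \<Rightarrow> real) \<Rightarrow> 'h"
  NuH :: "'h \<Rightarrow> 'h \<Rightarrow> 'x set \<Rightarrow> real"

definition du :: "('x \<Rightarrow> real) \<Rightarrow> 'x \<times> 'x \<Rightarrow> real" where
  "du f = (\<lambda>(x, y). f x - f y)"

definition avg :: "('x \<Rightarrow> real) \<Rightarrow> 'x \<times> 'x \<Rightarrow> real" where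
  "avg g = (\<lambda>(x, y). (g x + g y) / 2)"

definition one_form_span :: "('x::metric_space \<Rightarrow> real) set \<Rightarrow> ('x \<times> 'x \<Rightarrow> real) set" where
  "one_form_span C = {\<lambda>z. \<Sum>i<n. avg (g i) z * du (f i) z | (n::nat) g f.
     \<forall>i<n. g i \<in> Cc \<and> f i \<in> C}"

definition energy_measures ::
  "('x::metric_space, 'h) form_structure \<Rightarrow> bool" where
  "energy_measures S \<longleftrightarrow> (\<forall>f\<^sub>1\<in>Alg S. \<forall>f\<^sub>2\<in>Alg S. finite_signed_measure (Nu S f\<^sub>1 f\<^sub>2) \<and>
     (\<forall>g\<in>Alg S. signed_integral (Nu S f\<^sub>1 f\<^sub>2) g =
        1/2 * (Form S (\<lambda>x. f\<^sub>1 x * g x) f\<^sub>2 + Form S f\<^sub>1 (\<lambda>x. f\<^sub>2 x * g x)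
               - Form S (\<lambda>x. f\<^sub>1 x * f\<^sub>2 x) g)))"

definition hilbert_space_of_forms ::
  "('x::metric_space, 'h::{real_inner, complete_space}) form_structure \<Rightarrow> bool" where
  "hilbert_space_of_forms S \<longleftrightarrow>
     fun_linear_on (one_form_span (Alg S)) (Cls S)
   \<and> (\<forall>g\<^sub>1\<in>Cc. \<forall>f\<^sub>1\<in>Alg S. \<forall>g\<^sub>2\<in>Cc. \<forall>f\<^sub>2\<in>Alg S.
        inner (Cls S (\<lambda>z. avg g\<^sub>1 z * du f\<^sub>1 z)) (Cls S (\<lambda>z. avg g\<^sub>2 z * du f\<^sub>2 z)) =
        signed_integral (Nu S f\<^sub>1 f\<^sub>2) (\<lambda>x. g\<^sub>1 x * g\<^sub>2 x))
   \<and> closure (Cls S ` one_form_span (Alg S)) = UNIV"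

definition vector_measures ::
  "('x::metric_space, 'h::{real_inner, complete_space}) form_structure \<Rightarrow> bool" where
  "vector_measures S \<longleftrightarrow>
     (\<forall>v w. finite_signed_measure (NuH S v w))
   \<and> (\<forall>A\<in>sets borel. bounded_bilinear (\<lambda>v w. NuH S v w A))
   \<and> (\<forall>g\<^sub>1\<in>Cc. \<forall>f\<^sub>1\<in>Alg S. \<forall>g\<^sub>2\<in>Cc. \<forall>f\<^sub>2\<in>Alg S. \<forall>A\<in>sets borel.
        NuH S (Cls S (\<lambda>z. avg g\<^sub>1 z * du f\<^sub>1 z)) (Cls S (\<lambda>z. avg g\<^sub>2 z * du f\<^sub>2 z)) A =
        signed_integral (Nu S f\<^sub>1 f\<^sub>2) (\<lambda>x. g\<^sub>1 x * g\<^sub>2 x * indicator A x))"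

definition first_order_structure ::
  "('x::metric_space, 'h::{real_inner, complete_space}) form_structure \<Rightarrow> bool" where
  "first_order_structure S \<longleftrightarrow>
     energy_measures S \<and> hilbert_space_of_forms S \<and> vector_measures S"

text \<open>The derivation \<open>\<partial>\<close>. The function \<open>d\<^sub>u f\<close> lies in the span when the constant \<open>1\<close> is
  in \<open>C\<^sub>c(X)\<close>, as is the case for every complete form; for other forms this definition
  would have to be replaced by a limit.\<close>

definition grad :: "('x, 'h) form_structure \<Rightarrow> ('x \<Rightarrow> real) \<Rightarrow> 'h" where
  "grad S f = Cls S (du f)"

definition nu_vec ::
  "('x::metric_space, 'h) form_structure \<Rightarrow> 'h \<Rightarrow> 'x measure" where
  "nu_vec S v = to_measure (NuH S v v)"

definition mult ::
  "('x::metric_space, 'h::real_normed_vector) form_structure \<Rightarrow> ('x \<Rightarrow> real) \<Rightarrow> 'h \<Rightarrow> 'h" where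
  "mult S g = (THE T. bounded_linear T \<and> (\<forall>h\<in>Cc. \<forall>f\<in>Alg S.
     T (Cls S (\<lambda>z. avg h z * du f z)) = Cls S (\<lambda>z. avg (\<lambda>x. g x * h x) z * du f z)))"

text \<open>Elements of \<open>L\<^sup>2\<close> are represented by functions, so equality in \<open>L\<^sup>2\<close> is equality
  almost everywhere.\<close>

definition L2 :: "'x measure \<Rightarrow> ('x \<Rightarrow> real) set" where
  "L2 \<nu> = {f \<in> borel_measurable \<nu>. integrable \<nu> (\<lambda>x. (f x)\<^sup>2)}"

text \<open>\<open>star S b g\<close> is \<open>g b\<close> for \<open>g\<close> in \<open>L\<^sup>2(X, \<nu>\<^sub>b)\<close>, the extension of the action of
  \<open>C\<^sub>c(X)\<close> by isometry.\<close>

definition star ::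
  "('x::metric_space, 'h::real_normed_vector) form_structure \<Rightarrow> 'h \<Rightarrow> ('x \<Rightarrow> real) \<Rightarrow> 'h" where
  "star S b g = (THE v. \<exists>s. (\<forall>n. s n \<in> Cc)
     \<and> (\<lambda>n. LINT x|nu_vec S b. (s n x - g x)\<^sup>2) \<longlonglongrightarrow> 0
     \<and> (\<lambda>n. mult S (s n) b) \<longlonglongrightarrow> v)"

definition star_inv ::
  "('x::metric_space, 'h::real_normed_vector) form_structure \<Rightarrow> 'h \<Rightarrow> 'h \<Rightarrow> 'x \<Rightarrow> real" where
  "star_inv S b v = (SOME g. g \<in> L2 (nu_vec S b) \<and> star S b g = v)"


section \<open>Energy dominance and martingale dimension\<close>

definition energy_dominant ::
  "('x::metric_space, 'h) form_structure \<Rightarrow> 'x measure \<Rightarrow> bool" where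
  "energy_dominant S \<nu> \<longleftrightarrow> sigma_finite_measure \<nu> \<and> sets \<nu> = sets borel
     \<and> (\<forall>f\<in>Alg S. absolutely_continuous \<nu> (to_measure (Nu S f f)))"

definition minimal_energy_dominant ::
  "('x::metric_space, 'h) form_structure \<Rightarrow> 'x measure \<Rightarrow> bool" where
  "minimal_energy_dominant S \<nu> \<longleftrightarrow> energy_dominant S \<nu>
     \<and> (\<forall>\<nu>'. energy_dominant S \<nu>' \<longrightarrow> absolutely_continuous \<nu>' \<nu>)"

definition form_null_set :: "('x::metric_space, 'h) form_structure \<Rightarrow> 'x set \<Rightarrow> bool" where
  "form_null_set S A \<longleftrightarrow> A \<in> sets borel \<and> (\<exists>\<nu>. minimal_energy_dominant S \<nu> \<and> A \<in> null_sets \<nu>)"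

definition bounds_rank ::
  "('x::metric_space, 'h) form_structure \<Rightarrow> 'x measure \<Rightarrow> ('x \<Rightarrow> enat) \<Rightarrow> bool" where
  "bounds_rank S \<nu> p \<longleftrightarrow> (\<forall>N f. (\<forall>i<N. f i \<in> Alg S) \<longrightarrow>
     (AE x in \<nu>. enat (vec_space.rank N
        (Matrix.mat N N (\<lambda>(i, j). signed_density \<nu> (Nu S (f i) (f j)) x))) \<le> p x))"

definition pointwise_index ::
  "('x::metric_space, 'h) form_structure \<Rightarrow> 'x measure \<Rightarrow> ('x \<Rightarrow> enat) \<Rightarrow> bool" where
  "pointwise_index S \<nu> p \<longleftrightarrow> p \<in> measurable borel (count_space UNIV) \<and> bounds_rank S \<nu> p
     \<and> (\<forall>q \<in> measurable borel (count_space UNIV). bounds_rank S \<nu> q \<longrightarrow> (AE x in \<nu>. p x \<le> q x))"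

definition martingale_dimension :: "('x::metric_space, 'h) form_structure \<Rightarrow> enat \<Rightarrow> bool" where
  "martingale_dimension S d \<longleftrightarrow> (\<exists>\<nu> p. minimal_energy_dominant S \<nu> \<and> pointwise_index S \<nu> p
     \<and> d = Inf {c. AE x in \<nu>. p x \<le> c})"


section \<open>Completeness\<close>

definition complete_wrt ::
  "('x::metric_space, 'h::zero) form_structure \<Rightarrow> 'x \<Rightarrow> bool" where
  "complete_wrt S p \<longleftrightarrow>
     (let Cp = {f \<in> Alg S. f p = 0}; E = (\<lambda>f. Form S f f) in
       (\<lambda>x. 1) \<in> Alg S
     \<and> {f \<in> Alg S. grad S f = 0} = range (\<lambda>c x. c)
     \<and> (\<forall>f\<in>Cp. E f = 0 \<longrightarrow> f = (\<lambda>x. 0))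
     \<and> (\<forall>s. (\<forall>n. s n \<in> Cp) \<and>
          (\<forall>\<epsilon>>0. \<exists>n\<^sub>0. \<forall>m\<ge>n\<^sub>0. \<forall>n\<ge>n\<^sub>0. sqrt (E (\<lambda>x. s m x - s n x)) < \<epsilon>) \<longrightarrow>
          (\<exists>f\<in>Cp. (\<lambda>n. sqrt (E (\<lambda>x. s n x - f x))) \<longlonglongrightarrow> 0))
     \<and> (\<exists>c>0. \<forall>f\<in>Cp. sup_norm f \<le> c * sqrt (E f)))"


section \<open>Adjoints and the operators in duality\<close>

text \<open>In this section and the next one, all operators are taken with respect to
  \<open>\<nu>\<^sub>b = nu_vec S b\<close>. Since \<open>\<C>\<^sub>\<emptyset> = \<C>\<close>, the operators without subscript \<open>B\<close> are those for
  \<open>B = {}\<close>.\<close>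

definition AlgB :: "('x, 'h) form_structure \<Rightarrow> 'x set \<Rightarrow> ('x \<Rightarrow> real) set" where
  "AlgB S B = {f \<in> Alg S. \<forall>x\<in>B. f x = 0}"

definition ker_adj :: "('x, 'h::real_inner) form_structure \<Rightarrow> 'x set \<Rightarrow> 'h set" where
  "ker_adj S B = {v. \<forall>\<phi>\<in>AlgB S B. inner v (grad S \<phi>) = 0}"

definition is_adj ::
  "('x::metric_space, 'h::real_inner) form_structure \<Rightarrow> 'h \<Rightarrow> 'x set \<Rightarrow> 'h \<Rightarrow> ('x \<Rightarrow> real) \<Rightarrow> bool"
where
  "is_adj S b B v h \<longleftrightarrow> h \<in> L2 (nu_vec S b) \<and>
     (\<forall>\<phi>\<in>AlgB S B. inner v (grad S \<phi>) = (LINT x|nu_vec S b. h x * \<phi> x))"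

definition dom_adj ::
  "('x::metric_space, 'h::real_inner) form_structure \<Rightarrow> 'h \<Rightarrow> 'x set \<Rightarrow> 'h set" where
  "dom_adj S b B = {v. \<exists>h. is_adj S b B v h}"

definition adj ::
  "('x::metric_space, 'h::real_inner) form_structure \<Rightarrow> 'h \<Rightarrow> 'x set \<Rightarrow> 'h \<Rightarrow> 'x \<Rightarrow> real" where
  "adj S b B v = (SOME h. is_adj S b B v h)"

definition dom_perp ::
  "('x::metric_space, 'h::real_inner) form_structure \<Rightarrow> 'h \<Rightarrow> 'x set \<Rightarrow> ('x \<Rightarrow> real) set" where
  "dom_perp S b B = {f \<in> L2 (nu_vec S b). star S b f \<in> dom_adj S b B}"

definition perp ::
  "('x::metric_space, 'h::real_inner) form_structure \<Rightarrow> 'h \<Rightarrow> 'x set \<Rightarrow> ('x \<Rightarrow> real) \<Rightarrow> 'x \<Rightarrow> real"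
where
  "perp S b B f = (\<lambda>x. - adj S b B (star S b f) x)"

definition ker_perp ::
  "('x::metric_space, 'h::real_inner) form_structure \<Rightarrow> 'h \<Rightarrow> 'x set \<Rightarrow> ('x \<Rightarrow> real) set" where
  "ker_perp S b B = {f \<in> dom_perp S b B. AE x in nu_vec S b. perp S b B f x = 0}"


section \<open>Laplacian, normal parts and the Neumann problem\<close>

definition dom_laplacian ::
  "('x::metric_space, 'h::real_inner) form_structure \<Rightarrow> 'h \<Rightarrow> 'x set \<Rightarrow> ('x \<Rightarrow> real) set" where
  "dom_laplacian S b B = {u \<in> Alg S. \<exists>f \<in> L2 (nu_vec S b).
     \<forall>\<phi>\<in>AlgB S B. Form S u \<phi> = - (LINT x|nu_vec S b. f x * \<phi> x)}"

definition dual_Alg :: "('x, 'h) form_structure \<Rightarrow> (('x \<Rightarrow> real) \<Rightarrow> real) set" where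
  "dual_Alg S = {G. fun_linear_on (Alg S) G \<and>
     (\<exists>K. \<forall>\<phi>\<in>Alg S. \<bar>G \<phi>\<bar> \<le> K * (sqrt (Form S \<phi> \<phi>) + sup_norm \<phi>))}"

definition normal_part ::
  "('x::metric_space, 'h::real_inner) form_structure \<Rightarrow> 'h \<Rightarrow> 'x set \<Rightarrow> 'h \<Rightarrow> ('x \<Rightarrow> real) \<Rightarrow> real"
where
  "normal_part S b B v \<phi> = (if B = {} then 0
     else inner v (grad S \<phi>) - (LINT x|nu_vec S b. adj S b B v x * \<phi> x))"

text \<open>\<open>u\<close> is a weak solution of \<open>\<Delta>\<^sub>B u = f\<close> on \<open>X - B\<close>, \<open>(du)\<^sub>B = G\<close> on \<open>B\<close>. For \<open>B = {}\<close> the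
  condition that \<open>G\<close> vanishes on \<open>\<C>\<^sub>\<emptyset> = \<C>\<close> forces \<open>G = 0\<close> and leaves the Poisson equation.\<close>

definition weak_neumann_solution ::
  "('x::metric_space, 'h::real_inner) form_structure \<Rightarrow> 'h \<Rightarrow> 'x set \<Rightarrow> ('x \<Rightarrow> real) \<Rightarrow>
   (('x \<Rightarrow> real) \<Rightarrow> real) \<Rightarrow> ('x \<Rightarrow> real) \<Rightarrow> bool" where
  "weak_neumann_solution S b B f G u \<longleftrightarrow>
     f \<in> L2 (nu_vec S b) \<and> G \<in> dual_Alg S \<and> (\<forall>\<phi>\<in>AlgB S B. G \<phi> = 0) \<and> u \<in> Alg S
   \<and> (\<forall>\<phi>\<in>Alg S. Form S u \<phi> = G \<phi> - (LINT x|nu_vec S b. f x * \<phi> x))"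

definition neumann_representation ::
  "('x::metric_space, 'h::real_inner) form_structure \<Rightarrow> 'h \<Rightarrow> 'x set \<Rightarrow> ('x \<Rightarrow> real) \<Rightarrow>
   ('x \<Rightarrow> real) \<Rightarrow> ('x \<Rightarrow> real) \<Rightarrow> ('x \<Rightarrow> real) \<Rightarrow> bool" where
  "neumann_representation S b B f g u w \<longleftrightarrow>
     (AE x in nu_vec S b. f x = g x + star_inv S b (grad S u) x + w x)
   \<and> g \<in> Alg S \<and> u \<in> dom_laplacian S b B
   \<and> weak_neumann_solution S b B
       (\<lambda>x. perp S b B f x - star_inv S b (grad S g) x)
       (\<lambda>\<phi>. normal_part S b B (star S b f) \<phi> - normal_part S b B b (\<lambda>x. g x * \<phi> x)) u
   \<and> w \<in> ker_perp S b {}"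


section \<open>The completion of the domain modulo the kernel\<close>

text \<open>\<open>J f\<close> is the class of \<open>f\<close> modulo the kernel, as an element of the completion \<open>'k\<close>.\<close>

definition perp_completion ::
  "('x::metric_space, 'h::real_inner) form_structure \<Rightarrow> 'h \<Rightarrow> 'x set \<Rightarrow>
   (('x \<Rightarrow> real) \<Rightarrow> 'k::{real_inner, complete_space}) \<Rightarrow> bool" where
  "perp_completion S b B J \<longleftrightarrow> fun_linear_on (dom_perp S b B) J
   \<and> (\<forall>f\<in>dom_perp S b B. norm (J f) = sqrt (LINT x|nu_vec S b. (perp S b B f x)\<^sup>2))
   \<and> closure (J ` dom_perp S b B) = UNIV"

text \<open>\<open>neumann_representation\<close> alone does not determine \<open>g\<close>: every \<open>g\<close> in \<open>\<C>\<close> occurs for every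
  \<open>f\<close> in the domain, by decomposing \<open>(f - g) b\<close> into a gradient and an element of the kernel of
  the adjoint. It becomes unique up to constants for the \<open>g\<close> whose class is the
  orthogonal projection of the class of \<open>f\<close> to \<open>J ` Alg S\<close>, the space \<open>\<C>/\<real>\<close>.\<close>

definition orthogonal_projection :: "'k::real_inner set \<Rightarrow> 'k \<Rightarrow> 'k \<Rightarrow> bool" where
  "orthogonal_projection M x z \<longleftrightarrow> z \<in> M \<and> (\<forall>y\<in>M. inner (x - z) y = 0)"

end

theory Submission
  imports Defs "Jordan_Normal_Form.DL_Rank_Submatrix"
begin

text \<open>The main point is that martingale dimension one makes \<open>g \<mapsto> g b\<close> surjective. If \<open>w\<close> is orthogonal
  to all \<open>g b\<close>, then \<open>\<nu>\<^bsub>b,w\<^esub> = 0\<close>. For simple vectors \<open>v\<close>, \<open>v'\<close> the rank one condition makes the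
  Cauchy-Schwarz inequality between the densities of \<open>\<nu>\<^bsub>v,v'\<^esub>\<close>, \<open>\<nu>\<^bsub>v\<^esub>\<close> and \<open>\<nu>\<^bsub>v'\<^esub>\<close> an equality. Approximating
  \<open>b\<close> and \<open>w\<close> by simple vectors one obtains Borel sets \<open>D\<^sub>n\<close> such that \<open>\<nu>\<^sub>w D\<^sub>n\<close> and \<open>\<nu>\<^sub>b (- D\<^sub>n)\<close> tend
  to \<open>0\<close>, and absolute continuity of \<open>\<nu>\<^sub>w\<close> with respect to \<open>\<nu>\<^sub>b\<close> then forces \<open>w = 0\<close>.

  Given \<open>f\<close> and any \<open>g\<close> in \<open>\<C>\<close>, the decomposition of \<open>(f - g) b\<close> into \<open>\<partial>u\<close> and an element of the kernel
  of the adjoint gives the representation; the Leibniz rule for \<open>\<partial>(g \<phi>)\<close>, paired with \<open>b\<close>, shows that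
  \<open>u\<close> solves the Neumann problem. The map \<open>f \<mapsto> (\<partial>\<^sub>B\<^sup>\<bottom> f) b\<close> embeds the completion isometrically
  and sends \<open>g\<close> to \<open>\<partial>g\<close>, so that projecting onto \<open>\<C>/\<real>\<close> is the same as decomposing \<open>(\<partial>\<^sub>B\<^sup>\<bottom> f) b\<close>.\<close>

text \<open>The rank condition concerns finitely many elements of C at a time, while
  \<open>b\<close> and a vector orthogonal to all \<open>g b\<close> are only limits of simple
  vectors. So the equality case of Cauchy-Schwarz has to be used with an error term. If a, c \<ge> 0
  and s^2 = a c, then min(a, c) \<le> |s|; a mixed measure of small total variation therefore makes
  the two diagonal measures nearly mutually singular, and this survives the passage to the limit.
  The integral against a signed measure, the action of functions on vectors, its extension to L2,
  densities and adjoints are all given by description or choice operators, so each of them must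
  first be shown to denote. For adjoints this means that C_B is dense in L2, which is where
  \<open>B\<close> being closed and null enters. The constant \<open>c\<close> of the uniqueness
  claim arises because \<open>g\<close> is fixed only up to constants: adding \<open>c\<close> to
  \<open>g\<close> adds \<open>c b\<close> to \<open>g b\<close>, and the gradient part and the
  kernel part of \<open>c b\<close> must be taken out of the other two summands.\<close>

section \<open>Measures and continuous functions\<close>

text \<open>Weighted lists of measures stand in for linear combinations, which do not exist for \<^typ>\<open>'a measure\<close>.\<close>

lemma integral_zero_from_indicators:
  fixes L :: "(('x::topological_space \<Rightarrow> real) \<times> 'x measure) list"
  assumes L: "\<And>q M. (q, M) \<in> set L \<Longrightarrow> integrable M q \<and> sets M = sets borel"
    and zero: "\<And>A. A \<in> sets borel \<Longrightarrow> (\<Sum>(q, M)\<leftarrow>L. LINT x|M. q x * indicator A x) = 0"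
    and k: "k \<in> borel_measurable borel" "\<And>x. \<bar>k x\<bar> \<le> K"
  shows "(\<Sum>(q, M)\<leftarrow>L. LINT x|M. q x * k x) = 0"
proof -
  have I: "integrable M (\<lambda>x. q x * k x)"
    if "(q, M) \<in> set L" "k \<in> borel_measurable borel" "\<And>x. \<bar>k x\<bar> \<le> K" for q M k K
  proof (rule Bochner_Integration.integrable_bound)
    have "integrable M q" and M: "sets M = sets borel" using L that by auto
    then show "integrable M (\<lambda>x. K * q x)" by auto
    have [measurable]: "q \<in> borel_measurable M" "k \<in> borel_measurable M"
      using \<open>integrable M q\<close> that(2) by (auto simp: measurable_cong_sets[OF M refl])
    show "(\<lambda>x. q x * k x) \<in> borel_measurable M" by measurable
    have "\<bar>q x * k x\<bar> \<le> \<bar>K * q x\<bar>" for x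
    proof -
      have "\<bar>k x\<bar> \<le> \<bar>K\<bar>" using that(3)[of x] by linarith
      then show ?thesis by (simp add: abs_mult mult.commute mult_right_mono)
    qed
    then show "AE x in M. norm (q x * k x) \<le> norm (K * q x)" by simp
  qed
  \<comment> \<open>\<open>K\<close> is generalized in the induction because passing from
    \<open>c * u\<close> to \<open>u\<close> changes the bound to \<open>K / c\<close>. For
    \<open>c = 0\<close> no bound on \<open>u\<close> remains, but then all integrals
    vanish.\<close>
  have P: "(\<Sum>(q, M)\<leftarrow>L. LINT x|M. q x * k x) = 0"
    if "k \<in> borel_measurable borel" "\<And>x. 0 \<le> k x" "\<And>x. k x \<le> K" for k K
    using that
  proof (induction arbitrary: K rule: borel_measurable_induct_real)
    case (set A)
    then show ?case using zero by simp
  next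
    case (mult u c)
    show ?case
    proof (cases "c = 0")
      case True
      then show ?thesis by (simp add: case_prod_unfold)
    next
      case False
      then have "u x \<le> K / c" for x
        using mult.prems[of x] mult.hyps by (simp add: field_simps)
      then have "(\<Sum>(q, M)\<leftarrow>L. LINT x|M. q x * u x) = 0" by (rule mult.IH)
      then have "(\<Sum>(q, M)\<leftarrow>L. c * (LINT x|M. q x * u x)) = 0"
        by (simp add: case_prod_unfold sum_list_const_mult)
      then show ?thesis by (simp add: mult.left_commute)
    qed
  next
    case (add u v)
    have uK: "u x \<le> K" and vK: "v x \<le> K" for x
      using add.prems[of x] add.hyps(2,4)[of x] by linarith+
    have "(\<Sum>(q, M)\<leftarrow>L. LINT x|M. q x * (v x + u x)) =
      (\<Sum>(q, M)\<leftarrow>L. (LINT x|M. q x * v x) + (LINT x|M. q x * u x))"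
    proof (intro arg_cong[where f=sum_list] map_cong refl, clarsimp)
      fix q M assume qM: "(q, M) \<in> set L"
      have "integrable M (\<lambda>x. q x * v x)" "integrable M (\<lambda>x. q x * u x)"
        using I[OF qM, of u K] I[OF qM, of v K] uK vK add.hyps by auto
      then show "(LINT x|M. q x * (v x + u x)) = (LINT x|M. q x * v x) + (LINT x|M. q x * u x)"
        by (simp add: ring_distribs)
    qed
    also have "\<dots> = 0"
      using add.IH(1)[OF uK] add.IH(2)[OF vK] by (simp add: case_prod_unfold sum_list_addf)
    finally show ?case .
  next
    case (seq U)
    have Uu: "U i x \<le> k x" for i x
      using incseq_le[of "\<lambda>i. U i x" "k x" i] seq.hyps(3,4) by (auto simp: incseq_def le_fun_def)
    then have UK: "U i x \<le> K" for i x using seq.prems[of x] order_trans by blast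
    have "(\<lambda>i. \<Sum>(q, M)\<leftarrow>L. LINT x|M. q x * U i x) \<longlonglongrightarrow> (\<Sum>(q, M)\<leftarrow>L. LINT x|M. q x * k x)"
    proof -
      have "\<forall>p\<in>set L. (\<lambda>i. LINT x|snd p. fst p x * U i x) \<longlonglongrightarrow> (LINT x|snd p. fst p x * k x)"
      proof clarsimp
        fix q M assume qM: "(q, M) \<in> set L"
        note M = L[OF qM]
        have meas: "U i \<in> borel_measurable M" "k \<in> borel_measurable M" for i
          using M seq.hyps(1) that(1) measurable_cong_sets[of M borel borel borel] by auto
        show "(\<lambda>i. LINT x|M. q x * U i x) \<longlonglongrightarrow> (LINT x|M. q x * k x)"
        proof (rule integral_dominated_convergence)
          show "integrable M (\<lambda>x. \<bar>K\<bar> * \<bar>q x\<bar>)" using M by auto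
          show "AE x in M. (\<lambda>i. q x * U i x) \<longlonglongrightarrow> q x * k x"
            using seq.hyps(4) by (auto intro!: tendsto_intros)
          have "\<bar>q x * U i x\<bar> \<le> \<bar>K\<bar> * \<bar>q x\<bar>" for i x
          proof -
            have "\<bar>U i x\<bar> \<le> \<bar>K\<bar>" using UK[of i x] seq.hyps(2)[of i x] by linarith
            then show ?thesis unfolding abs_mult by (metis mult.commute mult_left_mono abs_ge_zero)
          qed
          then show "AE x in M. norm (q x * U i x) \<le> \<bar>K\<bar> * \<bar>q x\<bar>" for i by simp
        qed (use M meas in auto)
      qed
      then have "(\<lambda>i. \<Sum>p\<leftarrow>L'. LINT x|snd p. fst p x * U i x) \<longlonglongrightarrow> (\<Sum>p\<leftarrow>L'. LINT x|snd p. fst p x * k x)"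
        if "set L' \<subseteq> set L" for L'
        using that by (induction L') (auto intro!: tendsto_intros)
      then show ?thesis by (simp add: case_prod_unfold)
    qed
    moreover have "(\<lambda>i. \<Sum>(q, M)\<leftarrow>L. LINT x|M. q x * U i x) = (\<lambda>i. 0)"
      using seq.IH[OF UK] by simp
    ultimately show ?case by (simp add: LIMSEQ_const_iff)
  qed
  define kp where "kp x = max (k x) 0" for x
  define km where "km x = max (- k x) 0" for x
  have meas: "kp \<in> borel_measurable borel" "km \<in> borel_measurable borel"
    unfolding kp_def[abs_def] km_def[abs_def] using k(1) by auto
  have bnd: "0 \<le> kp x" "0 \<le> km x" "kp x \<le> \<bar>K\<bar>" "km x \<le> \<bar>K\<bar>" for x
    using k(2)[of x] by (auto simp: kp_def km_def)
  have "(\<Sum>(q, M)\<leftarrow>L. LINT x|M. q x * k x) =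
      (\<Sum>(q, M)\<leftarrow>L. (LINT x|M. q x * kp x) - (LINT x|M. q x * km x))"
  proof (intro arg_cong[where f=sum_list] map_cong refl, clarsimp)
    fix q M assume qM: "(q, M) \<in> set L"
    have "integrable M (\<lambda>x. q x * kp x)" "integrable M (\<lambda>x. q x * km x)"
      using I[OF qM meas(1), of "\<bar>K\<bar>"] I[OF qM meas(2), of "\<bar>K\<bar>"] bnd by auto
    moreover have "k x = kp x - km x" for x by (auto simp: kp_def km_def)
    ultimately show "(LINT x|M. q x * k x) = (LINT x|M. q x * kp x) - (LINT x|M. q x * km x)"
      by (simp add: ring_distribs)
  qed
  also have "\<dots> = 0"
    using P[OF meas(1) bnd(1,3)] P[OF meas(2) bnd(2,4)]
    by (simp add: case_prod_unfold sum_list_subtractf)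
  finally show ?thesis .
qed

text \<open>Dominated convergence with majorant 1 on each finite measure; as \<open>I\<close> is
  finite, one index serves all of them.\<close>

lemma eventually_L1_close:
  fixes f :: "nat \<Rightarrow> 'x::topological_space \<Rightarrow> real"
  assumes I: "finite I" and M: "\<And>i. i \<in> I \<Longrightarrow> finite_measure (M i) \<and> sets (M i) = sets borel"
    and [measurable]: "\<And>n. f n \<in> borel_measurable borel" "g \<in> borel_measurable borel"
    and le: "\<And>n x. \<bar>f n x - g x\<bar> \<le> 1" and lim: "\<And>x. (\<lambda>n. f n x) \<longlonglongrightarrow> g x" and e: "(e::real) > 0"
  shows "\<exists>n. \<forall>i\<in>I. (LINT x|M i. \<bar>f n x - g x\<bar>) < e"
proof -
  have "\<forall>\<^sub>F n in sequentially. (LINT x|M i. \<bar>f n x - g x\<bar>) < e" if "i \<in> I" for i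
  proof -
    note Mi = M[OF that]
    have "(\<lambda>n. LINT x|M i. \<bar>f n x - g x\<bar>) \<longlonglongrightarrow> (LINT x|M i. 0)"
    proof (rule integral_dominated_convergence[where w = "\<lambda>_. 1"])
      show "(\<lambda>x. \<bar>f n x - g x\<bar>) \<in> borel_measurable (M i)" for n
        by (subst measurable_cong_sets[of "M i" borel]) (use Mi in auto)
      show "AE x in M i. (\<lambda>n. \<bar>f n x - g x\<bar>) \<longlonglongrightarrow> 0"
        using tendsto_rabs_zero[OF LIM_zero[OF lim]] by simp
    qed (use Mi le in \<open>auto intro: finite_measure.integrable_const\<close>)
    from order_tendstoD(2)[OF this, of e] show ?thesis using e by simp
  qed
  then have "\<forall>\<^sub>F n in sequentially. \<forall>i\<in>I. (LINT x|M i. \<bar>f n x - g x\<bar>) < e"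
    using I by (simp add: eventually_ball_finite)
  then show ?thesis by (auto dest!: eventually_happens)
qed

text \<open>Regularity of finite Borel measures on a metric space, by induction over the Dynkin
  class generated by the closed sets. One \<open>h\<close> has to serve several measures: a signed
  measure enters through both parts of a decomposition, and two signed measures get
  compared.\<close>

lemma continuous_approximates_indicator:
  fixes A :: "'x::metric_space set"
  assumes I: "finite I" and M: "\<And>i. i \<in> I \<Longrightarrow> finite_measure (M i) \<and> sets (M i) = sets borel"
    and A: "A \<in> sets borel" and e: "(e::real) > 0"
  shows "\<exists>h. continuous_on UNIV h \<and> (\<forall>x. 0 \<le> h x \<and> h x \<le> 1) \<and>
    (\<forall>i\<in>I. (LINT x|M i. \<bar>h x - indicator A x\<bar>) < e)"
proof -
  have int_bdd: "integrable (M i) f" if "i \<in> I" "f \<in> borel_measurable borel" "\<And>x. \<bar>f x\<bar> \<le> c"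
    for i f and c :: real
    using that M[OF that(1)] measurable_cong_sets[of "M i" borel]
    by (intro finite_measure.integrable_const_bound[where B=c]) auto
  have "Int_stable (Collect closed :: 'x set set)" by (auto simp: Int_stable_def)
  moreover have "(Collect closed :: 'x set set) \<subseteq> Pow UNIV" by simp
  moreover have "A \<in> sigma_sets UNIV (Collect closed)"
    using A by (simp add: borel_eq_closed)
  ultimately show ?thesis using e
  proof (induction arbitrary: e rule: sigma_sets_induct_disjoint)
    case (basic A)
    then have clA: "closed A" by simp
    show ?case
    \<comment> \<open>The empty set is separate because \<open>infdist x {} = 0\<close> would make
      the cutoff functions below constantly 1.\<close>
    proof (cases "A = {}")
      case True
      then show ?thesis using basic.prems by (intro exI[of _ "\<lambda>x. 0"]) auto
    next
      case False
      define h where "h n x = max 0 (1 - real n * infdist x A)" for n x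
      have hc: "continuous_on UNIV (h n)" for n
        unfolding h_def by (intro continuous_intros)
      have hb: "0 \<le> h n x" "h n x \<le> 1" for n x
        by (auto simp: h_def infdist_nonneg)
      have lim: "(\<lambda>n. h n x) \<longlonglongrightarrow> indicator A x" for x
      proof (cases "x \<in> A")
        case True
        then show ?thesis by (simp add: h_def)
      next
        case xA: False
        then have d: "infdist x A > 0"
          using clA False by (metis in_closed_iff_infdist_zero infdist_nonneg less_eq_real_def)
        obtain N where N: "1 / infdist x A < real N" using reals_Archimedean2 by blast
        have "h n x = 0" if "n \<ge> N" for n
        proof -
          have "1 / infdist x A < real n" using N that by linarith
          then show ?thesis using d by (simp add: h_def field_simps)
        qed
        then have "\<forall>\<^sub>F n in sequentially. h n x = 0" by (auto simp: eventually_sequentially)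
        then show ?thesis using xA by (simp add: tendsto_eventually)
      qed
      have hA: "h n \<in> borel_measurable borel" "A \<in> sets borel" for n
        using hc clA by (auto intro: borel_measurable_continuous_onI)
      have le: "\<bar>h n x - indicator A x\<bar> \<le> 1" for n x
        using hb[of n x] by (auto simp: indicator_def)
      have "\<exists>n. \<forall>i\<in>I. (LINT x|M i. \<bar>h n x - indicator A x\<bar>) < e"
        by (rule eventually_L1_close[OF I]) (use M hA le lim basic.prems in auto)
      then obtain n where "\<forall>i\<in>I. (LINT x|M i. \<bar>h n x - indicator A x\<bar>) < e" ..
      then show ?thesis using hc hb by blast
    qed
  next
    case empty
    then show ?case by (intro exI[of _ "\<lambda>x. 0"]) auto
  next
    case (compl A)
    from compl.IH[OF compl.prems] obtain h where h: "continuous_on UNIV h" "\<forall>x. 0 \<le> h x \<and> h x \<le> 1"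
      "\<forall>i\<in>I. (LINT x|M i. \<bar>h x - indicator A x\<bar>) < e" by blast
    have "\<bar>(1 - h x) - indicator (UNIV - A) x\<bar> = \<bar>h x - indicator A x\<bar>" for x
      by (auto simp: indicator_def)
    then show ?case using h
      by (intro exI[of _ "\<lambda>x. 1 - h x"]) (auto intro!: continuous_intros)
  next
    case (union A)
    have [measurable]: "A j \<in> sets borel" for j
      using union.hyps(2) by (auto simp: borel_eq_closed)
    define C where "C k = (\<Union>j<k. A j)" for k
    have [measurable]: "C k \<in> sets borel" for k by (auto simp: C_def)
    let ?U = "\<Union>i. A i"
    have [measurable]: "?U \<in> sets borel" by auto
    have lim: "(\<lambda>k. indicator (C k) x :: real) \<longlonglongrightarrow> indicator ?U x" for x
    proof (cases "x \<in> ?U")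
      case True
      then obtain j where "x \<in> A j" by auto
      then have "\<forall>\<^sub>F k in sequentially. (indicator (C k) x :: real) = 1"
        by (auto simp: eventually_sequentially C_def indicator_def intro!: exI[of _ "Suc j"])
      then show ?thesis using True by (simp add: tendsto_eventually)
    next
      case False
      then show ?thesis by (auto simp: C_def indicator_def)
    qed
    have b2: "\<bar>indicator (C k) x - indicator ?U x :: real\<bar> \<le> 1" for k x
      by (auto simp: indicator_def)
    have "\<exists>k. \<forall>i\<in>I. (LINT x|M i. \<bar>indicator (C k) x - indicator ?U x :: real\<bar>) < e/2"
      by (rule eventually_L1_close[OF I]) (use M lim b2 union.prems in auto)
    then obtain k where k: "\<forall>i\<in>I. (LINT x|M i. \<bar>indicator (C k) x - indicator ?U x :: real\<bar>) < e/2" ..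
    \<comment> \<open>Dividing by \<open>k + 1\<close> instead of \<open>k\<close> keeps
      \<open>d\<close> positive for \<open>k = 0\<close>.\<close>
    define d where "d = e / 2 / (real k + 1)"
    have d: "d > 0" using union.prems by (simp add: d_def)
    have "\<forall>j. \<exists>h. continuous_on UNIV h \<and> (\<forall>x. 0 \<le> h x \<and> h x \<le> 1) \<and>
      (\<forall>i\<in>I. (LINT x|M i. \<bar>h x - indicator (A j) x\<bar>) < d)"
      using union.IH[OF d] by blast
    then obtain h where h: "\<And>j. continuous_on UNIV (h j)" "\<And>j x. 0 \<le> h j x" "\<And>j x. h j x \<le> 1"
      "\<And>j i. i \<in> I \<Longrightarrow> (LINT x|M i. \<bar>h j x - indicator (A j) x\<bar>) < d" by metis
    have [measurable]: "h j \<in> borel_measurable borel" for j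
      using h(1) by (auto intro: borel_measurable_continuous_onI)
    \<comment> \<open>Truncation at 1 is 1-Lipschitz: it brings the sum back to [0, 1] without
      enlarging the error, and it turns the sum of the indicators into the indicator of
      \<open>C k\<close>.\<close>
    define H where "H x = min 1 (\<Sum>j<k. h j x)" for x
    have Hc: "continuous_on UNIV H" unfolding H_def using h(1) by (intro continuous_intros) auto
    have Hb: "0 \<le> H x" "H x \<le> 1" for x by (auto simp: H_def h(2) sum_nonneg)
    have [measurable]: "H \<in> borel_measurable borel"
      using Hc by (auto intro: borel_measurable_continuous_onI)
    have indC: "indicator (C k) x = min 1 (\<Sum>j<k. indicator (A j) x :: real)" for x
    proof (cases "x \<in> C k")
      case True
      then obtain j where j: "j < k" "x \<in> A j" by (auto simp: C_def)
      then have "(indicator (A j) x :: real) \<le> (\<Sum>j<k. indicator (A j) x)"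
        by (intro member_le_sum) auto
      then show ?thesis using j True by simp
    next
      case False
      then have "(\<Sum>j<k. indicator (A j) x :: real) = 0" by (auto simp: C_def)
      then show ?thesis using False by simp
    qed
    have pt: "\<bar>H x - indicator ?U x\<bar> \<le>
        (\<Sum>j<k. \<bar>h j x - indicator (A j) x\<bar>) + \<bar>indicator (C k) x - indicator ?U x\<bar>" for x
    proof -
      have "\<bar>H x - indicator (C k) x\<bar> \<le> \<bar>(\<Sum>j<k. h j x) - (\<Sum>j<k. indicator (A j) x)\<bar>"
        unfolding indC H_def by linarith
      also have "\<dots> \<le> (\<Sum>j<k. \<bar>h j x - indicator (A j) x\<bar>)"
        by (simp add: sum_subtractf[symmetric] sum_abs)
      finally show ?thesis by linarith
    qed
    have "(LINT x|M i. \<bar>H x - indicator ?U x\<bar>) < e" if i: "i \<in> I" for i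
    proof -
      have b1: "\<bar>h j x - indicator (A j) x\<bar> \<le> 1" for j x
        using h(2)[of j x] h(3)[of j x] by (auto simp: indicator_def)
      have b3: "\<bar>H x - indicator ?U x\<bar> \<le> 1" for x
        using Hb[of x] by (auto simp: indicator_def)
      have i1: "integrable (M i) (\<lambda>x. \<bar>h j x - indicator (A j) x\<bar>)" for j
        using b1 by (intro int_bdd[OF i, where c=1]) auto
      have i2: "integrable (M i) (\<lambda>x. \<bar>indicator (C k) x - indicator ?U x :: real\<bar>)"
        using b2 by (intro int_bdd[OF i, where c=1]) auto
      have i3: "integrable (M i) (\<lambda>x. \<bar>H x - indicator ?U x\<bar>)"
        using b3 by (intro int_bdd[OF i, where c=1]) auto
      have "(LINT x|M i. \<bar>H x - indicator ?U x\<bar>) \<le> (LINT x|M i.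
         (\<Sum>j<k. \<bar>h j x - indicator (A j) x\<bar>) + \<bar>indicator (C k) x - indicator ?U x\<bar>)"
        using pt by (intro integral_mono i3) (auto intro!: i1 i2)
      also have "\<dots> = (\<Sum>j<k. LINT x|M i. \<bar>h j x - indicator (A j) x\<bar>) +
         (LINT x|M i. \<bar>indicator (C k) x - indicator ?U x\<bar>)"
        using i1 i2 by simp
      also have "\<dots> < (\<Sum>j<k. d) + d + e/2"
      proof -
        have "(\<Sum>j<k. LINT x|M i. \<bar>h j x - indicator (A j) x\<bar>) \<le> (\<Sum>j<k. d)"
          using h(4)[OF i] by (intro sum_mono) (auto intro: less_imp_le)
        then show ?thesis using k i d by fastforce
      qed
      also have "\<dots> = e"
      proof -
        have "real k + 1 \<noteq> 0" by linarith
        then have "(real k + 1) * d = e / 2" unfolding d_def by (metis nonzero_eq_divide_eq mult.commute)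
        then show ?thesis by (simp add: algebra_simps)
      qed
      finally show ?thesis .
    qed
    then show ?case using Hc Hb by blast
  qed
qed

lemma finite_borel_integrable:
  fixes k :: "'x::topological_space \<Rightarrow> real"
  assumes "finite_measure M" "sets M = sets borel" "k \<in> borel_measurable borel" "\<And>x. \<bar>k x\<bar> \<le> K"
  shows "integrable M k"
  using assms measurable_cong_sets[OF assms(2), of borel borel]
  by (intro finite_measure.integrable_const_bound[where B=K]) auto

text \<open>Induction over integrable functions, starting from indicators. Boundedness of
  \<open>s\<close> is part of the claim since it yields integrability on a finite measure, and later
  membership in \<open>L2\<close>.\<close>

lemma continuous_L1_dense:
  fixes f :: "'x::metric_space \<Rightarrow> real"
  assumes M: "finite_measure M" "sets M = sets borel" and f: "integrable M f" and e: "(e::real) > 0"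
  shows "\<exists>s c. continuous_on UNIV s \<and> (\<forall>x. \<bar>s x\<bar> \<le> c) \<and> (LINT x|M. \<bar>s x - f x\<bar>) < e"
  using f e
proof (induction f arbitrary: e rule: integrable_induct)
  case (base A c)
  then have A: "A \<in> sets borel" using M by auto
  have "e / (\<bar>c\<bar> + 1) > 0" using base.prems by simp
  from continuous_approximates_indicator[of "{()}" "\<lambda>_. M" A, OF _ _ A this] M
  obtain h where h: "continuous_on UNIV h" "\<forall>x. 0 \<le> h x \<and> h x \<le> 1"
    "(LINT x|M. \<bar>h x - indicator A x\<bar>) < e / (\<bar>c\<bar> + 1)" by auto
  have "(LINT x|M. \<bar>c * h x - indicator A x *\<^sub>R c\<bar>) = \<bar>c\<bar> * (LINT x|M. \<bar>h x - indicator A x\<bar>)"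
    by (simp add: abs_mult[symmetric] right_diff_distrib mult.commute flip: integral_mult_right_zero)
  also have "\<dots> \<le> (\<bar>c\<bar> + 1) * (LINT x|M. \<bar>h x - indicator A x\<bar>)"
    by (intro mult_right_mono) auto
  also have "\<dots> < e" using h(3) by (simp add: field_simps)
  finally have "(LINT x|M. \<bar>c * h x - indicator A x *\<^sub>R c\<bar>) < e" .
  moreover have "\<bar>c * h x\<bar> \<le> \<bar>c\<bar>" for x
    using h(2) by (simp add: abs_mult mult_left_le)
  ultimately show ?case using h(1)
    by (intro exI[of _ "\<lambda>x. c * h x"] exI[of _ "\<bar>c\<bar>"]) (auto intro!: continuous_intros)
next
  case (add f g)
  have "e/2 > 0" using add.prems by simp
  from add.IH(1)[OF this] add.IH(2)[OF this] obtain s c t d where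
    s: "continuous_on UNIV s" "\<forall>x. \<bar>s x\<bar> \<le> c" "(LINT x|M. \<bar>s x - f x\<bar>) < e/2" and
    t: "continuous_on UNIV t" "\<forall>x. \<bar>t x\<bar> \<le> d" "(LINT x|M. \<bar>t x - g x\<bar>) < e/2"
    by blast
  have i: "integrable M s" "integrable M t"
    using s t M by (auto intro!: finite_borel_integrable borel_measurable_continuous_onI)
  have "(LINT x|M. \<bar>(s x + t x) - (f x + g x)\<bar>) \<le> (LINT x|M. \<bar>s x - f x\<bar> + \<bar>t x - g x\<bar>)"
    by (intro integral_mono) (use i add.hyps in \<open>auto\<close>)
  also have "\<dots> = (LINT x|M. \<bar>s x - f x\<bar>) + (LINT x|M. \<bar>t x - g x\<bar>)"
    using i add.hyps by simp
  also have "\<dots> < e" using s t by linarith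
  finally have "(LINT x|M. \<bar>(s x + t x) - (f x + g x)\<bar>) < e" .
  moreover have "\<bar>s x + t x\<bar> \<le> c + d" for x
    using s(2)[rule_format, of x] t(2)[rule_format, of x] by linarith
  ultimately show ?case using s(1) t(1)
    by (intro exI[of _ "\<lambda>x. s x + t x"] exI[of _ "c + d"]) (auto intro!: continuous_intros)
next
  case (lim f s)
  have "(\<lambda>i. LINT x|M. \<bar>s i x - f x\<bar>) \<longlonglongrightarrow> (LINT x|M. 0)"
  proof (rule integral_dominated_convergence)
    \<comment> \<open>The induction rule supplies
      \<open>\<bar>s i x\<bar> \<le> 2 * \<bar>f x\<bar>\<close>, hence the factor 3.\<close>
    show "integrable M (\<lambda>x. 3 * \<bar>f x\<bar>)" using lim by auto
    show "AE x in M. (\<lambda>i. \<bar>s i x - f x\<bar>) \<longlonglongrightarrow> 0"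
      using tendsto_rabs_zero[OF LIM_zero[OF lim.hyps(2)]] by simp
    have "\<bar>s i x - f x\<bar> \<le> 3 * \<bar>f x\<bar>" if "x \<in> space M" for i x
      using lim.hyps(3)[OF that, of i] by (auto simp: abs_le_iff)
    then show "AE x in M. norm \<bar>s i x - f x\<bar> \<le> 3 * \<bar>f x\<bar>" for i by simp
  qed (use lim in auto)
  from order_tendstoD(2)[OF this, of "e/2"] lim.prems obtain i where i: "(LINT x|M. \<bar>s i x - f x\<bar>) < e/2"
    by (auto dest!: eventually_happens)
  have "e/2 > 0" using lim.prems by simp
  from lim.IH[OF this, of i] obtain t c where
    t: "continuous_on UNIV t" "\<forall>x. \<bar>t x\<bar> \<le> c" "(LINT x|M. \<bar>t x - s i x\<bar>) < e/2" by blast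
  have ti: "integrable M t"
    using t M by (auto intro!: finite_borel_integrable borel_measurable_continuous_onI)
  have "(LINT x|M. \<bar>t x - f x\<bar>) \<le> (LINT x|M. \<bar>t x - s i x\<bar> + \<bar>s i x - f x\<bar>)"
    by (intro integral_mono) (use ti lim in \<open>auto\<close>)
  also have "\<dots> = (LINT x|M. \<bar>t x - s i x\<bar>) + (LINT x|M. \<bar>s i x - f x\<bar>)"
    using ti lim by simp
  also have "\<dots> < e" using t i by linarith
  finally show ?case using t by blast
qed

section \<open>Square integrable functions on a finite measure space\<close>

lemma L2_integrable:
  assumes "finite_measure M" "f \<in> L2 M" "g \<in> L2 M"
  shows "integrable M f" "integrable M (\<lambda>x. f x * g x)"
proof -
  note [measurable] = conjunct1[OF assms(2)[unfolded L2_def mem_Collect_eq]]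
    conjunct1[OF assms(3)[unfolded L2_def mem_Collect_eq]]
  have sq: "integrable M (\<lambda>x. (f x)\<^sup>2)" "integrable M (\<lambda>x. (g x)\<^sup>2)" "integrable M (\<lambda>x. 1 :: real)"
    using assms finite_measure.integrable_const[OF assms(1)] by (auto simp: L2_def)
  have am: "\<bar>a * b\<bar> \<le> a\<^sup>2 + b\<^sup>2" for a b :: real
  proof -
    have "0 \<le> (\<bar>a\<bar> - \<bar>b\<bar>)\<^sup>2" by simp
    also have "\<dots> = a\<^sup>2 + b\<^sup>2 - 2 * \<bar>a * b\<bar>" by (simp add: power2_diff abs_mult)
    finally show ?thesis using abs_ge_zero[of "a * b"] by linarith
  qed
  show "integrable M (\<lambda>x. f x * g x)"
    by (rule Bochner_Integration.integrable_bound[of M "\<lambda>x. (f x)\<^sup>2 + (g x)\<^sup>2"])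
      (use sq am in \<open>auto\<close>)
  show "integrable M f"
    by (rule Bochner_Integration.integrable_bound[of M "\<lambda>x. (f x)\<^sup>2 + 1"])
      (use sq am[of _ 1] in \<open>auto\<close>)
qed

lemma L2_add: "finite_measure M \<Longrightarrow> f \<in> L2 M \<Longrightarrow> g \<in> L2 M \<Longrightarrow> (\<lambda>x. f x + g x) \<in> L2 M"
  using L2_integrable(2)[of M f g] by (auto simp: L2_def power2_sum mult.assoc)

lemma L2_cmult: "f \<in> L2 M \<Longrightarrow> (\<lambda>x. c * f x) \<in> L2 M"
  by (auto simp: L2_def power_mult_distrib)

lemma L2_diff: "finite_measure M \<Longrightarrow> f \<in> L2 M \<Longrightarrow> g \<in> L2 M \<Longrightarrow> (\<lambda>x. f x - g x) \<in> L2 M"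
  using L2_add[of M f "\<lambda>x. (-1) * g x"] L2_cmult[of g M "-1"] by simp

lemma bounded_L2:
  fixes k :: "'x::topological_space \<Rightarrow> real"
  assumes "finite_measure M" "sets M = sets borel" "k \<in> borel_measurable borel" "\<And>x. \<bar>k x\<bar> \<le> K"
  shows "k \<in> L2 M"
proof -
  have "(k x)\<^sup>2 \<le> K\<^sup>2" for x using assms(4)[of x] by (simp add: abs_le_square_iff[symmetric])
  then have "integrable M (\<lambda>x. (k x)\<^sup>2)"
    using assms by (intro finite_borel_integrable) auto
  then show ?thesis using assms by (simp add: L2_def measurable_cong_sets[OF assms(2) refl])
qed

text \<open>Squared distances are used in place of the L2 norm; (a + b)^2 \<le> 2 a^2 + 2 b^2 then
  replaces the Minkowski inequality and explains the factors 2.\<close>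

lemma L2_dist_triangle:
  assumes M: "finite_measure M" "f \<in> L2 M" "g \<in> L2 M" "h \<in> L2 M"
  shows "(LINT x|M. (f x - h x)\<^sup>2) \<le> 2 * (LINT x|M. (f x - g x)\<^sup>2) + 2 * (LINT x|M. (g x - h x)\<^sup>2)"
proof -
  have i: "integrable M (\<lambda>x. (f x - h x)\<^sup>2)" "integrable M (\<lambda>x. (f x - g x)\<^sup>2)"
    "integrable M (\<lambda>x. (g x - h x)\<^sup>2)"
    using L2_diff[OF M(1)] M by (auto simp: L2_def)
  have "(f x - h x)\<^sup>2 \<le> 2 * (f x - g x)\<^sup>2 + 2 * (g x - h x)\<^sup>2" for x
    using zero_le_power2[of "(f x - g x) - (g x - h x)"] by (simp add: power2_eq_square algebra_simps)
  then have "(LINT x|M. (f x - h x)\<^sup>2) \<le> (LINT x|M. 2 * (f x - g x)\<^sup>2 + 2 * (g x - h x)\<^sup>2)"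
    using i by (intro integral_mono) auto
  then show ?thesis using i by simp
qed

text \<open>Truncate \<open>f\<close> at level \<open>n\<close>, approximate in L1, and truncate the
  approximant as well: between functions bounded by \<open>n\<close> the squared difference is at
  most \<open>2 * n\<close> times the absolute difference.\<close>

lemma continuous_L2_dense:
  fixes f :: "'x::metric_space \<Rightarrow> real"
  assumes M: "finite_measure M" "sets M = sets borel" and f: "f \<in> L2 M" and e: "(e::real) > 0"
  shows "\<exists>s. continuous_on UNIV s \<and> (\<exists>c. \<forall>x. \<bar>s x\<bar> \<le> c) \<and> (LINT x|M. (s x - f x)\<^sup>2) < e"
proof -
  have [measurable]: "f \<in> borel_measurable M" using f by (simp add: L2_def)
  define clip where "clip n t = max (- real n) (min (real n) t)" for n t
  have clip_b: "\<bar>clip n t\<bar> \<le> real n" for n t by (auto simp: clip_def)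
  have clip_d: "\<bar>clip n t - t\<bar> \<le> \<bar>t\<bar>" for n t by (auto simp: clip_def)
  have sets_M: "measurable M borel = (measurable borel borel :: ('x \<Rightarrow> real) set)"
    using M(2) by (rule measurable_cong_sets) simp
  have fb: "f \<in> borel_measurable borel"
    using \<open>f \<in> borel_measurable M\<close> unfolding sets_M .
  have clip_m: "(\<lambda>x. clip n (f x)) \<in> borel_measurable borel" for n
    unfolding clip_def using fb by (intro borel_measurable_max borel_measurable_min) auto
  then have [measurable]: "(\<lambda>x. clip n (f x)) \<in> borel_measurable M" for n
    unfolding sets_M .
  have "(\<lambda>n. LINT x|M. (clip n (f x) - f x)\<^sup>2) \<longlonglongrightarrow> (LINT x|M. 0)"
  proof (rule integral_dominated_convergence)
    show "integrable M (\<lambda>x. (f x)\<^sup>2)" using f by (simp add: L2_def)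
    have "(\<lambda>n. (clip n (f x) - f x)\<^sup>2) \<longlonglongrightarrow> 0" for x
    proof -
      obtain N where N: "\<bar>f x\<bar> < real N" using reals_Archimedean2 by blast
      have "(clip n (f x) - f x)\<^sup>2 = 0" if "n \<ge> N" for n
      proof -
        have "real N \<le> real n" using that by simp
        then show ?thesis using N by (auto simp: clip_def max_def min_def)
      qed
      then show ?thesis by (intro tendsto_eventually) (auto simp: eventually_sequentially)
    qed
    then show "AE x in M. (\<lambda>n. (clip n (f x) - f x)\<^sup>2) \<longlonglongrightarrow> 0" by simp
    show "AE x in M. norm ((clip n (f x) - f x)\<^sup>2) \<le> (f x)\<^sup>2" for n
      using clip_d by (auto simp: abs_le_square_iff)
  qed auto
  from order_tendstoD(2)[OF this, of "e/4"] e obtain n where n: "(LINT x|M. (clip n (f x) - f x)\<^sup>2) < e/4"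
    by (auto dest!: eventually_happens)
  have cL2: "(\<lambda>x. clip n (f x)) \<in> L2 M" using clip_b by (intro bounded_L2[OF M clip_m])
  \<comment> \<open>\<open>2 * n\<close> times this number is at most \<open>e/4\<close>; the
    triangle inequality for squared distances then doubles this error and the truncation error,
    which is below \<open>e/4\<close>.\<close>
  have "e / (8 * (real n + 1)) > 0" using e by simp
  from continuous_L1_dense[OF M L2_integrable(1)[OF M(1) cL2 cL2] this]
  obtain s c where s: "continuous_on UNIV s" "\<forall>x. \<bar>s x\<bar> \<le> c"
    "(LINT x|M. \<bar>s x - clip n (f x)\<bar>) < e / (8 * (real n + 1))" by blast
  define t where "t x = clip n (s x)" for x
  have tc: "continuous_on UNIV t" unfolding t_def clip_def using s(1) by (intro continuous_intros)
  have tb: "\<bar>t x\<bar> \<le> real n" for x by (simp add: t_def clip_b)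
  have tm: "t \<in> borel_measurable borel" using tc by (rule borel_measurable_continuous_onI)
  have tL2: "t \<in> L2 M" using tb by (intro bounded_L2[OF M tm])
  have sL2: "s \<in> L2 M" using s by (intro bounded_L2[OF M]) (auto intro: borel_measurable_continuous_onI)
  have "(t x - clip n (f x))\<^sup>2 \<le> 2 * real n * \<bar>s x - clip n (f x)\<bar>" for x
  proof -
    have 1: "\<bar>t x - clip n (f x)\<bar> \<le> \<bar>s x - clip n (f x)\<bar>" unfolding t_def clip_def by linarith
    have 2: "\<bar>t x - clip n (f x)\<bar> \<le> 2 * real n" using tb[of x] clip_b[of n "f x"] by linarith
    have "(t x - clip n (f x))\<^sup>2 = \<bar>t x - clip n (f x)\<bar> * \<bar>t x - clip n (f x)\<bar>"
      by (simp add: power2_eq_square)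
    also have "\<dots> \<le> 2 * real n * \<bar>s x - clip n (f x)\<bar>" using 1 2 by (intro mult_mono) auto
    finally show ?thesis .
  qed
  then have "(LINT x|M. (t x - clip n (f x))\<^sup>2) \<le> (LINT x|M. 2 * real n * \<bar>s x - clip n (f x)\<bar>)"
    using L2_diff[OF M(1) tL2 cL2] L2_integrable(1)[OF M(1) L2_diff[OF M(1) sL2 cL2] cL2]
    by (intro integral_mono) (auto simp: L2_def)
  also have "\<dots> = 2 * real n * (LINT x|M. \<bar>s x - clip n (f x)\<bar>)" by simp
  also have "\<dots> \<le> 2 * real n * (e / (8 * (real n + 1)))" using s(3) by (intro mult_left_mono) auto
  also have "\<dots> \<le> e/4" using e by (simp add: field_simps)
  finally have "(LINT x|M. (t x - clip n (f x))\<^sup>2) \<le> e/4" .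
  then have "(LINT x|M. (t x - f x)\<^sup>2) < e"
    using L2_dist_triangle[OF M(1) tL2 cL2 f] n by linarith
  then show ?thesis using tc tb by blast
qed

section \<open>Finite signed measures\<close>

text \<open>This makes the description in \<open>signed_integral\<close> denote: for two
  decompositions, M - N - M' + N' vanishes on Borel sets, and this passes to bounded
  integrands.\<close>

lemma decomposition_signed_integral:
  assumes D: "is_decomposition \<sigma> M N" and k: "k \<in> borel_measurable borel" "\<And>x. \<bar>k x\<bar> \<le> K"
  shows "signed_integral \<sigma> k = integral\<^sup>L M k - integral\<^sup>L N k"
  unfolding signed_integral_def
proof (rule the_equality)
  show "\<exists>M' N'. is_decomposition \<sigma> M' N' \<and> integral\<^sup>L M k - integral\<^sup>L N k = integral\<^sup>L M' k - integral\<^sup>L N' k"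
    using D by blast
next
  fix r assume "\<exists>M N. is_decomposition \<sigma> M N \<and> r = integral\<^sup>L M k - integral\<^sup>L N k"
  then obtain M' N' where D': "is_decomposition \<sigma> M' N'"
    and r: "r = integral\<^sup>L M' k - integral\<^sup>L N' k" by blast
  have S: "sets M = sets borel" "sets N = sets borel" "sets M' = sets borel" "sets N' = sets borel"
    using D D' by (simp_all add: is_decomposition_def)
  have sp: "measure M A - measure N A = measure M' A - measure N' A" for A
    using D D' by (metis is_decomposition_def)
  let ?L = "[(\<lambda>x. 1 :: real, M), (\<lambda>x. -1, N), (\<lambda>x. -1, M'), (\<lambda>x. 1, N')]"
  have "(\<Sum>(q, M)\<leftarrow>?L. LINT x|M. q x * k x) = 0"
  proof (rule integral_zero_from_indicators[OF _ _ k])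
    fix A :: "'a set" assume "A \<in> sets borel"
    then show "(\<Sum>(q, M)\<leftarrow>?L.
        LINT x|M. q x * indicator A x) = 0"
      using sp[of A] S by simp
  qed (use D D' in \<open>auto simp: is_decomposition_def finite_measure.integrable_const\<close>)
  then show "r = integral\<^sup>L M k - integral\<^sup>L N k" by (simp add: r)
qed

lemma finite_signed_measure_notin:
  "finite_signed_measure \<sigma> \<Longrightarrow> A \<notin> sets borel \<Longrightarrow> \<sigma> A = 0"
  unfolding finite_signed_measure_def is_decomposition_def
  by (auto simp: measure_notin_sets)

lemma finite_signed_measure_eqI:
  assumes "finite_signed_measure \<sigma>" "finite_signed_measure \<tau>" "\<And>A. A \<in> sets borel \<Longrightarrow> \<sigma> A = \<tau> A"
  shows "\<sigma> = \<tau>"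
  using assms finite_signed_measure_notin by (metis ext)

lemma signed_integral_indicator:
  assumes "finite_signed_measure \<sigma>" "A \<in> sets borel"
  shows "signed_integral \<sigma> (indicator A) = \<sigma> A"
proof -
  obtain M N where D: "is_decomposition \<sigma> M N" using assms by (auto simp: finite_signed_measure_def)
  have "signed_integral \<sigma> (indicator A) = integral\<^sup>L M (indicator A) - integral\<^sup>L N (indicator A)"
    using assms by (intro decomposition_signed_integral[OF D, where K=1]) (auto simp: indicator_def)
  then show ?thesis using D assms by (simp add: is_decomposition_def)
qed

lemma signed_integral_lincomb:
  assumes s: "finite_signed_measure \<sigma>" "finite_signed_measure \<sigma>1" "finite_signed_measure \<sigma>2"
    and eq: "\<And>A. A \<in> sets borel \<Longrightarrow> \<sigma> A = a * \<sigma>1 A + b * \<sigma>2 A"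
    and k: "k \<in> borel_measurable borel" "\<And>x. \<bar>k x\<bar> \<le> K"
  shows "signed_integral \<sigma> k = a * signed_integral \<sigma>1 k + b * signed_integral \<sigma>2 k"
proof -
  obtain M N M1 N1 M2 N2 where D: "is_decomposition \<sigma> M N" "is_decomposition \<sigma>1 M1 N1"
    "is_decomposition \<sigma>2 M2 N2" using s by (auto simp: finite_signed_measure_def)
  let ?L = "[(\<lambda>x. 1, M), (\<lambda>x. -1, N), (\<lambda>x. -a, M1), (\<lambda>x. a, N1), (\<lambda>x. -b, M2), (\<lambda>x. b, N2)]"
  have "(\<Sum>(q, M)\<leftarrow>?L. LINT x|M. q x * k x) = 0"
  proof (rule integral_zero_from_indicators[OF _ _ k])
    fix A :: "'a set" assume A: "A \<in> sets borel"
    show "(\<Sum>(q, M)\<leftarrow>?L. LINT x|M. q x * indicator A x) = 0"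
      using eq[OF A] D A by (simp add: is_decomposition_def algebra_simps)
  qed (use D in \<open>auto simp: is_decomposition_def finite_measure.integrable_const\<close>)
  then show ?thesis
    unfolding D(1)[THEN decomposition_signed_integral, OF k] D(2)[THEN decomposition_signed_integral, OF k]
      D(3)[THEN decomposition_signed_integral, OF k]
    by (simp add: algebra_simps)
qed

text \<open>The defining relation of \<open>NuH\<close> on one-forms is stated for sets only; this
  turns it into a relation for bounded integrands.\<close>

lemma signed_integral_mult:
  assumes s: "finite_signed_measure \<sigma>" "finite_signed_measure \<tau>"
    and q: "q \<in> borel_measurable borel" "\<And>x. \<bar>q x\<bar> \<le> Q"
    and eq: "\<And>A. A \<in> sets borel \<Longrightarrow> \<tau> A = signed_integral \<sigma> (\<lambda>x. q x * indicator A x)"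
    and k: "k \<in> borel_measurable borel" "\<And>x. \<bar>k x\<bar> \<le> K"
  shows "signed_integral \<tau> k = signed_integral \<sigma> (\<lambda>x. q x * k x)"
proof -
  obtain M N M1 N1 where D: "is_decomposition \<sigma> M N" "is_decomposition \<tau> M1 N1"
    using s by (auto simp: finite_signed_measure_def)
  have qi: "integrable M q" "integrable N q"
    using D q by (auto simp: is_decomposition_def intro!: finite_borel_integrable)
  have b: "\<bar>q x * k x\<bar> \<le> Q * K" "\<bar>q x * indicator A x\<bar> \<le> Q" for x A
    using q(2)[of x] k(2)[of x] by (auto simp: abs_mult indicator_def intro!: mult_mono)
  let ?L = "[(\<lambda>x. 1, M1), (\<lambda>x. -1, N1), (\<lambda>x. - q x, M), (q, N)]"
  have "(\<Sum>(q, M)\<leftarrow>?L. LINT x|M. q x * k x) = 0"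
  proof (rule integral_zero_from_indicators[OF _ _ k])
    fix A :: "'a set" assume A: "A \<in> sets borel"
    have "signed_integral \<sigma> (\<lambda>x. q x * indicator A x) = integral\<^sup>L M (\<lambda>x. q x * indicator A x) -
      integral\<^sup>L N (\<lambda>x. q x * indicator A x)"
      using q A by (intro decomposition_signed_integral[OF D(1) _ b(2)]) auto
    then show "(\<Sum>(q, M)\<leftarrow>?L. LINT x|M. q x * indicator A x) = 0"
      using eq[OF A] D A by (simp add: is_decomposition_def algebra_simps)
  qed (use D qi in \<open>auto simp: is_decomposition_def finite_measure.integrable_const\<close>)
  moreover have "signed_integral \<sigma> (\<lambda>x. q x * k x) = integral\<^sup>L M (\<lambda>x. q x * k x) -
      integral\<^sup>L N (\<lambda>x. q x * k x)"
    using q k by (intro decomposition_signed_integral[OF D(1) _ b(1)]) auto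
  ultimately show ?thesis using decomposition_signed_integral[OF D(2) k]
    by (simp add: algebra_simps)
qed

lemma signed_integral_density:
  assumes s: "finite_signed_measure \<sigma>" and d: "integrable \<nu> d" "sets \<nu> = sets borel"
    and eq: "\<And>A. A \<in> sets borel \<Longrightarrow> \<sigma> A = (LINT x|\<nu>. d x * indicator A x)"
    and k: "k \<in> borel_measurable borel" "\<And>x. \<bar>k x\<bar> \<le> K"
  shows "signed_integral \<sigma> k = (LINT x|\<nu>. d x * k x)"
proof -
  obtain M N where D: "is_decomposition \<sigma> M N" using s by (auto simp: finite_signed_measure_def)
  let ?L = "[(\<lambda>x. 1, M), (\<lambda>x. -1, N), (\<lambda>x. - d x, \<nu>)]"
  have "(\<Sum>(q, M)\<leftarrow>?L. LINT x|M. q x * k x) = 0"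
  proof (rule integral_zero_from_indicators[OF _ _ k])
    fix A :: "'a set" assume A: "A \<in> sets borel"
    show "(\<Sum>(q, M)\<leftarrow>?L. LINT x|M. q x * indicator A x) = 0"
      using eq[OF A] D A by (simp add: is_decomposition_def algebra_simps)
  qed (use d D in \<open>auto simp: is_decomposition_def finite_measure.integrable_const\<close>)
  then show ?thesis using D[THEN decomposition_signed_integral, OF k]
    by (simp add: algebra_simps)
qed

lemma signed_integral_measure:
  assumes "finite_measure M" "sets M = sets borel" "\<And>A. A \<in> sets borel \<Longrightarrow> \<sigma> A = measure M A"
    "finite_signed_measure \<sigma>"
    and k: "k \<in> borel_measurable borel" "\<And>x. \<bar>k x\<bar> \<le> K"
  shows "signed_integral \<sigma> k = integral\<^sup>L M k"
  using assms signed_integral_density[of \<sigma> M "\<lambda>x. 1" k K]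
  by (simp add: finite_measure.integrable_const)

text \<open>Two decompositions consist of four finite measures; a single \<open>h\<close>
  approximates the indicator in all of them, with error \<open>e/2\<close> in each.\<close>

lemma signed_integral_approx:
  fixes \<sigma> \<tau> :: "'x::metric_space set \<Rightarrow> real"
  assumes s: "finite_signed_measure \<sigma>" "finite_signed_measure \<tau>" and A: "A \<in> sets borel"
    and e: "e > 0"
  shows "\<exists>h. continuous_on UNIV h \<and> (\<forall>x. 0 \<le> h x \<and> h x \<le> 1) \<and>
    \<bar>signed_integral \<sigma> h - \<sigma> A\<bar> < e \<and> \<bar>signed_integral \<tau> h - \<tau> A\<bar> < e"
proof -
  obtain M N M1 N1 where D: "is_decomposition \<sigma> M N" "is_decomposition \<tau> M1 N1"
    using s by (auto simp: finite_signed_measure_def)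
  define F where "F i = [M, N, M1, N1] ! i" for i
  have F: "finite_measure (F i) \<and> sets (F i) = sets borel" if "i \<in> {..<4}" for i
  proof -
    have "F i \<in> set [M, N, M1, N1]" unfolding F_def using that by (intro nth_mem) simp
    then show ?thesis using D by (auto simp: is_decomposition_def)
  qed
  have "e/2 > 0" using e by simp
  from continuous_approximates_indicator[of "{..<4}" F, OF _ F A this]
  obtain h where h: "continuous_on UNIV h" "\<And>x. 0 \<le> h x" "\<And>x. h x \<le> 1"
    "\<And>i. i < 4 \<Longrightarrow> (LINT x|F i. \<bar>h x - indicator A x\<bar>) < e/2" by auto
  have hm: "h \<in> borel_measurable borel" using h(1) by (rule borel_measurable_continuous_onI)
  have hb: "\<bar>h x\<bar> \<le> 1" for x using h(2,3)[of x] by simp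
  have d: "\<bar>integral\<^sup>L (F i) h - measure (F i) A\<bar> < e/2" if "i < 4" for i
  proof -
    have Fi: "finite_measure (F i)" "sets (F i) = sets borel" using F[of i] that by auto
    have i: "integrable (F i) h" "integrable (F i) (indicator A :: 'x \<Rightarrow> real)"
      using A hm hb by (auto intro!: finite_borel_integrable[OF Fi, where K=1] simp: indicator_def)
    have "\<bar>integral\<^sup>L (F i) h - measure (F i) A\<bar> = \<bar>LINT x|F i. h x - indicator A x\<bar>"
      using i A Fi by simp
    also have "\<dots> \<le> (LINT x|F i. \<bar>h x - indicator A x\<bar>)" by simp
    finally show ?thesis using h(4)[OF that] by linarith
  qed
  have "\<bar>signed_integral \<sigma> h - \<sigma> A\<bar> < e"
  proof -
    have "\<bar>integral\<^sup>L M h - measure M A\<bar> < e/2" "\<bar>integral\<^sup>L N h - measure N A\<bar> < e/2"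
      using d[of 0] d[of 1] by (simp_all add: F_def)
    moreover have "\<sigma> A = measure M A - measure N A" using D(1) by (metis is_decomposition_def)
    ultimately show ?thesis unfolding decomposition_signed_integral[OF D(1) hm hb] by linarith
  qed
  moreover have "\<bar>signed_integral \<tau> h - \<tau> A\<bar> < e"
  proof -
    have "\<bar>integral\<^sup>L M1 h - measure M1 A\<bar> < e/2" "\<bar>integral\<^sup>L N1 h - measure N1 A\<bar> < e/2"
      using d[of 2] d[of 3] by (simp_all add: F_def eval_nat_numeral)
    moreover have "\<tau> A = measure M1 A - measure N1 A" using D(2) by (metis is_decomposition_def)
    ultimately show ?thesis unfolding decomposition_signed_integral[OF D(2) hm hb] by linarith
  qed
  ultimately show ?thesis using h by blast
qed

text \<open>Continuous test functions are the ones that act on one-forms, so sign and equality of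
  the measures of vectors can be read off from scalar products.\<close>

lemma signed_measure_nonneg:
  fixes \<sigma> :: "'x::metric_space set \<Rightarrow> real"
  assumes s: "finite_signed_measure \<sigma>"
    and nn: "\<And>h. continuous_on UNIV h \<Longrightarrow> (\<And>x. 0 \<le> h x) \<Longrightarrow> (\<And>x. h x \<le> 1) \<Longrightarrow> 0 \<le> signed_integral \<sigma> h"
  shows "0 \<le> \<sigma> A"
proof (cases "A \<in> sets borel")
  case True
  show ?thesis
  proof (rule field_le_epsilon)
    fix e :: real assume "e > 0"
    from signed_integral_approx[OF s s True this] nn show "0 \<le> \<sigma> A + e" by force
  qed
qed (use finite_signed_measure_notin[OF s] in auto)

lemma signed_measure_eqI:
  fixes \<sigma> \<tau> :: "'x::metric_space set \<Rightarrow> real"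
  assumes s: "finite_signed_measure \<sigma>" "finite_signed_measure \<tau>"
    and eq: "\<And>h. continuous_on UNIV h \<Longrightarrow> (\<And>x. 0 \<le> h x) \<Longrightarrow> (\<And>x. h x \<le> 1) \<Longrightarrow>
      signed_integral \<sigma> h = signed_integral \<tau> h"
  shows "\<sigma> = \<tau>"
proof (rule finite_signed_measure_eqI[OF s])
  fix A :: "'x set" assume A: "A \<in> sets borel"
  have "\<bar>\<sigma> A - \<tau> A\<bar> \<le> 0"
  proof (rule field_le_epsilon)
    fix e :: real assume "e > 0"
    then have "e/2 > 0" by simp
    from signed_integral_approx[OF s A this] obtain h where
      h: "continuous_on UNIV h" "\<forall>x. 0 \<le> h x \<and> h x \<le> 1" and
      d: "\<bar>signed_integral \<sigma> h - \<sigma> A\<bar> < e/2" "\<bar>signed_integral \<tau> h - \<tau> A\<bar> < e/2" by blast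
    have "signed_integral \<sigma> h = signed_integral \<tau> h" using h by (intro eq) auto
    then show "\<bar>\<sigma> A - \<tau> A\<bar> \<le> 0 + e" using d by linarith
  qed
  then show "\<sigma> A = \<tau> A" by simp
qed

text \<open>\<open>ennreal\<close> sends negative values to 0, which would destroy additivity. Under
  \<open>nn\<close> countable additivity is the difference of that of the two parts of a
  decomposition.\<close>

lemma nonneg_signed_measure_to_measure:
  assumes s: "finite_signed_measure \<sigma>" and nn: "\<And>A. 0 \<le> \<sigma> A"
  shows "finite_measure (to_measure \<sigma>)" "sets (to_measure \<sigma>) = sets borel"
    "measure (to_measure \<sigma>) A = \<sigma> A"
proof -
  obtain M N where D: "is_decomposition \<sigma> M N" using s by (auto simp: finite_signed_measure_def)
  then have M: "finite_measure M" "sets M = sets borel" "finite_measure N" "sets N = sets borel"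
    and eq: "\<sigma> A = measure M A - measure N A" for A by (auto simp: is_decomposition_def)
  show sets: "sets (to_measure \<sigma>) = sets borel"
    unfolding to_measure_def by (simp add: sets_measure_of_conv) (metis sets.sigma_sets_eq space_borel)
  have sp: "space (to_measure \<sigma>) = UNIV" unfolding to_measure_def by (simp add: space_measure_of_conv)
  have ca: "countably_additive (sets (to_measure \<sigma>)) (\<lambda>A. ennreal (\<sigma> A))"
  proof (rule countably_additiveI)
    fix A :: "nat \<Rightarrow> 'a set"
    assume A: "range A \<subseteq> sets (to_measure \<sigma>)" "disjoint_family A"
    have "(\<lambda>i. measure M (A i)) sums measure M (\<Union>i. A i)" "(\<lambda>i. measure N (A i)) sums measure N (\<Union>i. A i)"
      using A M sets by (auto intro!: finite_measure.finite_measure_UNION)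
    then have "(\<lambda>i. \<sigma> (A i)) sums \<sigma> (\<Union>i. A i)" unfolding eq by (rule sums_diff)
    then show "(\<Sum>i. ennreal (\<sigma> (A i))) = ennreal (\<sigma> (\<Union>i. A i))"
      using nn by (intro suminf_ennreal_eq) auto
  qed
  have em: "emeasure (to_measure \<sigma>) A = ennreal (\<sigma> A)" if "A \<in> sets borel" for A
  proof (rule emeasure_measure_of[OF to_measure_def[of \<sigma>]])
    show "A \<in> sets (to_measure \<sigma>)" using that sets by simp
    show "positive (sets (to_measure \<sigma>)) (\<lambda>A. ennreal (\<sigma> A))" by (simp add: positive_def eq)
  qed (use ca in auto)
  show "finite_measure (to_measure \<sigma>)"
    by (rule finite_measureI) (simp add: sp em)
  show "measure (to_measure \<sigma>) A = \<sigma> A"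
  proof (cases "A \<in> sets borel")
    case True
    then show ?thesis by (simp add: measure_def em nn)
  next
    case False
    then show ?thesis using sets finite_signed_measure_notin[OF s False] by (simp add: measure_notin_sets)
  qed
qed

section \<open>Densities and absolute continuity\<close>

lemma real_Radon_Nikodym:
  fixes \<nu> M :: "'x::topological_space measure"
  assumes \<nu>: "sigma_finite_measure \<nu>" "sets \<nu> = sets borel"
    and M: "finite_measure M" "sets M = sets borel" and ac: "absolutely_continuous \<nu> M"
  shows "\<exists>d. integrable \<nu> d \<and> (\<forall>x. 0 \<le> d x) \<and>
    (\<forall>A\<in>sets borel. measure M A = (LINT x|\<nu>. d x * indicator A x))"
proof -
  obtain f where [measurable]: "f \<in> borel_measurable \<nu>" and f: "density \<nu> f = M"
    using sigma_finite_measure.Radon_Nikodym[OF \<nu>(1) ac] M \<nu> by auto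
  have "(\<integral>\<^sup>+x. f x \<partial>\<nu>) = emeasure M (space \<nu>)"
    unfolding f[symmetric] by (subst emeasure_density) (auto intro!: nn_integral_cong)
  also have "\<dots> < \<infinity>" using finite_measure.emeasure_finite[OF M(1)] by (simp add: less_top)
  finally have fin: "(\<integral>\<^sup>+x. f x \<partial>\<nu>) < \<infinity>" .
  then have AEf: "AE x in \<nu>. ennreal (enn2real (f x)) = f x"
    using nn_integral_PInf_AE[of f \<nu>] by (auto simp: less_top)
  define d where "d x = enn2real (f x)" for x
  have dm[measurable]: "d \<in> borel_measurable \<nu>" unfolding d_def by measurable
  have dnn: "0 \<le> d x" for x by (simp add: d_def)
  have "(\<integral>\<^sup>+x. ennreal (d x) \<partial>\<nu>) = (\<integral>\<^sup>+x. f x \<partial>\<nu>)"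
    using AEf by (intro nn_integral_cong_AE) (simp add: d_def)
  then have di: "integrable \<nu> d" using fin dnn by (intro integrableI_nonneg) auto
  have "measure M A = (LINT x|\<nu>. d x * indicator A x)" if A: "A \<in> sets borel" for A
  proof -
    have [measurable]: "A \<in> sets \<nu>" using A \<nu> by simp
    have i: "integrable \<nu> (\<lambda>x. d x * indicator A x)"
      using di integrable_mult_indicator[of A \<nu> d] by (simp add: mult.commute)
    have "emeasure M A = (\<integral>\<^sup>+x. f x * indicator A x \<partial>\<nu>)"
      by (simp add: f[symmetric] emeasure_density)
    also have "\<dots> = (\<integral>\<^sup>+x. ennreal (d x * indicator A x) \<partial>\<nu>)"
      using AEf by (intro nn_integral_cong_AE) (auto simp: d_def indicator_def)
    also have "\<dots> = ennreal (LINT x|\<nu>. d x * indicator A x)"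
      using i dnn by (intro nn_integral_eq_integral) auto
    finally have "emeasure M A = ennreal (LINT x|\<nu>. d x * indicator A x)" .
    then show ?thesis using dnn by (intro measure_eq_emeasure_eq_ennreal) (auto intro!: integral_nonneg_AE)
  qed
  then show ?thesis using di dnn by blast
qed

text \<open>The epsilon-delta form of absolute continuity: the part of the density above level
  \<open>k\<close> has small integral, and the rest contributes at most \<open>k\<close> times the
  \<open>M\<close>-measure of \<open>D n\<close>.\<close>

lemma absolutely_continuous_tendsto_0:
  fixes M N :: "'x::topological_space measure"
  assumes M: "finite_measure M" "sets M = sets borel" and N: "finite_measure N" "sets N = sets borel"
    and ac: "absolutely_continuous M N" and D: "\<And>n. D n \<in> sets borel"
    and lim: "(\<lambda>n. measure M (D n)) \<longlonglongrightarrow> 0"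
  shows "(\<lambda>n. measure N (D n)) \<longlonglongrightarrow> 0"
proof -
  interpret M: finite_measure M by fact
  obtain d where d: "integrable M d" "\<And>x. 0 \<le> d x"
    "\<And>A. A \<in> sets borel \<Longrightarrow> measure N A = (LINT x|M. d x * indicator A x)"
    using real_Radon_Nikodym[OF M.sigma_finite_measure_axioms M(2) N ac] by blast
  have [measurable]: "d \<in> borel_measurable M" using d by auto
  have [measurable]: "D n \<in> sets M" for n using D M by simp
  have "(\<lambda>k. LINT x|M. max 0 (d x - real k)) \<longlonglongrightarrow> (LINT x|M. 0)"
  proof (rule integral_dominated_convergence[OF _ _ d(1)])
    have "(\<lambda>k. max 0 (d x - real k)) \<longlonglongrightarrow> 0" for x
    proof -
      obtain K where "d x < real K" using reals_Archimedean2 by blast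
      then have "\<forall>k\<ge>K. max 0 (d x - real k) = 0" by auto
      then show ?thesis by (intro tendsto_eventually) (auto simp: eventually_sequentially)
    qed
    then show "AE x in M. (\<lambda>k. max 0 (d x - real k)) \<longlonglongrightarrow> 0" by simp
    show "AE x in M. norm (max 0 (d x - real k)) \<le> d x" for k using d(2) by auto
  qed auto
  then have tail: "(\<lambda>k. LINT x|M. max 0 (d x - real k)) \<longlonglongrightarrow> 0" by simp
  show ?thesis
  proof (rule tendstoI)
    fix e :: real assume "e > 0"
    then obtain k where k: "(LINT x|M. max 0 (d x - real k)) < e/2"
      using order_tendstoD(2)[OF tail, of "e/2"] by (auto dest!: eventually_happens)
    have "e / (2 * (real k + 1)) > 0" using \<open>e > 0\<close> by simp
    from order_tendstoD(2)[OF lim this]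
    show "\<forall>\<^sub>F n in sequentially. dist (measure N (D n)) 0 < e"
    proof eventually_elim
      case (elim n)
      have i: "integrable M (\<lambda>x. max 0 (d x - real k))"
        by (rule Bochner_Integration.integrable_bound[OF d(1)]) (use d(2) in auto)
      have i2: "integrable M (\<lambda>x. d x * indicator (D n) x)"
        using d(1) integrable_mult_indicator[of "D n" M d] by (simp add: mult.commute)
      have i3: "integrable M (\<lambda>x. real k * indicator (D n) x)"
        using M.emeasure_finite by (auto intro!: integrable_real_indicator simp: less_top[symmetric])
      have "measure N (D n) \<le> (LINT x|M. max 0 (d x - real k) + real k * indicator (D n) x)"
        unfolding d(3)[OF D] using d(2) i i2 i3
        by (intro integral_mono) (auto simp: indicator_def)
      also have "\<dots> = (LINT x|M. max 0 (d x - real k)) + real k * measure M (D n)"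
        by (subst Bochner_Integration.integral_add[OF i i3]) simp
      also have "real k * measure M (D n) \<le> (real k + 1) * measure M (D n)"
        by (intro mult_right_mono) auto
      also have "\<dots> < e/2" using elim by (simp add: field_simps)
      finally show ?case using k by (simp add: dist_real_def)
    qed
  qed
qed

section \<open>Hilbert spaces\<close>

lemma closure_add:
  fixes x y :: "'a::real_normed_vector"
  assumes "\<And>x y. x \<in> R \<Longrightarrow> y \<in> R \<Longrightarrow> x + y \<in> R" "x \<in> closure R" "y \<in> closure R"
  shows "x + y \<in> closure R"
proof -
  obtain s t where "\<And>n. s n \<in> R" "s \<longlonglongrightarrow> x" "\<And>n. t n \<in> R" "t \<longlonglongrightarrow> y"
    using assms(2,3) unfolding closure_sequential by metis
  then show ?thesis unfolding closure_sequential
    by (intro exI[of _ "\<lambda>n. s n + t n"]) (auto intro: assms(1) tendsto_intros)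
qed

lemma closure_scaleR:
  fixes x :: "'a::real_normed_vector"
  assumes "\<And>x. x \<in> R \<Longrightarrow> c *\<^sub>R x \<in> R" "x \<in> closure R"
  shows "c *\<^sub>R x \<in> closure R"
proof -
  obtain s where "\<And>n. s n \<in> R" "s \<longlonglongrightarrow> x" using assms(2) unfolding closure_sequential by metis
  then show ?thesis unfolding closure_sequential
    by (intro exI[of _ "\<lambda>n. c *\<^sub>R s n"]) (auto intro: assms(1) tendsto_intros)
qed

text \<open>Extension by continuity for a relation not known to be a function. In the closure, (0,
  y) forces y = 0 by the bound, so the closure is a graph; density of the first components and
  completeness of the target give it full domain.\<close>

lemma bounded_linear_of_graph:
  fixes R :: "('a::real_normed_vector \<times> 'b::{real_normed_vector, complete_space}) set"
  assumes add: "\<And>p q. p \<in> R \<Longrightarrow> q \<in> R \<Longrightarrow> p + q \<in> R"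
    and scale: "\<And>c p. p \<in> R \<Longrightarrow> c *\<^sub>R p \<in> R"
    and bound: "\<And>x y. (x, y) \<in> R \<Longrightarrow> norm y \<le> K * norm x"
    and dense: "closure (fst ` R) = UNIV"
  shows "\<exists>T. bounded_linear T \<and> (\<forall>(x, y)\<in>R. T x = y)"
proof -
  have diff: "p - q \<in> R" if "p \<in> R" "q \<in> R" for p q
    using add[OF that(1) scale[OF that(2), of "-1"]] by simp
  have "\<exists>y. (x, y) \<in> closure R" for x
  proof -
    have "x \<in> closure (fst ` R)" using dense by simp
    then obtain s where s: "\<And>n. s n \<in> fst ` R" "s \<longlonglongrightarrow> x" unfolding closure_sequential by blast
    then have "\<forall>n. \<exists>y. (s n, y) \<in> R" by force
    then obtain t where t: "\<And>n. (s n, t n) \<in> R" by metis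
    have "Cauchy t"
    proof (rule CauchyI)
      fix e :: real assume "e > 0"
      then have "e / (\<bar>K\<bar> + 1) > 0" by simp
      with LIMSEQ_imp_Cauchy[OF s(2)] obtain M where
        M: "\<And>m n. m \<ge> M \<Longrightarrow> n \<ge> M \<Longrightarrow> norm (s m - s n) < e / (\<bar>K\<bar> + 1)" by (meson CauchyD)
      have "norm (t m - t n) < e" if "m \<ge> M" "n \<ge> M" for m n
      proof -
        have "(s m - s n, t m - t n) \<in> R" using diff[OF t t] by simp
        then have "norm (t m - t n) \<le> K * norm (s m - s n)" by (rule bound)
        also have "\<dots> \<le> (\<bar>K\<bar> + 1) * norm (s m - s n)" by (intro mult_right_mono) auto
        also have "\<dots> < e" using M[OF that] by (simp add: field_simps)
        finally show ?thesis .
      qed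
      then show "\<exists>M. \<forall>m\<ge>M. \<forall>n\<ge>M. norm (t m - t n) < e" by blast
    qed
    then obtain y where "t \<longlonglongrightarrow> y" using Cauchy_convergent convergentD by blast
    then have "(\<lambda>n. (s n, t n)) \<longlonglongrightarrow> (x, y)" using s(2) by (intro tendsto_Pair)
    then have "(x, y) \<in> closure R" unfolding closure_sequential
      using t by (intro exI[of _ "\<lambda>n. (s n, t n)"]) auto
    then show ?thesis by blast
  qed
  then obtain T where T: "\<And>x. (x, T x) \<in> closure R" by metis
  have bnd: "norm y \<le> K * norm x" if "(x, y) \<in> closure R" for x y
  proof -
    have "closed {p :: 'a \<times> 'b. norm (snd p) \<le> K * norm (fst p)}"
      by (intro closed_Collect_le continuous_intros)
    then have "closure R \<subseteq> {p. norm (snd p) \<le> K * norm (fst p)}"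
      using bound by (intro closure_minimal) auto
    then show ?thesis using that by auto
  qed
  have cadd: "p + q \<in> closure R" if "p \<in> closure R" "q \<in> closure R" for p q
    using closure_add[OF add that] .
  have cscale: "c *\<^sub>R p \<in> closure R" if "p \<in> closure R" for p c
    using closure_scaleR[OF scale that] .
  have uniq: "y = T x" if "(x, y) \<in> closure R" for x y
  proof -
    have "(0, y - T x) \<in> closure R" using cadd[OF that cscale[OF T[of x], of "-1"]] by simp
    from bnd[OF this] show ?thesis by simp
  qed
  have "bounded_linear T"
  proof (rule bounded_linear_intro)
    show "T (x + y) = T x + T y" for x y
      using uniq[of "x + y" "T x + T y"] cadd[OF T[of x] T[of y]] by simp
    show "T (c *\<^sub>R x) = c *\<^sub>R T x" for c x
      using uniq[of "c *\<^sub>R x" "c *\<^sub>R T x"] cscale[OF T[of x], of c] by simp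
    show "norm (T x) \<le> norm x * K" for x using bnd[OF T[of x]] by (simp add: mult.commute)
  qed
  moreover have "T x = y" if "(x, y) \<in> R" for x y
    using uniq[of x y] closure_subset that by blast
  ultimately show ?thesis by blast
qed

lemma orthogonal_decomposition_exists:
  fixes V :: "'a::{real_inner, complete_space} set"
  assumes V: "closed V" "0 \<in> V" "\<And>x y. x \<in> V \<Longrightarrow> y \<in> V \<Longrightarrow> x + y \<in> V"
    "\<And>c x. x \<in> V \<Longrightarrow> c *\<^sub>R x \<in> V"
  shows "\<exists>y\<in>V. \<forall>z\<in>V. inner (x - y) z = 0"
proof -
  define D where "D = (\<lambda>y. (norm (x - y))\<^sup>2) ` V"
  have D: "D \<noteq> {}" "bdd_below D" using V(2) by (auto simp: D_def intro!: bdd_belowI[of _ 0])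
  define d where "d = Inf D"
  have d_le: "d \<le> (norm (x - y))\<^sup>2" if "y \<in> V" for y
    unfolding d_def using that D by (intro cInf_lower) (auto simp: D_def)
  have "\<exists>y\<in>V. (norm (x - y))\<^sup>2 < d + 1 / real (Suc n)" for n
  proof -
    have "d < d + 1 / real (Suc n)" by simp
    then obtain z where "z \<in> D" "z < d + 1 / real (Suc n)"
      unfolding d_def using cInf_lessD[OF D(1)] by metis
    then show ?thesis by (auto simp: D_def)
  qed
  then obtain s where s: "\<And>n. s n \<in> V" "\<And>n. (norm (x - s n))\<^sup>2 < d + 1 / real (Suc n)" by metis
  \<comment> \<open>Parallelogram law: the midpoint lies in \<open>V\<close>, so its distance to
    \<open>x\<close> is not below the infimum. This makes the minimizing sequence Cauchy.\<close>
  have par: "(norm (s m - s n))\<^sup>2 \<le> 2 / real (Suc m) + 2 / real (Suc n)" for m n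
  proof -
    define z where "z = (1/2) *\<^sub>R (s m + s n)"
    have "z \<in> V" unfolding z_def using V s by blast
    have "(norm (s m - s n))\<^sup>2 + 4 * (norm (x - z))\<^sup>2 = 2 * (norm (x - s m))\<^sup>2 + 2 * (norm (x - s n))\<^sup>2"
      unfolding z_def power2_norm_eq_inner
      by (simp add: inner_diff inner_add inner_commute algebra_simps)
    then show ?thesis using d_le[OF \<open>z \<in> V\<close>] s(2)[of m] s(2)[of n] by linarith
  qed
  have "Cauchy s"
  proof (rule CauchyI)
    fix e :: real assume e: "e > 0"
    obtain N where N: "4 / e\<^sup>2 < real N" using reals_Archimedean2 by blast
    have "norm (s m - s n) < e" if "m \<ge> N" "n \<ge> N" for m n
    proof -
      have *: "2 / real (Suc k) < e\<^sup>2 / 2" if "k \<ge> N" for k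
      proof -
        have "4 / e\<^sup>2 < real (Suc k)" using N that by linarith
        then show ?thesis using e by (simp add: field_simps)
      qed
      have "(norm (s m - s n))\<^sup>2 < e\<^sup>2" using par[of m n] *[OF that(1)] *[OF that(2)] by linarith
      then show ?thesis using e by (simp add: power_less_imp_less_base)
    qed
    then show "\<exists>M. \<forall>m\<ge>M. \<forall>n\<ge>M. norm (s m - s n) < e" by blast
  qed
  then obtain y where y: "s \<longlonglongrightarrow> y" using Cauchy_convergent convergentD by blast
  have yV: "y \<in> V" using closed_sequentially[OF V(1)] s(1) y by blast
  have "(\<lambda>n. (norm (x - s n))\<^sup>2) \<longlonglongrightarrow> (norm (x - y))\<^sup>2" using y by (intro tendsto_intros)
  moreover have "(\<lambda>n. d + 1 / real (Suc n)) \<longlonglongrightarrow> d + 0"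
    by (intro tendsto_intros LIMSEQ_Suc[OF lim_1_over_n])
  ultimately have yd: "(norm (x - y))\<^sup>2 \<le> d"
    using s(2) by (intro LIMSEQ_le[of _ _ "\<lambda>n. d + 1 / real (Suc n)"]) (auto intro: less_imp_le)
  have "inner (x - y) z = 0" if z: "z \<in> V" for z
  proof (cases "z = 0")
    case False
    \<comment> \<open>The minimizer of the quadratic polynomial
      \<open>(norm (x - y - t *\<^sub>R z))\<^sup>2\<close> in \<open>t\<close>.\<close>
    define t where "t = inner (x - y) z / inner z z"
    have zz: "inner z z > 0" using False by simp
    have "y + t *\<^sub>R z \<in> V" using V yV z by blast
    from d_le[OF this] yd have "(norm (x - y))\<^sup>2 \<le> (norm (x - (y + t *\<^sub>R z)))\<^sup>2" by linarith
    also have "\<dots> = (norm (x - y))\<^sup>2 - 2 * t * inner (x - y) z + t\<^sup>2 * inner z z"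
      unfolding power2_norm_eq_inner
      by (simp add: inner_diff inner_add inner_commute algebra_simps power2_eq_square)
    also have "t\<^sup>2 * inner z z = t * inner (x - y) z" using zz by (simp add: t_def power2_eq_square)
    finally have "t * inner (x - y) z \<le> 0" by simp
    then have "(inner (x - y) z)\<^sup>2 / inner z z \<le> 0" by (simp add: t_def power2_eq_square)
    then show ?thesis using zz by (simp add: divide_le_0_iff)
  qed simp
  then show ?thesis using yV by blast
qed

section \<open>The action of continuous functions on one-forms\<close>

definition bounded_borel :: "('x::topological_space \<Rightarrow> real) \<Rightarrow> bool" where
  "bounded_borel k \<longleftrightarrow> k \<in> borel_measurable borel \<and> (\<exists>K. \<forall>x. \<bar>k x\<bar> \<le> K)"

lemma bounded_borelE:
  assumes "bounded_borel k"
  obtains K where "k \<in> borel_measurable borel" "\<And>x. \<bar>k x\<bar> \<le> K" "0 \<le> K"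
proof -
  obtain K where "k \<in> borel_measurable borel" "\<forall>x. \<bar>k x\<bar> \<le> K"
    using assms by (auto simp: bounded_borel_def)
  moreover have "0 \<le> K" using abs_ge_zero order_trans calculation(2) by blast
  ultimately show ?thesis using that by blast
qed

lemma bounded_borel_indicator: "A \<in> sets borel \<Longrightarrow> bounded_borel (indicator A)"
  by (auto simp: bounded_borel_def indicator_def intro!: exI[of _ 1])

lemma bounded_borel_const: "bounded_borel (\<lambda>x. c)"
  by (auto simp: bounded_borel_def)

lemma bounded_borel_mult:
  assumes "bounded_borel f" "bounded_borel g" shows "bounded_borel (\<lambda>x. f x * g x)"
proof -
  obtain K L where f: "f \<in> borel_measurable borel" "\<And>x. \<bar>f x\<bar> \<le> K" "0 \<le> K"
    and g: "g \<in> borel_measurable borel" "\<And>x. \<bar>g x\<bar> \<le> L" "0 \<le> L"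
    using assms by (metis bounded_borelE)
  have "\<bar>f x * g x\<bar> \<le> K * L" for x using f g by (simp add: abs_mult mult_mono)
  then show ?thesis using f g by (auto simp: bounded_borel_def)
qed

text \<open>Elements of C have compact support, so \<open>one\<close> makes the space compact. Then
  \<open>Cc\<close> consists of all continuous functions, these are bounded, and \<open>du f\<close>
  lies in the span of one-forms.\<close>

locale compact_form =
  fixes S :: "('x::metric_space, 'h::{real_inner, complete_space}) form_structure"
  assumes adm: "admissible_form (Alg S) (Form S)"
    and fos: "first_order_structure S"
    and one: "(\<lambda>x. 1) \<in> Alg S"
begin

lemma compact_UNIV: "compact (UNIV :: 'x set)"
  using adm one by (auto simp: admissible_form_def Cc_def)

lemma Cc_iff: "f \<in> Cc \<longleftrightarrow> continuous_on UNIV (f :: 'x \<Rightarrow> real)"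
proof
  assume "continuous_on UNIV f"
  moreover have "compact (closure {x. f x \<noteq> 0})"
    using compact_Int_closed[OF compact_UNIV, of "closure {x. f x \<noteq> 0}"] by simp
  ultimately show "f \<in> Cc" by (simp add: Cc_def)
qed (simp add: Cc_def)

lemma Cc_bounded:
  assumes "(f :: 'x \<Rightarrow> real) \<in> Cc"
  shows "\<exists>K. \<forall>x. \<bar>f x\<bar> \<le> K"
proof -
  have "compact (range f)"
    using assms compact_UNIV by (auto simp: Cc_iff intro: compact_continuous_image)
  then show ?thesis using compact_imp_bounded bounded_iff by (metis rangeI real_norm_def)
qed

lemma Cc_bounded_borel: "(f :: 'x \<Rightarrow> real) \<in> Cc \<Longrightarrow> bounded_borel f"
  using Cc_bounded[of f] by (auto simp: bounded_borel_def Cc_iff intro: borel_measurable_continuous_onI)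

lemma Cc_const [simp]: "(\<lambda>x::'x. c) \<in> Cc" by (simp add: Cc_iff)
lemma Cc_mult: "f \<in> Cc \<Longrightarrow> g \<in> Cc \<Longrightarrow> (\<lambda>x::'x. f x * g x) \<in> Cc"
  by (auto simp: Cc_iff intro!: continuous_intros)
lemma Cc_add: "f \<in> Cc \<Longrightarrow> g \<in> Cc \<Longrightarrow> (\<lambda>x::'x. f x + g x) \<in> Cc"
  by (auto simp: Cc_iff intro!: continuous_intros)
lemma Cc_diff: "f \<in> Cc \<Longrightarrow> g \<in> Cc \<Longrightarrow> (\<lambda>x::'x. f x - g x) \<in> Cc"
  by (auto simp: Cc_iff intro!: continuous_intros)

lemma Alg_Cc: "f \<in> Alg S \<Longrightarrow> f \<in> Cc" using adm by (auto simp: admissible_form_def)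
lemma Alg_zero: "(\<lambda>x. 0) \<in> Alg S"
  using adm by (auto simp: admissible_form_def fun_subspace_def)
lemma Alg_add: "f \<in> Alg S \<Longrightarrow> g \<in> Alg S \<Longrightarrow> (\<lambda>x. f x + g x) \<in> Alg S"
  using adm by (auto simp: admissible_form_def fun_subspace_def)
lemma Alg_cmult: "f \<in> Alg S \<Longrightarrow> (\<lambda>x. c * f x) \<in> Alg S"
  using adm by (auto simp: admissible_form_def fun_subspace_def)
lemma Alg_mult: "f \<in> Alg S \<Longrightarrow> g \<in> Alg S \<Longrightarrow> (\<lambda>x. f x * g x) \<in> Alg S"
  using adm by (auto simp: admissible_form_def)
lemma Alg_const: "(\<lambda>x. c) \<in> Alg S" using Alg_cmult[OF one, of c] by simp
lemma Alg_diff: "f \<in> Alg S \<Longrightarrow> g \<in> Alg S \<Longrightarrow> (\<lambda>x. f x - g x) \<in> Alg S"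
  using Alg_add[of f "\<lambda>x. (-1) * g x"] Alg_cmult[of g "-1"] by simp

abbreviation elem :: "('x \<Rightarrow> real) \<Rightarrow> ('x \<Rightarrow> real) \<Rightarrow> 'h" where
  "elem h f \<equiv> Cls S (\<lambda>z. avg h z * du f z)"

abbreviation elems :: "'h set" where
  "elems \<equiv> {elem h f | h f. h \<in> Cc \<and> f \<in> Alg S}"

lemma one_form_spanI:
  fixes n :: nat
  shows "(\<And>i. i < n \<Longrightarrow> g i \<in> Cc \<and> f i \<in> Alg S) \<Longrightarrow>
   (\<lambda>z. \<Sum>i<n. avg (g i) z * du (f i) z) \<in> one_form_span (Alg S)"
  unfolding one_form_span_def by blast

lemma elem_in_span:
  assumes "h \<in> Cc" "f \<in> Alg S"
  shows "(\<lambda>z. avg h z * du f z) \<in> one_form_span (Alg S)"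
  using one_form_spanI[of 1 "\<lambda>_. h" "\<lambda>_. f"] assms by simp

lemma Cls_add:
  assumes "a \<in> one_form_span (Alg S)" "b \<in> one_form_span (Alg S)"
  shows "Cls S (\<lambda>z. a z + b z) = Cls S a + Cls S b"
  using fos assms by (auto simp: first_order_structure_def hilbert_space_of_forms_def fun_linear_on_def)

lemma Cls_scale:
  assumes "a \<in> one_form_span (Alg S)"
  shows "Cls S (\<lambda>z. c * a z) = c *\<^sub>R Cls S a"
  using fos assms by (auto simp: first_order_structure_def hilbert_space_of_forms_def fun_linear_on_def)

lemma Cls_sum:
  fixes n :: nat
  assumes "\<And>i. i < n \<Longrightarrow> g i \<in> Cc \<and> f i \<in> Alg S"
  shows "Cls S (\<lambda>z. \<Sum>i<n. avg (g i) z * du (f i) z) = (\<Sum>i<n. elem (g i) (f i))"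
  using assms
proof (induction n)
  case 0
  \<comment> \<open>The empty sum is 0 times an element of the span, so homogeneity gives the class
    0.\<close>
  show ?case using Cls_scale[OF elem_in_span[OF Cc_const one], of 0 1] by simp
next
  case (Suc n)
  then have "Cls S (\<lambda>z. (\<Sum>i<n. avg (g i) z * du (f i) z) + avg (g n) z * du (f n) z) =
     Cls S (\<lambda>z. \<Sum>i<n. avg (g i) z * du (f i) z) + elem (g n) (f n)"
    by (intro Cls_add one_form_spanI elem_in_span) auto
  then show ?case using Suc by simp
qed

lemma closure_span_elems: "closure (span elems) = UNIV"
proof -
  have "Cls S ` one_form_span (Alg S) \<subseteq> span elems"
  proof safe
    fix a assume "a \<in> one_form_span (Alg S)"
    then obtain n :: nat and g f where a: "a = (\<lambda>z. \<Sum>i<n. avg (g i) z * du (f i) z)"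
      and gf: "\<And>i. i < n \<Longrightarrow> g i \<in> Cc \<and> f i \<in> Alg S" unfolding one_form_span_def by blast
    have "Cls S a = (\<Sum>i<n. elem (g i) (f i))" unfolding a by (rule Cls_sum) (rule gf)
    moreover have "(\<Sum>i<n. elem (g i) (f i)) \<in> span elems"
      using gf by (intro span_sum span_base) blast
    ultimately show "Cls S a \<in> span elems" by simp
  qed
  from closure_mono[OF this] show ?thesis
    using fos by (auto simp: first_order_structure_def hilbert_space_of_forms_def)
qed

section \<open>The measures of pairs of vectors and integration against them\<close>

lemma fsm_Nu: "f1 \<in> Alg S \<Longrightarrow> f2 \<in> Alg S \<Longrightarrow> finite_signed_measure (Nu S f1 f2)"
  using fos by (auto simp: first_order_structure_def energy_measures_def)

lemma fsm_NuH: "finite_signed_measure (NuH S v w)"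
  using fos by (auto simp: first_order_structure_def vector_measures_def)

lemma NuH_bilinear: "bounded_bilinear (\<lambda>v w. NuH S v w A)"
proof (cases "A \<in> sets borel")
  case True
  then show ?thesis using fos by (auto simp: first_order_structure_def vector_measures_def)
next
  case False
  then have "(\<lambda>v w. NuH S v w A) = (\<lambda>v w. 0)"
    using finite_signed_measure_notin[OF fsm_NuH] by auto
  then show ?thesis by (auto simp: bounded_bilinear_def intro!: exI[of _ 0])
qed

lemma inner_elem:
  "g1 \<in> Cc \<Longrightarrow> f1 \<in> Alg S \<Longrightarrow> g2 \<in> Cc \<Longrightarrow> f2 \<in> Alg S \<Longrightarrow>
   inner (elem g1 f1) (elem g2 f2) = signed_integral (Nu S f1 f2) (\<lambda>x. g1 x * g2 x)"
  using fos by (auto simp: first_order_structure_def hilbert_space_of_forms_def)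

definition int_NuH :: "('x \<Rightarrow> real) \<Rightarrow> 'h \<Rightarrow> 'h \<Rightarrow> real" where
  "int_NuH k v w = signed_integral (NuH S v w) k"

lemma int_NuH_elem:
  assumes "g1 \<in> Cc" "f1 \<in> Alg S" "g2 \<in> Cc" "f2 \<in> Alg S" "bounded_borel k"
  shows "int_NuH k (elem g1 f1) (elem g2 f2) = signed_integral (Nu S f1 f2) (\<lambda>x. (g1 x * g2 x) * k x)"
proof -
  obtain K where k: "k \<in> borel_measurable borel" "\<And>x. \<bar>k x\<bar> \<le> K" using assms(5) bounded_borelE by metis
  obtain Q where q: "(\<lambda>x. g1 x * g2 x) \<in> borel_measurable borel" "\<And>x. \<bar>g1 x * g2 x\<bar> \<le> Q"
    using Cc_bounded_borel[OF Cc_mult[OF assms(1,3)]] bounded_borelE by metis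
  show ?thesis unfolding int_NuH_def
    by (rule signed_integral_mult[OF fsm_Nu[OF assms(2,4)] fsm_NuH q _ k])
      (use fos assms in \<open>auto simp: first_order_structure_def vector_measures_def\<close>)
qed

lemma int_NuH_bilinear:
  assumes "bounded_borel k" shows "bilinear (int_NuH k)"
proof -
  obtain K where k: "k \<in> borel_measurable borel" "\<And>x. \<bar>k x\<bar> \<le> K" using assms bounded_borelE by metis
  interpret N: bounded_bilinear "\<lambda>v w. NuH S v w A" for A by (rule NuH_bilinear)
  have r: "int_NuH k v (a *\<^sub>R w + b *\<^sub>R w') = a * int_NuH k v w + b * int_NuH k v w'" for v w w' a b
    unfolding int_NuH_def by (rule signed_integral_lincomb[OF fsm_NuH fsm_NuH fsm_NuH _ k])
      (simp add: N.add_right N.scaleR_right)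
  have l: "int_NuH k (a *\<^sub>R w + b *\<^sub>R w') v = a * int_NuH k w v + b * int_NuH k w' v" for v w w' a b
    unfolding int_NuH_def by (rule signed_integral_lincomb[OF fsm_NuH fsm_NuH fsm_NuH _ k])
      (simp add: N.add_left N.scaleR_left)
  have "int_NuH k v (w + w') = int_NuH k v w + int_NuH k v w'" "int_NuH k (w + w') v = int_NuH k w v + int_NuH k w' v"
    "int_NuH k v (c *\<^sub>R w) = c *\<^sub>R int_NuH k v w" "int_NuH k (c *\<^sub>R w) v = c *\<^sub>R int_NuH k w v" for v w w' c
    using r[of v 1 w 1 w'] l[of 1 w 1 w' v] r[of v c w 0 w] l[of c w 0 w v] by simp_all
  then show ?thesis unfolding bilinear_def linear_iff by blast
qed

lemma int_NuH_indicator: "A \<in> sets borel \<Longrightarrow> int_NuH (indicator A) v w = NuH S v w A"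
  unfolding int_NuH_def by (rule signed_integral_indicator[OF fsm_NuH])

lemma inner_span:
  assumes "v \<in> span elems" "w \<in> span elems"
  shows "inner v w = int_NuH (\<lambda>x. 1) v w"
proof (rule bilinear_eq[OF _ int_NuH_bilinear[OF bounded_borel_const] order_refl order_refl assms])
  show "bilinear (inner :: 'h \<Rightarrow> 'h \<Rightarrow> real)"
    unfolding bilinear_def linear_iff by (auto simp: inner_add)
  show "inner v w = int_NuH (\<lambda>x. 1) v w" if "v \<in> elems" "w \<in> elems" for v w
    using that by (auto simp: int_NuH_elem[OF _ _ _ _ bounded_borel_const] inner_elem)
qed

text \<open>The last stage of a recurring pattern: an identity is checked on \<open>elems\<close>,
  extended to the span by bilinearity, and to all vectors by continuity and density.\<close>

lemma closed_dense_pairs: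
  assumes "closed P" "span elems \<times> span elems \<subseteq> P"
  shows "(v, w) \<in> P"
proof -
  have "closure (span elems \<times> span elems) \<subseteq> P" using assms by (intro closure_minimal)
  then show ?thesis by (auto simp: closure_Times closure_span_elems)
qed

lemma NuH_cont: "continuous_on UNIV (\<lambda>p. NuH S (fst p) (snd p) A)"
  by (intro bounded_bilinear.continuous_on[OF NuH_bilinear] continuous_intros)

lemma inner_eq_NuH: "inner v w = NuH S v w UNIV"
proof -
  have "closed {p. inner (fst p) (snd p) = NuH S (fst p) (snd p) UNIV}"
    by (intro closed_Collect_eq continuous_intros NuH_cont)
  moreover have "int_NuH (\<lambda>x. 1) v w = NuH S v w UNIV" for v w
    using int_NuH_indicator[of UNIV v w] by (simp add: indicator_def)
  ultimately have "(v, w) \<in> {p. inner (fst p) (snd p) = NuH S (fst p) (snd p) UNIV}"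
    by (intro closed_dense_pairs) (auto simp: inner_span)
  then show ?thesis by simp
qed

text \<open>Both integrals of \<open>h\<close> equal the scalar product of \<open>elem h f1\<close>
  with the gradient of \<open>f2\<close>.\<close>

lemma Nu_sym:
  assumes f: "f1 \<in> Alg S" "f2 \<in> Alg S" shows "Nu S f1 f2 = Nu S f2 f1"
proof (rule signed_measure_eqI)
  fix h :: "'x \<Rightarrow> real" assume "continuous_on UNIV h"
  then have h: "h \<in> Cc" by (simp add: Cc_iff)
  show "signed_integral (Nu S f1 f2) h = signed_integral (Nu S f2 f1) h"
    using inner_elem[OF h f(1) Cc_const f(2), of 1] inner_elem[OF Cc_const f(2) h f(1), of 1]
    by (simp add: inner_commute)
qed (use f fsm_Nu in auto)

lemma NuH_sym: "NuH S v w A = NuH S w v A"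
proof (cases "A \<in> sets borel")
  case True
  have span: "int_NuH (indicator A) v w = int_NuH (indicator A) w v" if "v \<in> span elems" "w \<in> span elems" for v w
  proof (rule bilinear_eq[OF int_NuH_bilinear _ order_refl order_refl that])
    show "bounded_borel (indicator A)" using True by (rule bounded_borel_indicator)
    show "bilinear (\<lambda>v w. int_NuH (indicator A) w v)"
      using int_NuH_bilinear[OF bounded_borel_indicator[OF True]] by (auto simp: bilinear_def)
    show "int_NuH (indicator A) v w = int_NuH (indicator A) w v" if "v \<in> elems" "w \<in> elems" for v w
      using that Nu_sym by (auto simp: int_NuH_elem[OF _ _ _ _ bounded_borel_indicator[OF True]] mult.commute)
  qed
  have "closed {p. NuH S (fst p) (snd p) A = NuH S (snd p) (fst p) A}"
    by (intro closed_Collect_eq NuH_cont bounded_bilinear.continuous_on[OF NuH_bilinear] continuous_intros)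
  then have "(v, w) \<in> {p. NuH S (fst p) (snd p) A = NuH S (snd p) (fst p) A}"
    by (rule closed_dense_pairs) (use span True in \<open>auto simp: int_NuH_indicator\<close>)
  then show ?thesis by simp
next
  case False
  then show ?thesis using finite_signed_measure_notin[OF fsm_NuH] by auto
qed

lemma int_NuH_sym: "int_NuH k v w = int_NuH k w v"
proof -
  have "NuH S v w = NuH S w v" using NuH_sym by auto
  then show ?thesis by (simp add: int_NuH_def)
qed

text \<open>A relation, because \<open>k * h\<close> is not determined by the function \<open>avg h * du f\<close> alone; that it is
  single-valued follows from \<open>inner_graph\<close>.\<close>

definition graph :: "('x \<Rightarrow> real) \<Rightarrow> ('h \<times> 'h) set" where
  "graph k = span {(elem h f, elem (\<lambda>x. k x * h x) f) | h f. h \<in> Cc \<and> f \<in> Alg S}"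

lemma fst_graph: "fst ` graph k = span elems"
proof -
  have "elems = fst ` {(elem h f, elem (\<lambda>x. k x * h x) f) | h f. h \<in> Cc \<and> f \<in> Alg S}" by force
  then show ?thesis unfolding graph_def by (simp add: linear_span_image bounded_linear.linear[OF bounded_linear_fst])
qed

text \<open>On generators the two factors \<open>k\<close> move from the vectors into the integrand.
  Multiplication by \<open>k\<close> is still a relation here, so the identity is stated for any of
  its pairs; it yields positivity of \<open>NuH\<close> and the bound needed for
  \<open>mult\<close>.\<close>

lemma inner_graph:
  assumes k: "k \<in> Cc" and p: "p \<in> graph k" and q: "q \<in> graph k"
  shows "inner (snd p) (snd q) = int_NuH (\<lambda>x. k x * k x) (fst p) (fst q)"
proof -
  note kk = Cc_bounded_borel[OF Cc_mult[OF k k]]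
  have "bilinear (\<lambda>p q. inner (snd p) (snd q) :: real)"
    unfolding bilinear_def linear_iff by (auto simp: inner_add)
  moreover have "bilinear (\<lambda>p q. int_NuH (\<lambda>x. k x * k x) (fst p) (fst q))"
    using int_NuH_bilinear[OF kk] unfolding bilinear_def linear_iff by auto
  ultimately show ?thesis using p q unfolding graph_def
  proof (rule bilinear_eq[OF _ _ order_refl order_refl])
    fix p q
    assume "p \<in> {(elem h f, elem (\<lambda>x. k x * h x) f) | h f. h \<in> Cc \<and> f \<in> Alg S}"
      "q \<in> {(elem h f, elem (\<lambda>x. k x * h x) f) | h f. h \<in> Cc \<and> f \<in> Alg S}"
    then obtain h f h' f' where p: "p = (elem h f, elem (\<lambda>x. k x * h x) f)"
      and q: "q = (elem h' f', elem (\<lambda>x. k x * h' x) f')"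
      and hf: "h \<in> Cc" "f \<in> Alg S" "h' \<in> Cc" "f' \<in> Alg S" by blast
    have "(\<lambda>x. (k x * h x) * (k x * h' x)) = (\<lambda>x. (h x * h' x) * (k x * k x))"
      by (simp add: fun_eq_iff)
    then show "inner (snd p) (snd q) = int_NuH (\<lambda>x. k x * k x) (fst p) (fst q)"
      using inner_elem[OF Cc_mult[OF k hf(1)] hf(2) Cc_mult[OF k hf(3)] hf(4)]
      by (simp add: p q int_NuH_elem[OF hf kk])
  qed
qed

text \<open>The integral of \<open>h \<ge> 0\<close> with respect to \<open>\<nu>\<^sub>v\<close> is the squared norm of \<open>\<surd>h v\<close>.\<close>

lemma NuH_nonneg: "0 \<le> NuH S v v A"
proof -
  have span: "0 \<le> NuH S v v A" if v: "v \<in> span elems" for v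
  proof (rule signed_measure_nonneg[OF fsm_NuH])
    fix h :: "'x \<Rightarrow> real" assume h: "continuous_on UNIV h" "\<And>x. 0 \<le> h x"
    define k where "k x = sqrt (h x)" for x
    have k: "k \<in> Cc" unfolding k_def Cc_iff using h by (intro continuous_intros)
    have kk: "(\<lambda>x. k x * k x) = h" using h by (auto simp: k_def)
    obtain y where "(v, y) \<in> graph k" using v fst_graph[of k] by force
    from inner_graph[OF k this this] show "0 \<le> signed_integral (NuH S v v) h"
      by (simp add: kk int_NuH_def[symmetric]) (metis inner_ge_zero)
  qed
  have "closed {v. 0 \<le> NuH S v v A}"
    by (intro closed_Collect_le bounded_bilinear.continuous_on[OF NuH_bilinear] continuous_intros)
  then have "closure (span elems) \<subseteq> {v. 0 \<le> NuH S v v A}" using span by (intro closure_minimal) auto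
  then show ?thesis using closure_span_elems by auto
qed

lemma nu_vec_measure:
  "finite_measure (nu_vec S v)" "sets (nu_vec S v) = sets borel"
  "measure (nu_vec S v) A = NuH S v v A"
  unfolding nu_vec_def by (rule nonneg_signed_measure_to_measure[OF fsm_NuH NuH_nonneg])+

lemma int_NuH_diag:
  assumes "bounded_borel k" shows "int_NuH k v v = (LINT x|nu_vec S v. k x)"
proof -
  obtain K where k: "k \<in> borel_measurable borel" "\<And>x. \<bar>k x\<bar> \<le> K" using assms bounded_borelE by metis
  show ?thesis unfolding int_NuH_def
    by (rule signed_integral_measure[OF nu_vec_measure(1,2) _ fsm_NuH k]) (simp add: nu_vec_measure)
qed

lemma norm_sq_NuH: "(norm v)\<^sup>2 = NuH S v v UNIV"
  by (simp add: power2_norm_eq_inner inner_eq_NuH)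

text \<open>On the diagonal this is integration against a positive measure. Polarization then gives
  a bound by the mean of the squared norms, and scaling both vectors to norm 1 turns the mean into
  the product with the same constant \<open>K\<close>.\<close>

lemma int_NuH_bound:
  assumes k: "k \<in> borel_measurable borel" "\<And>x. \<bar>k x\<bar> \<le> K"
  shows "\<bar>int_NuH k v w\<bar> \<le> K * (norm v * norm w)"
proof -
  have kb: "bounded_borel k" using k by (auto simp: bounded_borel_def)
  interpret B: bounded_bilinear "\<lambda>v w. NuH S v w A" for A by (rule NuH_bilinear)
  note bil = int_NuH_bilinear[OF kb]
  have diag: "\<bar>int_NuH k v v\<bar> \<le> K * (norm v)\<^sup>2" for v
  proof -
    note f = nu_vec_measure(1,2)[of v]
    have "\<bar>LINT x|nu_vec S v. k x\<bar> \<le> (LINT x|nu_vec S v. \<bar>k x\<bar>)" by simp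
    also have "\<dots> \<le> (LINT x|nu_vec S v. K)"
      using k f by (intro integral_mono finite_measure.integrable_const integrable_abs
          finite_borel_integrable[where K=K]) auto
    also have "\<dots> = K * (norm v)\<^sup>2"
      using sets_eq_imp_space_eq[OF f(2)] by (simp add: norm_sq_NuH nu_vec_measure(3))
    finally show ?thesis by (simp add: int_NuH_diag[OF kb])
  qed
  have pol: "2 * \<bar>int_NuH k v w\<bar> \<le> K * ((norm v)\<^sup>2 + (norm w)\<^sup>2)" for v w
  proof -
    have "4 * int_NuH k v w = int_NuH k (v + w) (v + w) - int_NuH k (v - w) (v - w)"
      using int_NuH_sym[of k v w]
      by (simp add: bilinear_ladd[OF bil] bilinear_radd[OF bil] bilinear_lsub[OF bil] bilinear_rsub[OF bil])
    then have "4 * \<bar>int_NuH k v w\<bar> \<le> K * (norm (v + w))\<^sup>2 + K * (norm (v - w))\<^sup>2"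
      using diag[of "v + w"] diag[of "v - w"] by linarith
    also have "\<dots> = K * ((norm (v + w))\<^sup>2 + (norm (v - w))\<^sup>2)" by (simp add: algebra_simps)
    also have "(norm (v + w))\<^sup>2 + (norm (v - w))\<^sup>2 = 2 * ((norm v)\<^sup>2 + (norm w)\<^sup>2)"
      by (simp add: power2_norm_eq_inner inner_add inner_diff inner_commute)
    finally show ?thesis by (simp add: algebra_simps)
  qed
  show ?thesis
  proof (cases "v = 0 \<or> w = 0")
    case True
    then show ?thesis by (auto simp: bilinear_lzero[OF bil] bilinear_rzero[OF bil])
  next
    case False
    then have n: "norm v > 0" "norm w > 0" by auto
    define a b where "a = inverse (norm v)" and "b = inverse (norm w)"
    have ab: "norm (a *\<^sub>R v) = 1" "norm (b *\<^sub>R w) = 1" "a > 0" "b > 0"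
      using n by (auto simp: a_def b_def)
    have "int_NuH k (a *\<^sub>R v) (b *\<^sub>R w) = a * (b * int_NuH k v w)"
      by (simp add: bilinear_lmul[OF bil] bilinear_rmul[OF bil])
    then have "a * (b * \<bar>int_NuH k v w\<bar>) \<le> K"
      using pol[of "a *\<^sub>R v" "b *\<^sub>R w"] ab by (simp add: abs_mult)
    then show ?thesis using n by (simp add: a_def b_def field_simps)
  qed
qed

lemma int_NuH_bounded_bilinear:
  assumes "bounded_borel k" shows "bounded_bilinear (int_NuH k)"
proof -
  obtain K where k: "k \<in> borel_measurable borel" "\<And>x. \<bar>k x\<bar> \<le> K" using assms bounded_borelE by metis
  note bil = int_NuH_bilinear[OF assms]
  show ?thesis
  proof
    show "\<exists>K. \<forall>v w. norm (int_NuH k v w) \<le> norm v * norm w * K"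
      using int_NuH_bound[OF k] by (auto simp: mult_ac intro!: exI[of _ K])
  qed (simp_all add: bilinear_ladd[OF bil] bilinear_radd[OF bil] bilinear_lmul[OF bil] bilinear_rmul[OF bil])
qed

section \<open>Multiplication of vectors by continuous functions\<close>

lemma mult_unique:
  assumes "bounded_linear T" "bounded_linear T'" "\<And>v. v \<in> elems \<Longrightarrow> T v = T' v"
  shows "T = T'"
proof
  fix v
  have "closed {v. T v = T' v}"
    using assms by (intro closed_Collect_eq linear_continuous_on) auto
  moreover have "span elems \<subseteq> {v. T v = T' v}"
    using linear_eq_on_span[of T T' elems] assms bounded_linear.linear by blast
  ultimately show "T v = T' v"
    using closure_minimal[of "span elems" "{v. T v = T' v}"] closure_span_elems by auto
qed

text \<open>The description in \<open>mult\<close> denotes: if \<open>K\<close> bounds the square of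
  \<open>k\<close>, the densely defined relation \<open>graph k\<close> is bounded by
  \<open>sqrt K\<close> and extends to an operator.\<close>

lemma mult_exists:
  assumes k: "k \<in> Cc"
  shows "bounded_linear (mult S k)" "h \<in> Cc \<Longrightarrow> f \<in> Alg S \<Longrightarrow> mult S k (elem h f) = elem (\<lambda>x. k x * h x) f"
proof -
  obtain K where K: "(\<lambda>x. k x * k x) \<in> borel_measurable borel" "\<And>x. \<bar>k x * k x\<bar> \<le> K" "0 \<le> K"
    using Cc_bounded_borel[OF Cc_mult[OF k k]] bounded_borelE by metis
  have bound: "norm y \<le> sqrt K * norm x" if "(x, y) \<in> graph k" for x y
  proof -
    have "(norm y)\<^sup>2 = int_NuH (\<lambda>x. k x * k x) x x"
      using inner_graph[OF k that that] by (simp add: power2_norm_eq_inner)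
    also have "\<dots> \<le> K * (norm x)\<^sup>2" using int_NuH_bound[OF K(1,2), of x x] by (simp add: power2_eq_square)
    also have "\<dots> = (sqrt K * norm x)\<^sup>2" using K by (simp add: power_mult_distrib)
    finally show ?thesis by (rule power2_le_imp_le) (use K(3) in simp)
  qed
  obtain T where T: "bounded_linear T" "\<forall>(x, y)\<in>graph k. T x = y"
  proof -
    have "\<exists>T. bounded_linear T \<and> (\<forall>(x, y)\<in>graph k. T x = y)"
    proof (rule bounded_linear_of_graph[of "graph k" "sqrt K", OF _ _ bound])
      show "closure (fst ` graph k) = UNIV" by (simp add: fst_graph closure_span_elems)
    qed (simp_all add: graph_def span_add span_scale)
    then show ?thesis using that by blast
  qed
  have Te: "T (elem h f) = elem (\<lambda>x. k x * h x) f" if "h \<in> Cc" "f \<in> Alg S" for h f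
  proof -
    have "(elem h f, elem (\<lambda>x. k x * h x) f) \<in> graph k"
      unfolding graph_def using that by (intro span_base) blast
    from bspec[OF T(2) this] show ?thesis by simp
  qed
  have "mult S k = T" unfolding mult_def
  proof (rule the_equality)
    fix T' assume T': "bounded_linear T' \<and> (\<forall>h\<in>Cc. \<forall>f\<in>Alg S. T' (elem h f) = elem (\<lambda>x. k x * h x) f)"
    show "T' = T"
      by (rule mult_unique) (use T(1) T' Te in auto)
  qed (use T(1) Te in auto)
  then show "bounded_linear (mult S k)" "h \<in> Cc \<Longrightarrow> f \<in> Alg S \<Longrightarrow> mult S k (elem h f) = elem (\<lambda>x. k x * h x) f"
    using T(1) Te by auto
qed

text \<open>The link between action and measures. Self-adjointness of \<open>mult\<close>, the
  isometry \<open>norm_mult_sq\<close>, and the vanishing of the mixed measure of \<open>b\<close>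
  with vectors orthogonal to all \<open>k b\<close> come from it.\<close>

lemma inner_mult:
  assumes k: "k \<in> Cc" shows "inner (mult S k v) w = int_NuH k v w"
proof -
  note kb = Cc_bounded_borel[OF k]
  interpret T: bounded_linear "mult S k" by (rule mult_exists[OF k])
  have bil: "bilinear (\<lambda>v w. inner (mult S k v) w)"
    unfolding bilinear_def linear_iff by (auto simp: inner_add T.add T.scaleR)
  have span: "inner (mult S k v) w = int_NuH k v w" if "v \<in> span elems" "w \<in> span elems" for v w
  proof (rule bilinear_eq[OF bil int_NuH_bilinear[OF kb] order_refl order_refl that])
    show "inner (mult S k v) w = int_NuH k v w" if "v \<in> elems" "w \<in> elems" for v w
    proof -
      obtain h f h' f' where vw: "v = elem h f" "w = elem h' f'"
        and hf: "h \<in> Cc" "f \<in> Alg S" "h' \<in> Cc" "f' \<in> Alg S" using \<open>v \<in> elems\<close> \<open>w \<in> elems\<close> by blast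
      have "(\<lambda>x. (k x * h x) * h' x) = (\<lambda>x. (h x * h' x) * k x)"
        by (simp add: fun_eq_iff)
      then show ?thesis
        using inner_elem[OF Cc_mult[OF k hf(1)] hf(2) hf(3,4)]
        by (simp add: vw mult_exists(2)[OF k hf(1,2)] int_NuH_elem[OF hf kb])
    qed
  qed
  have "closed {p. inner (mult S k (fst p)) (snd p) = int_NuH k (fst p) (snd p)}"
    by (intro closed_Collect_eq continuous_intros T.continuous_on
        bounded_bilinear.continuous_on[OF int_NuH_bounded_bilinear[OF kb]])
  then have "(v, w) \<in> {p. inner (mult S k (fst p)) (snd p) = int_NuH k (fst p) (snd p)}"
    by (rule closed_dense_pairs) (use span in auto)
  then show ?thesis by simp
qed

lemma mult_mult:
  assumes "k \<in> Cc" "l \<in> Cc" shows "mult S k (mult S l v) = mult S (\<lambda>x. k x * l x) v"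
proof -
  have "(\<lambda>v. mult S k (mult S l v)) = mult S (\<lambda>x. k x * l x)"
  proof (rule mult_unique)
    show "bounded_linear (\<lambda>v. mult S k (mult S l v))"
      using bounded_linear_compose mult_exists(1) assms by blast
    show "bounded_linear (mult S (\<lambda>x. k x * l x))" using mult_exists(1) Cc_mult assms by blast
    show "mult S k (mult S l v) = mult S (\<lambda>x. k x * l x) v" if "v \<in> elems" for v
      using that assms by (auto simp: mult_exists Cc_mult mult.assoc)
  qed
  then show ?thesis by metis
qed

lemma mult_one: "mult S (\<lambda>x. 1) v = v"
proof -
  have "mult S (\<lambda>x. 1) = (\<lambda>v. v)"
    by (rule mult_unique) (auto simp: mult_exists bounded_linear_ident)
  then show ?thesis by metis
qed

text \<open>On \<open>Cc\<close> this is the isometry that \<open>star\<close> extends to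
  L2.\<close>

lemma norm_mult_sq:
  assumes k: "k \<in> Cc" shows "(norm (mult S k v))\<^sup>2 = (LINT x|nu_vec S v. (k x)\<^sup>2)"
proof -
  have "(norm (mult S k v))\<^sup>2 = int_NuH k v (mult S k v)" by (simp add: power2_norm_eq_inner inner_mult[OF k])
  also have "\<dots> = inner (mult S k (mult S k v)) v" by (simp add: inner_mult[OF k] int_NuH_sym)
  also have "\<dots> = int_NuH (\<lambda>x. k x * k x) v v"
    by (simp add: mult_mult[OF k k] inner_mult[OF Cc_mult[OF k k]])
  also have "\<dots> = (LINT x|nu_vec S v. (k x)\<^sup>2)"
    by (simp add: int_NuH_diag[OF Cc_bounded_borel[OF Cc_mult[OF k k]]] power2_eq_square)
  finally show ?thesis .
qed

lemma mult_lincomb_left: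
  assumes "k \<in> Cc" "l \<in> Cc" shows "mult S (\<lambda>x. k x + c * l x) v = mult S k v + c *\<^sub>R mult S l v"
proof -
  have kl: "(\<lambda>x. k x + c * l x) \<in> Cc" using assms by (intro Cc_add Cc_mult Cc_const)
  have "mult S (\<lambda>x. k x + c * l x) = (\<lambda>v. mult S k v + c *\<^sub>R mult S l v)"
  proof (rule mult_unique)
    show "bounded_linear (\<lambda>v. mult S k v + c *\<^sub>R mult S l v)"
      by (intro bounded_linear_add bounded_linear_const_scaleR mult_exists assms)
    show "bounded_linear (mult S (\<lambda>x. k x + c * l x))" by (rule mult_exists[OF kl])
    fix v assume "v \<in> elems"
    then obtain h f where hf: "v = elem h f" "h \<in> Cc" "f \<in> Alg S" by blast
    have m: "(\<lambda>z. avg (\<lambda>x. k x * h x) z * du f z) \<in> one_form_span (Alg S)"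
      "(\<lambda>z. avg (\<lambda>x. c * (l x * h x)) z * du f z) \<in> one_form_span (Alg S)"
      "(\<lambda>z. avg (\<lambda>x. l x * h x) z * du f z) \<in> one_form_span (Alg S)"
      using hf(2,3) assms by (simp_all add: elem_in_span Cc_mult)
    have "(\<lambda>z. avg (\<lambda>x. (k x + c * l x) * h x) z * du f z) =
        (\<lambda>z. avg (\<lambda>x. k x * h x) z * du f z + avg (\<lambda>x. c * (l x * h x)) z * du f z)"
      and "(\<lambda>z. avg (\<lambda>x. c * (l x * h x)) z * du f z) = (\<lambda>z. c * (avg (\<lambda>x. l x * h x) z * du f z))"
      by (auto simp: avg_def field_simps)
    then show "mult S (\<lambda>x. k x + c * l x) v = mult S k v + c *\<^sub>R mult S l v"
      using Cls_add[OF m(1,2)] Cls_scale[OF m(3), of c] hf assms mult_exists(2)[OF kl hf(2,3)]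
      by (simp add: mult_exists)
  qed
  then show ?thesis by metis
qed

lemma mult_diff_left:
  assumes "k \<in> Cc" "l \<in> Cc" shows "mult S (\<lambda>x. k x - l x) v = mult S k v - mult S l v"
  using mult_lincomb_left[OF assms, of "-1"] by simp

lemma norm_mult_diff_sq:
  assumes "k \<in> Cc" "l \<in> Cc"
  shows "(norm (mult S k v - mult S l v))\<^sup>2 = (LINT x|nu_vec S v. (k x - l x)\<^sup>2)"
  using norm_mult_sq[OF Cc_diff[OF assms], of v] by (simp only: mult_diff_left[OF assms])

end

section \<open>The isometry given by a vector\<close>

lemma discriminant_le:
  fixes a b c :: real
  assumes q: "\<And>t. 0 \<le> a + 2 * t * b + t\<^sup>2 * c"
  shows "b\<^sup>2 \<le> a * c"
proof (cases "c = 0")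
  case True
  have "b = 0"
  proof (rule ccontr)
    assume "b \<noteq> 0"
    \<comment> \<open>At this point \<open>a + 2 * t * b\<close> equals \<open>-1\<close>.\<close>
    then show False using q[of "- (a + 1) / (2 * b)"] True by (simp add: field_simps)
  qed
  then show ?thesis using True by simp
next
  case False
  have a0: "0 \<le> a" using q[of 0] by simp
  have c0: "c > 0"
  proof (rule ccontr)
    assume "\<not> c > 0"
    then have c: "c < 0" using False by simp
    \<comment> \<open>Adding the values at \<open>t\<close> and \<open>- t\<close> removes
      \<open>b\<close> and leaves \<open>t\<^sup>2 * \<bar>c\<bar> \<le> a\<close>; this
      \<open>t\<close> is at least 1 and large enough to contradict it.\<close>
    define t where "t = (a + 1 + \<bar>b\<bar>) / \<bar>c\<bar> + 1"
    have t1: "t \<ge> 1" using a0 by (simp add: t_def)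
    have tc: "t * \<bar>c\<bar> > a + \<bar>b\<bar>" using c by (simp add: t_def field_simps)
    have "0 \<le> (a + 2 * t * b + t\<^sup>2 * c) + (a + 2 * (-t) * b + (-t)\<^sup>2 * c)" using q[of t] q[of "-t"] by linarith
    then have "t * (t * \<bar>c\<bar>) \<le> a" using c by (simp add: power2_eq_square mult_ac)
    moreover have "t * (t * \<bar>c\<bar>) \<ge> 1 * (t * \<bar>c\<bar>)" using t1 by (intro mult_right_mono) simp_all
    ultimately show False using tc by simp
  qed
  have "0 \<le> a + 2 * (- b / c) * b + (- b / c)\<^sup>2 * c" by (rule q)
  also have "\<dots> = a - b\<^sup>2 / c" using c0 by (simp add: power2_eq_square field_simps)
  finally show ?thesis using c0 by (simp add: field_simps)
qed

lemma L2_Cauchy_Schwarz: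
  assumes M: "finite_measure M" and f: "f \<in> L2 M" and g: "g \<in> L2 M"
  shows "(LINT x|M. f x * g x)\<^sup>2 \<le> (LINT x|M. (f x)\<^sup>2) * (LINT x|M. (g x)\<^sup>2)"
proof (rule discriminant_le)
  fix t :: real
  have i: "integrable M (\<lambda>x. (f x)\<^sup>2)" "integrable M (\<lambda>x. (g x)\<^sup>2)" "integrable M (\<lambda>x. f x * g x)"
    using f g L2_integrable(2)[OF M f g] by (auto simp: L2_def)
  have "0 \<le> (LINT x|M. (f x + t * g x)\<^sup>2)" by simp
  also have "(\<lambda>x. (f x + t * g x)\<^sup>2) = (\<lambda>x. (f x)\<^sup>2 + (2 * t) * (f x * g x) + t\<^sup>2 * (g x)\<^sup>2)"
    by (auto simp: power2_eq_square algebra_simps)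
  finally show "0 \<le> (LINT x|M. (f x)\<^sup>2) + 2 * t * (LINT x|M. f x * g x) + t\<^sup>2 * (LINT x|M. (g x)\<^sup>2)"
    using i by simp
qed

lemma L2_abs_integral_le:
  assumes M: "finite_measure M" and f: "f \<in> L2 M"
  shows "(LINT x|M. \<bar>f x\<bar>) \<le> sqrt (measure M (space M)) * sqrt (LINT x|M. (f x)\<^sup>2)"
proof -
  have "(\<lambda>x. 1) \<in> L2 M" "(\<lambda>x. \<bar>f x\<bar>) \<in> L2 M"
    using f finite_measure.integrable_const[OF M, of 1] by (auto simp: L2_def)
  from L2_Cauchy_Schwarz[OF M this]
  have "(LINT x|M. \<bar>f x\<bar>)\<^sup>2 \<le> measure M (space M) * (LINT x|M. (f x)\<^sup>2)" by simp
  from real_sqrt_le_mono[OF this] show ?thesis by (simp add: real_sqrt_mult)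
qed

text \<open>Riesz-Fischer: a rapidly converging subsequence converges almost everywhere, and Fatou's
  lemma shows that its limit is the limit of the whole sequence in mean square.\<close>

lemma L2_complete:
  fixes s :: "nat \<Rightarrow> 'a \<Rightarrow> real"
  assumes M: "finite_measure M" and s: "\<And>n. s n \<in> L2 M"
    and Cauchy: "\<And>e. e > 0 \<Longrightarrow> \<exists>N. \<forall>m\<ge>N. \<forall>n\<ge>N. (LINT x|M. (s m x - s n x)\<^sup>2) < e"
  shows "\<exists>g\<in>L2 M. (\<lambda>n. LINT x|M. (s n x - g x)\<^sup>2) \<longlonglongrightarrow> 0"
proof -
  \<comment> \<open>Squared distances below \<open>(1/4)^k\<close> give L1 distances of order
    \<open>(1/2)^k\<close>, which are summable.\<close>
  have "\<exists>N. \<forall>m\<ge>N. \<forall>n\<ge>N. (LINT x|M. (s m x - s n x)\<^sup>2) < (1/4)^k" for k :: nat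
    by (rule Cauchy) simp
  then obtain N where N: "\<And>k m n. m \<ge> N k \<Longrightarrow> n \<ge> N k \<Longrightarrow> (LINT x|M. (s m x - s n x)\<^sup>2) < (1/4)^k"
    by metis
  \<comment> \<open>Partial sums make \<open>r\<close> monotone with \<open>r k \<ge> N k\<close>;
    the summands 1 give \<open>r k \<ge> k\<close>, so the subsequence passes every
    threshold.\<close>
  define r where "r k = (\<Sum>i\<le>k. N i + 1)" for k
  have r1: "r k \<ge> N k" for k
    using member_le_sum[of k "{..k}" "\<lambda>i. N i + 1"] by (simp add: r_def)
  have r2: "r (Suc k) \<ge> r k" for k by (simp add: r_def)
  have r3: "r k \<ge> k" for k by (induction k) (auto simp: r_def)
  define t where "t k = s (r k)" for k
  have tL: "t k \<in> L2 M" for k by (simp add: t_def s)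
  have [measurable]: "s k \<in> borel_measurable M" "t k \<in> borel_measurable M" for k
    using s tL by (auto simp: L2_def)
  define C where "C = sqrt (measure M (space M))"
  have step: "(LINT x|M. \<bar>t (Suc k) x - t k x\<bar>) \<le> C * (1/2)^k" for k
  proof -
    have "(LINT x|M. (t (Suc k) x - t k x)\<^sup>2) \<le> (1/4)^k"
      unfolding t_def using N[of k "r (Suc k)" "r k"] r1[of k] r2[of k] by simp
    then have "sqrt (LINT x|M. (t (Suc k) x - t k x)\<^sup>2) \<le> sqrt ((1/4)^k)" by simp
    also have "sqrt ((1/4)^k) = (1/2)^k" by (simp add: real_sqrt_power real_sqrt_divide)
    finally have "sqrt (LINT x|M. (t (Suc k) x - t k x)\<^sup>2) \<le> (1/2)^k" .
    then have "C * sqrt (LINT x|M. (t (Suc k) x - t k x)\<^sup>2) \<le> C * (1/2)^k"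
      by (intro mult_left_mono) (auto simp: C_def)
    then show ?thesis
      using L2_abs_integral_le[OF M L2_diff[OF M tL[of "Suc k"] tL[of k]]] by (simp add: C_def)
  qed
  have "(\<integral>\<^sup>+x. (\<Sum>k. ennreal \<bar>t (Suc k) x - t k x\<bar>) \<partial>M) = (\<Sum>k. \<integral>\<^sup>+x. ennreal \<bar>t (Suc k) x - t k x\<bar> \<partial>M)"
    by (rule nn_integral_suminf) measurable
  also have "\<dots> \<le> (\<Sum>k. ennreal (C * (1/2)^k))"
  proof (rule suminf_le)
    fix k
    have "integrable M (\<lambda>x. \<bar>t (Suc k) x - t k x\<bar>)"
      using L2_integrable(1)[OF M L2_diff[OF M tL[of "Suc k"] tL[of k]] tL] by auto
    then have "(\<integral>\<^sup>+x. ennreal \<bar>t (Suc k) x - t k x\<bar> \<partial>M) = ennreal (LINT x|M. \<bar>t (Suc k) x - t k x\<bar>)"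
      by (intro nn_integral_eq_integral) auto
    then show "(\<integral>\<^sup>+x. ennreal \<bar>t (Suc k) x - t k x\<bar> \<partial>M) \<le> ennreal (C * (1/2)^k)"
      using step[of k] by (simp add: ennreal_leI)
  qed auto
  also have "\<dots> = ennreal (\<Sum>k. C * (1/2)^k)"
    by (rule suminf_ennreal2) (auto simp: C_def intro: summable_mult)
  also have "\<dots> < \<infinity>" by simp
  finally have "AE x in M. (\<Sum>k. ennreal \<bar>t (Suc k) x - t k x\<bar>) \<noteq> \<infinity>"
    by (intro nn_integral_PInf_AE) (auto simp: less_top)
  then have conv: "AE x in M. convergent (\<lambda>k. t k x)"
  proof eventually_elim
    case (elim x)
    have "summable (\<lambda>k. \<bar>t (Suc k) x - t k x\<bar>)"
      using elim by (intro summable_suminf_not_top) auto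
    then have "summable (\<lambda>k. t (Suc k) x - t k x)" by (rule summable_rabs_cancel)
    then have "convergent (\<lambda>n. \<Sum>k<n. t (Suc k) x - t k x)" by (simp add: summable_iff_convergent)
    moreover have "(\<lambda>n. \<Sum>k<n. t (Suc k) x - t k x) = (\<lambda>n. t n x - t 0 x)"
      by (rule ext) (rule sum_lessThan_telescope)
    ultimately have "convergent (\<lambda>n. t n x - t 0 x)" by simp
    then obtain L where "(\<lambda>n. t n x - t 0 x) \<longlonglongrightarrow> L" by (auto simp: convergent_def)
    from tendsto_add[OF this tendsto_const[of "t 0 x"]] show ?case by (auto simp: convergent_def)
  qed
  define g where "g x = lim (\<lambda>k. t k x)" for x
  have gm[measurable]: "g \<in> borel_measurable M" unfolding g_def by measurable
  \<comment> \<open>Fatou along the subsequence with \<open>s m\<close> fixed yields integrability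
    and the bound together.\<close>
  have bound: "integrable M (\<lambda>x. (s m x - g x)\<^sup>2) \<and> (LINT x|M. (s m x - g x)\<^sup>2) \<le> e"
    if e: "e > 0" and K: "\<And>m n. m \<ge> K \<Longrightarrow> n \<ge> K \<Longrightarrow> (LINT x|M. (s m x - s n x)\<^sup>2) < e" and m: "m \<ge> K"
    for e K m
  proof -
    have "(\<integral>\<^sup>+x. ennreal ((s m x - g x)\<^sup>2) \<partial>M) = (\<integral>\<^sup>+x. liminf (\<lambda>k. ennreal ((s m x - t k x)\<^sup>2)) \<partial>M)"
    proof (rule nn_integral_cong_AE)
      show "AE x in M. ennreal ((s m x - g x)\<^sup>2) = liminf (\<lambda>k. ennreal ((s m x - t k x)\<^sup>2))"
        using conv
      proof eventually_elim
        case (elim x)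
        then have "(\<lambda>k. t k x) \<longlonglongrightarrow> g x" by (simp add: g_def convergent_LIMSEQ_iff)
        then have "(\<lambda>k. ennreal ((s m x - t k x)\<^sup>2)) \<longlonglongrightarrow> ennreal ((s m x - g x)\<^sup>2)"
          by (intro tendsto_ennrealI tendsto_intros)
        from lim_imp_Liminf[OF _ this] show ?case by simp
      qed
    qed
    also have "\<dots> \<le> liminf (\<lambda>k. \<integral>\<^sup>+x. ennreal ((s m x - t k x)\<^sup>2) \<partial>M)"
      by (rule nn_integral_liminf) measurable
    also have "\<dots> \<le> ennreal e"
    proof (rule Liminf_le)
      have "(\<integral>\<^sup>+x. ennreal ((s m x - t k x)\<^sup>2) \<partial>M) \<le> ennreal e" if "k \<ge> K" for k
      proof -
        have "(LINT x|M. (s m x - t k x)\<^sup>2) < e"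
          unfolding t_def using K[OF m, of "r k"] r3[of k] that by simp
        moreover have "integrable M (\<lambda>x. (s m x - t k x)\<^sup>2)"
          using L2_diff[OF M s tL] by (simp add: L2_def)
        then have "(\<integral>\<^sup>+x. ennreal ((s m x - t k x)\<^sup>2) \<partial>M) = ennreal (LINT x|M. (s m x - t k x)\<^sup>2)"
          by (intro nn_integral_eq_integral) auto
        ultimately show ?thesis by (simp add: ennreal_leI)
      qed
      then show "\<forall>\<^sub>F k in sequentially. (\<integral>\<^sup>+x. ennreal ((s m x - t k x)\<^sup>2) \<partial>M) \<le> ennreal e"
        by (auto simp: eventually_sequentially)
    qed simp
    finally have le: "(\<integral>\<^sup>+x. ennreal ((s m x - g x)\<^sup>2) \<partial>M) \<le> ennreal e" .
    then have i: "integrable M (\<lambda>x. (s m x - g x)\<^sup>2)"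
      by (intro integrableI_nonneg) (auto simp: less_top[symmetric] top_unique)
    then have "ennreal (LINT x|M. (s m x - g x)\<^sup>2) \<le> ennreal e"
      using le by (subst nn_integral_eq_integral[symmetric]) auto
    then show ?thesis using i e by (simp add: ennreal_le_iff)
  qed
  have "g \<in> L2 M"
  proof -
    obtain K where K: "\<And>m n. m \<ge> K \<Longrightarrow> n \<ge> K \<Longrightarrow> (LINT x|M. (s m x - s n x)\<^sup>2) < 1"
      using Cauchy[of 1] by auto
    have "integrable M (\<lambda>x. (s K x - g x)\<^sup>2)"
      by (rule conjunct1[OF bound[of 1 K K]]) (use K in auto)
    then have "(\<lambda>x. s K x - g x) \<in> L2 M" by (simp add: L2_def)
    from L2_diff[OF M s[of K] this] show ?thesis by simp
  qed
  moreover have "(\<lambda>n. LINT x|M. (s n x - g x)\<^sup>2) \<longlonglongrightarrow> 0"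
  proof (rule LIMSEQ_I)
    fix e :: real assume e: "e > 0"
    then have e2: "e/2 > 0" by simp
    obtain K where K: "\<And>m n. m \<ge> K \<Longrightarrow> n \<ge> K \<Longrightarrow> (LINT x|M. (s m x - s n x)\<^sup>2) < e/2"
      using Cauchy[OF e2] by auto
    have "norm ((LINT x|M. (s n x - g x)\<^sup>2) - 0) < e" if "n \<ge> K" for n
    proof -
      have "(LINT x|M. (s n x - g x)\<^sup>2) \<le> e/2"
        by (rule conjunct2[OF bound[of "e/2" K n]]) (use K e2 that in auto)
      moreover have "0 \<le> (LINT x|M. (s n x - g x)\<^sup>2)" by simp
      ultimately show ?thesis using e by simp
    qed
    then show "\<exists>no. \<forall>n\<ge>no. norm ((LINT x|M. (s n x - g x)\<^sup>2) - 0) < e" by blast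
  qed
  ultimately show ?thesis by blast
qed

lemma L2_AE_zero:
  assumes "f \<in> L2 M" "(LINT x|M. (f x)\<^sup>2) = 0"
  shows "AE x in M. f x = 0"
  using assms integral_nonneg_eq_0_iff_AE[of M "\<lambda>x. (f x)\<^sup>2"] by (simp add: L2_def)

context compact_form
begin

lemma NuH_Cauchy_Schwarz: "(NuH S v w A)\<^sup>2 \<le> NuH S v v A * NuH S w w A"
proof (rule discriminant_le)
  fix t :: real
  interpret N: bounded_bilinear "\<lambda>v w. NuH S v w A" by (rule NuH_bilinear)
  have "0 \<le> NuH S (v + t *\<^sub>R w) (v + t *\<^sub>R w) A" by (rule NuH_nonneg)
  also have "\<dots> = NuH S v v A + 2 * t * NuH S v w A + t\<^sup>2 * NuH S w w A"
    by (simp add: N.add_left N.add_right N.scaleR_left N.scaleR_right NuH_sym[of w v] power2_eq_square algebra_simps)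
  finally show "0 \<le> NuH S v v A + 2 * t * NuH S v w A + t\<^sup>2 * NuH S w w A" .
qed

lemma NuH_le_norm: "\<bar>NuH S v w A\<bar> \<le> norm v * norm w"
proof (cases "A \<in> sets borel")
  case True
  have "indicator A \<in> borel_measurable borel" using True by auto
  from int_NuH_bound[OF this, of 1 v w] show ?thesis
    using int_NuH_indicator[OF True, of v w] by (simp add: indicator_def)
next
  case False
  then show ?thesis using finite_signed_measure_notin[OF fsm_NuH] by simp
qed

section \<open>The derivation and its calculus\<close>

lemma grad_elem: "grad S f = elem (\<lambda>x. 1) f"
proof -
  have "(\<lambda>z. avg (\<lambda>x. 1) z * du f z) = du f" by (auto simp: avg_def)
  then show ?thesis by (simp add: grad_def)
qed

lemma mult_grad: "k \<in> Cc \<Longrightarrow> f \<in> Alg S \<Longrightarrow> mult S k (grad S f) = elem k f"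
  by (simp add: grad_elem mult_exists)

lemma du_in_span: "f \<in> Alg S \<Longrightarrow> du f \<in> one_form_span (Alg S)"
  using elem_in_span[OF Cc_const, of f 1] by (simp add: avg_def case_prod_unfold)

lemma grad_add: "f \<in> Alg S \<Longrightarrow> g \<in> Alg S \<Longrightarrow> grad S (\<lambda>x. f x + g x) = grad S f + grad S g"
proof -
  assume fg: "f \<in> Alg S" "g \<in> Alg S"
  have "du (\<lambda>x. f x + g x) = (\<lambda>z. du f z + du g z)" by (auto simp: du_def)
  then show ?thesis using Cls_add[OF du_in_span du_in_span] fg by (simp add: grad_def)
qed

lemma grad_cmult: "f \<in> Alg S \<Longrightarrow> grad S (\<lambda>x. c * f x) = c *\<^sub>R grad S f"
proof -
  assume f: "f \<in> Alg S"
  have "du (\<lambda>x. c * f x) = (\<lambda>z. c * du f z)" by (auto simp: du_def algebra_simps)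
  then show ?thesis using Cls_scale[OF du_in_span] f by (simp add: grad_def)
qed

lemma grad_diff: "f \<in> Alg S \<Longrightarrow> g \<in> Alg S \<Longrightarrow> grad S (\<lambda>x. f x - g x) = grad S f - grad S g"
  using grad_add[of f "\<lambda>x. (-1) * g x"] grad_cmult[of g "-1"] Alg_cmult[of g "-1"] by simp

lemma grad_const: "grad S (\<lambda>x. c) = 0"
  using grad_cmult[OF one, of 0] Cls_scale[OF du_in_span[OF one], of 0]
  by (simp add: grad_def du_def case_prod_unfold)

text \<open>The Leibniz rule holds exactly for functions of two variables: f(x) g(x) - f(y) g(y) is
  average times difference, summed over both orders. This is the purpose of the averages.\<close>

lemma grad_mult:
  assumes f: "f \<in> Alg S" and g: "g \<in> Alg S"
  shows "grad S (\<lambda>x. f x * g x) = mult S f (grad S g) + mult S g (grad S f)"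
proof -
  have "du (\<lambda>x. f x * g x) = (\<lambda>z. avg f z * du g z + avg g z * du f z)"
    by (auto simp: du_def avg_def field_simps)
  then have "grad S (\<lambda>x. f x * g x) = elem f g + elem g f"
    using f g by (simp add: grad_def Cls_add elem_in_span Alg_Cc)
  then show ?thesis using f g by (simp add: mult_grad Alg_Cc)
qed

text \<open>Integrate 1 against the energy measure. The third term E(f g, 1) vanishes by locality,
  since 1 is constant on a neighborhood of any support.\<close>

lemma Form_inner:
  assumes f: "f \<in> Alg S" and g: "g \<in> Alg S"
  shows "Form S f g = inner (grad S f) (grad S g)"
proof -
  have "inner (grad S f) (grad S g) = signed_integral (Nu S f g) (\<lambda>x. 1)"
    using inner_elem[OF Cc_const f Cc_const g, of 1 1] by (simp add: grad_elem)
  also have "\<dots> = 1/2 * (Form S (\<lambda>x. f x * 1) g + Form S f (\<lambda>x. g x * 1) - Form S (\<lambda>x. f x * g x) (\<lambda>x. 1))"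
    using fos f g one unfolding first_order_structure_def energy_measures_def by blast
  also have "Form S (\<lambda>x. f x * g x) (\<lambda>x. 1) = 0"
  proof -
    have "\<exists>U a. open U \<and> closure {x. f x * g x \<noteq> 0} \<subseteq> U \<and> (\<forall>x\<in>U. (1::real) = a)"
      by (intro exI[of _ UNIV] exI[of _ 1]) auto
    moreover have "\<forall>f\<in>Alg S. \<forall>g\<in>Alg S.
        (\<exists>U a. open U \<and> closure {x. f x \<noteq> 0} \<subseteq> U \<and> (\<forall>x\<in>U. g x = a)) \<longrightarrow> Form S f g = 0"
      using adm unfolding admissible_form_def by (elim conjE) assumption
    ultimately show ?thesis using Alg_mult[OF f g] one by simp
  qed
  finally show ?thesis by simp
qed

lemma Nu_NuH: "f \<in> Alg S \<Longrightarrow> g \<in> Alg S \<Longrightarrow> Nu S f g = NuH S (grad S f) (grad S g)"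
proof (rule finite_signed_measure_eqI[OF fsm_Nu fsm_NuH])
  fix A :: "'x set" assume fg: "f \<in> Alg S" "g \<in> Alg S" and A: "A \<in> sets borel"
  have "NuH S (grad S f) (grad S g) A = int_NuH (indicator A) (elem (\<lambda>x. 1) f) (elem (\<lambda>x. 1) g)"
    by (simp add: int_NuH_indicator[OF A] grad_elem)
  also have "\<dots> = signed_integral (Nu S f g) (\<lambda>x. 1 * 1 * indicator A x)"
    by (rule int_NuH_elem[OF Cc_const fg(1) Cc_const fg(2) bounded_borel_indicator[OF A]])
  finally show "Nu S f g A = NuH S (grad S f) (grad S g) A"
    using signed_integral_indicator[OF fsm_Nu[OF fg] A] by simp
qed

lemma nu_vec_grad: "f \<in> Alg S \<Longrightarrow> to_measure (Nu S f f) = nu_vec S (grad S f)"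
  by (simp add: nu_vec_def Nu_NuH)

section \<open>Extension of the action on \<open>b\<close> to square integrable functions\<close>

lemma Cc_L2: "k \<in> Cc \<Longrightarrow> k \<in> L2 (nu_vec S b)"
  using Cc_bounded_borel[of k] bounded_borelE bounded_L2[OF nu_vec_measure(1,2)] by metis

text \<open>Two sequences approximating \<open>g\<close> are close to each other in L2, so by the
  isometry their products with \<open>b\<close> have the same limit; hence the description in
  \<open>star\<close> is unambiguous.\<close>

lemma star_limit_unique:
  assumes g: "g \<in> L2 (nu_vec S b)"
    and s: "\<And>n. s n \<in> Cc" "(\<lambda>n. LINT x|nu_vec S b. (s n x - g x)\<^sup>2) \<longlonglongrightarrow> 0" "(\<lambda>n. mult S (s n) b) \<longlonglongrightarrow> v"
    and t: "\<And>n. t n \<in> Cc" "(\<lambda>n. LINT x|nu_vec S b. (t n x - g x)\<^sup>2) \<longlonglongrightarrow> 0" "(\<lambda>n. mult S (t n) b) \<longlonglongrightarrow> w"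
  shows "v = w"
proof -
  note f = nu_vec_measure(1)[of b]
  have "(\<lambda>n. (norm (mult S (s n) b - mult S (t n) b))\<^sup>2) \<longlonglongrightarrow> 0"
  proof (rule tendsto_sandwich[OF _ _ tendsto_const])
    have "(norm (mult S (s n) b - mult S (t n) b))\<^sup>2 \<le>
      2 * (LINT x|nu_vec S b. (s n x - g x)\<^sup>2) + 2 * (LINT x|nu_vec S b. (t n x - g x)\<^sup>2)" for n
      using L2_dist_triangle[OF f Cc_L2[OF s(1)[of n]] g Cc_L2[OF t(1)[of n]]]
        norm_mult_diff_sq[OF s(1)[of n] t(1)[of n], of b] by (simp add: power2_commute[of "g _"])
    then show "\<forall>\<^sub>F n in sequentially. (norm (mult S (s n) b - mult S (t n) b))\<^sup>2 \<le>
      2 * (LINT x|nu_vec S b. (s n x - g x)\<^sup>2) + 2 * (LINT x|nu_vec S b. (t n x - g x)\<^sup>2)" by simp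
    show "(\<lambda>n. 2 * (LINT x|nu_vec S b. (s n x - g x)\<^sup>2) + 2 * (LINT x|nu_vec S b. (t n x - g x)\<^sup>2)) \<longlonglongrightarrow> 0"
      using tendsto_add[OF tendsto_mult_left[OF s(2), of 2] tendsto_mult_left[OF t(2), of 2]] by simp
  qed simp
  moreover have "(\<lambda>n. (norm (mult S (s n) b - mult S (t n) b))\<^sup>2) \<longlonglongrightarrow> (norm (v - w))\<^sup>2"
    using s(3) t(3) by (intro tendsto_intros)
  ultimately have "(norm (v - w))\<^sup>2 = 0" using LIMSEQ_unique by blast
  then show ?thesis by simp
qed

lemma star_eqI:
  assumes g: "g \<in> L2 (nu_vec S b)"
    and s: "\<And>n. s n \<in> Cc" "(\<lambda>n. LINT x|nu_vec S b. (s n x - g x)\<^sup>2) \<longlonglongrightarrow> 0" "(\<lambda>n. mult S (s n) b) \<longlonglongrightarrow> v"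
  shows "star S b g = v"
  unfolding star_def
proof (rule the_equality)
  show "w = v" if "\<exists>s. (\<forall>n. s n \<in> Cc) \<and> (\<lambda>n. LINT x|nu_vec S b. (s n x - g x)\<^sup>2) \<longlonglongrightarrow> 0 \<and>
    (\<lambda>n. mult S (s n) b) \<longlonglongrightarrow> w" for w
    using that star_limit_unique[OF g _ _ _ s] by blast
qed (use s in blast)

text \<open>Existence for the description in \<open>star\<close>: continuous functions are dense in
  L2, and the isometry turns an approximating sequence into a Cauchy sequence of vectors.\<close>

lemma star_obtain:
  assumes g: "g \<in> L2 (nu_vec S b)"
  obtains s where "\<And>n. s n \<in> Cc" "(\<lambda>n. LINT x|nu_vec S b. (s n x - g x)\<^sup>2) \<longlonglongrightarrow> 0"
    "(\<lambda>n. mult S (s n) b) \<longlonglongrightarrow> star S b g"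
proof -
  note f = nu_vec_measure(1,2)[of b]
  have "\<exists>s. s \<in> Cc \<and> (LINT x|nu_vec S b. (s x - g x)\<^sup>2) < 1 / real (Suc n)" for n
    using continuous_L2_dense[OF f g, of "1 / real (Suc n)"] by (auto simp: Cc_iff)
  then obtain s where s: "\<And>n. s n \<in> Cc" "\<And>n. (LINT x|nu_vec S b. (s n x - g x)\<^sup>2) < 1 / real (Suc n)" by metis
  have lim: "(\<lambda>n. LINT x|nu_vec S b. (s n x - g x)\<^sup>2) \<longlonglongrightarrow> 0"
    by (rule tendsto_sandwich[OF _ _ tendsto_const LIMSEQ_Suc[OF lim_1_over_n]])
      (use s(2) in \<open>auto intro!: always_eventually less_imp_le simp del: of_nat_Suc\<close>)
  have "Cauchy (\<lambda>n. mult S (s n) b)"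
  proof (rule CauchyI)
    fix e :: real assume e: "e > 0"
    then have "e\<^sup>2/4 > 0" by simp
    from order_tendstoD(2)[OF lim this] obtain N where
      N: "\<And>n. n \<ge> N \<Longrightarrow> (LINT x|nu_vec S b. (s n x - g x)\<^sup>2) < e\<^sup>2/4" by (auto simp: eventually_sequentially)
    have "norm (mult S (s m) b - mult S (s n) b) < e" if "m \<ge> N" "n \<ge> N" for m n
    proof -
      have "(norm (mult S (s m) b - mult S (s n) b))\<^sup>2 \<le>
        2 * (LINT x|nu_vec S b. (s m x - g x)\<^sup>2) + 2 * (LINT x|nu_vec S b. (s n x - g x)\<^sup>2)"
        using L2_dist_triangle[OF f(1) Cc_L2[OF s(1)[of m]] g Cc_L2[OF s(1)[of n]]]
          norm_mult_diff_sq[OF s(1)[of m] s(1)[of n], of b] by (simp add: power2_commute[of "g _"])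
      also have "\<dots> < e\<^sup>2" using N[OF that(1)] N[OF that(2)] by linarith
      finally show ?thesis using e by (simp add: power_less_imp_less_base)
    qed
    then show "\<exists>M. \<forall>m\<ge>M. \<forall>n\<ge>M. norm (mult S (s m) b - mult S (s n) b) < e" by blast
  qed
  then obtain v where v: "(\<lambda>n. mult S (s n) b) \<longlonglongrightarrow> v" using Cauchy_convergent convergentD by blast
  show ?thesis using that[OF s(1) lim] v star_eqI[OF g s(1) lim v] by simp
qed

lemma star_Cc: "k \<in> Cc \<Longrightarrow> star S b k = mult S k b"
  by (rule star_eqI[OF Cc_L2, where s = "\<lambda>_. k"]) auto

lemma star_lincomb:
  assumes f: "f \<in> L2 (nu_vec S b)" and g: "g \<in> L2 (nu_vec S b)"
  shows "star S b (\<lambda>x. f x + c * g x) = star S b f + c *\<^sub>R star S b g"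
proof -
  let ?M = "nu_vec S b"
  note M = nu_vec_measure(1)[of b]
  obtain s where s: "\<And>n. s n \<in> Cc" "(\<lambda>n. LINT x|?M. (s n x - f x)\<^sup>2) \<longlonglongrightarrow> 0"
    "(\<lambda>n. mult S (s n) b) \<longlonglongrightarrow> star S b f" by (rule star_obtain[OF f]) (rule that)
  obtain t where t: "\<And>n. t n \<in> Cc" "(\<lambda>n. LINT x|?M. (t n x - g x)\<^sup>2) \<longlonglongrightarrow> 0"
    "(\<lambda>n. mult S (t n) b) \<longlonglongrightarrow> star S b g" by (rule star_obtain[OF g]) (rule that)
  show ?thesis
  proof (rule star_eqI[OF L2_add[OF M f L2_cmult[OF g]], where s = "\<lambda>n x. s n x + c * t n x"])
    show "(\<lambda>n. mult S (\<lambda>x. s n x + c * t n x) b) \<longlonglongrightarrow> star S b f + c *\<^sub>R star S b g"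
      unfolding mult_lincomb_left[OF s(1) t(1)] by (intro tendsto_intros s t)
    show "(\<lambda>n. LINT x|?M. (s n x + c * t n x - (f x + c * g x))\<^sup>2) \<longlonglongrightarrow> 0"
    proof (rule tendsto_sandwich[OF _ _ tendsto_const])
      have "(LINT x|?M. (s n x + c * t n x - (f x + c * g x))\<^sup>2) \<le>
        2 * (LINT x|?M. (s n x - f x)\<^sup>2) + 2 * (c\<^sup>2 * (LINT x|?M. (t n x - g x)\<^sup>2))" for n
      proof -
        have "(\<lambda>x. s n x - f x) \<in> L2 ?M" "(\<lambda>x. c * (g x - t n x)) \<in> L2 ?M" "(\<lambda>x. 0) \<in> L2 ?M"
          by (simp_all add: L2_diff[OF M] L2_cmult Cc_L2 s(1) t(1) f g)
        from L2_dist_triangle[OF M this(1,3,2)]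
        have "(LINT x|?M. ((s n x - f x) - c * (g x - t n x))\<^sup>2) \<le>
          2 * (LINT x|?M. (s n x - f x)\<^sup>2) + 2 * (c\<^sup>2 * (LINT x|?M. (t n x - g x)\<^sup>2))"
          by (simp add: power_mult_distrib power2_commute[of "g _"])
        moreover have "(s n x - f x) - c * (g x - t n x) = s n x + c * t n x - (f x + c * g x)" for x
          by (simp add: algebra_simps)
        ultimately show ?thesis by simp
      qed
      then show "\<forall>\<^sub>F n in sequentially. (LINT x|?M. (s n x + c * t n x - (f x + c * g x))\<^sup>2) \<le>
        2 * (LINT x|?M. (s n x - f x)\<^sup>2) + 2 * (c\<^sup>2 * (LINT x|?M. (t n x - g x)\<^sup>2))" by simp
      show "(\<lambda>n. 2 * (LINT x|?M. (s n x - f x)\<^sup>2) + 2 * (c\<^sup>2 * (LINT x|?M. (t n x - g x)\<^sup>2))) \<longlonglongrightarrow> 0"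
        using tendsto_add[OF tendsto_mult_left[OF s(2), of 2] tendsto_mult_left[OF tendsto_mult_left[OF t(2), of "c\<^sup>2"], of 2]]
        by simp
    qed simp
  qed (simp add: Cc_add Cc_mult s(1) t(1))
qed

lemma star_add:
  assumes "f \<in> L2 (nu_vec S b)" "g \<in> L2 (nu_vec S b)"
  shows "star S b (\<lambda>x. f x + g x) = star S b f + star S b g"
  using star_lincomb[OF assms, of 1] by simp

lemma star_diff:
  assumes "f \<in> L2 (nu_vec S b)" "g \<in> L2 (nu_vec S b)"
  shows "star S b (\<lambda>x. f x - g x) = star S b f - star S b g"
  using star_lincomb[OF assms, of "-1"] by simp

lemma star_cmult: "f \<in> L2 (nu_vec S b) \<Longrightarrow> star S b (\<lambda>x. c * f x) = c *\<^sub>R star S b f"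
  using star_lincomb[of f b f "c - 1"] by (simp add: algebra_simps)

lemma norm_star:
  assumes g: "g \<in> L2 (nu_vec S b)"
  shows "(norm (star S b g))\<^sup>2 = (LINT x|nu_vec S b. (g x)\<^sup>2)"
proof -
  note M = nu_vec_measure(1)[of b]
  let ?M = "nu_vec S b"
  obtain s where s: "\<And>n. s n \<in> Cc" "(\<lambda>n. LINT x|?M. (s n x - g x)\<^sup>2) \<longlonglongrightarrow> 0"
    "(\<lambda>n. mult S (s n) b) \<longlonglongrightarrow> star S b g" by (rule star_obtain[OF g]) (rule that)
  have dL: "(\<lambda>x. s n x - g x) \<in> L2 ?M" for n by (intro L2_diff M Cc_L2 s g)
  \<comment> \<open>The cross term in the expansion of \<open>(s n x)\<^sup>2\<close> around
    \<open>g\<close>; Cauchy-Schwarz makes it vanish in the limit.\<close>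
  have "(\<lambda>n. (LINT x|?M. (s n x - g x) * g x)\<^sup>2) \<longlonglongrightarrow> 0"
  proof (rule tendsto_sandwich[OF _ _ tendsto_const])
    show "\<forall>\<^sub>F n in sequentially. (LINT x|?M. (s n x - g x) * g x)\<^sup>2 \<le>
      (LINT x|?M. (s n x - g x)\<^sup>2) * (LINT x|?M. (g x)\<^sup>2)"
      using L2_Cauchy_Schwarz[OF M dL g] by simp
    show "(\<lambda>n. (LINT x|?M. (s n x - g x)\<^sup>2) * (LINT x|?M. (g x)\<^sup>2)) \<longlonglongrightarrow> 0"
      using tendsto_mult_right[OF s(2)] by simp
  qed simp
  then have cross: "(\<lambda>n. LINT x|?M. (s n x - g x) * g x) \<longlonglongrightarrow> 0"
    using tendsto_real_sqrt[of "\<lambda>n. (LINT x|?M. (s n x - g x) * g x)\<^sup>2" 0] by (simp add: tendsto_rabs_zero_iff)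
  have "(norm (mult S (s n) b))\<^sup>2 = (LINT x|?M. (s n x - g x)\<^sup>2) + 2 * (LINT x|?M. (s n x - g x) * g x)
      + (LINT x|?M. (g x)\<^sup>2)" for n
  proof -
    have i: "integrable ?M (\<lambda>x. (s n x - g x)\<^sup>2)" "integrable ?M (\<lambda>x. (s n x - g x) * g x)"
      "integrable ?M (\<lambda>x. (g x)\<^sup>2)"
      using dL[of n] g L2_integrable(2)[OF M dL g] by (auto simp: L2_def)
    have "(\<lambda>x. (s n x)\<^sup>2) = (\<lambda>x. (s n x - g x)\<^sup>2 + 2 * ((s n x - g x) * g x) + (g x)\<^sup>2)"
      by (auto simp: power2_eq_square algebra_simps)
    then show ?thesis using i by (simp add: norm_mult_sq[OF s(1)])
  qed
  then have "(\<lambda>n. (norm (mult S (s n) b))\<^sup>2) \<longlonglongrightarrow> 0 + 2 * 0 + (LINT x|?M. (g x)\<^sup>2)"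
    using s(2) cross by (simp only:) (intro tendsto_intros)
  moreover have "(\<lambda>n. (norm (mult S (s n) b))\<^sup>2) \<longlonglongrightarrow> (norm (star S b g))\<^sup>2"
    by (intro tendsto_intros s)
  ultimately show ?thesis using LIMSEQ_unique by fastforce
qed

lemma inner_star:
  assumes f: "f \<in> L2 (nu_vec S b)" and g: "g \<in> L2 (nu_vec S b)"
  shows "inner (star S b f) (star S b g) = (LINT x|nu_vec S b. f x * g x)"
proof -
  note M = nu_vec_measure(1)[of b]
  have i: "integrable (nu_vec S b) (\<lambda>x. (f x)\<^sup>2)" "integrable (nu_vec S b) (\<lambda>x. (g x)\<^sup>2)"
    "integrable (nu_vec S b) (\<lambda>x. f x * g x)"
    using f g L2_integrable(2)[OF M f g] by (auto simp: L2_def)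
  have "(norm (star S b f + star S b g))\<^sup>2 = (LINT x|nu_vec S b. (f x + g x)\<^sup>2)"
    using norm_star[OF L2_add[OF M f g]] by (simp add: star_add[OF f g])
  also have "(\<lambda>x. (f x + g x)\<^sup>2) = (\<lambda>x. (f x)\<^sup>2 + 2 * (f x * g x) + (g x)\<^sup>2)"
    by (auto simp: power2_eq_square algebra_simps)
  finally have "(norm (star S b f + star S b g))\<^sup>2 =
    (norm (star S b f))\<^sup>2 + 2 * (LINT x|nu_vec S b. f x * g x) + (norm (star S b g))\<^sup>2"
    using i by (simp add: norm_star f g)
  then show ?thesis by (simp add: power2_norm_eq_inner inner_add inner_commute)
qed

text \<open>The dictionary between equations of vectors and almost everywhere equations of
  functions.\<close>

lemma star_eq_iff:
  assumes f: "f \<in> L2 (nu_vec S b)" and g: "g \<in> L2 (nu_vec S b)"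
  shows "star S b f = star S b g \<longleftrightarrow> (AE x in nu_vec S b. f x = g x)"
proof -
  note d = L2_diff[OF nu_vec_measure(1) f g]
  have "star S b f = star S b g \<longleftrightarrow> (norm (star S b (\<lambda>x. f x - g x)))\<^sup>2 = 0"
    by (simp add: star_diff[OF f g])
  also have "\<dots> \<longleftrightarrow> (AE x in nu_vec S b. (f x - g x)\<^sup>2 = 0)"
    unfolding norm_star[OF d] using d by (intro integral_nonneg_eq_0_iff_AE) (auto simp: L2_def)
  finally show ?thesis by simp
qed

end

section \<open>Martingale dimension one\<close>

lemma det_2_mat:
  fixes A :: "real mat"
  assumes A: "A \<in> carrier_mat 2 2"
  shows "Determinant.det A = A $$ (0,0) * A $$ (1,1) - A $$ (0,1) * A $$ (1,0)"
proof -
  have s: "{..<2} = {0, 1::nat}" by auto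
  have d: "Determinant.det (mat_delete A 0 j) = A $$ (1, 1 - j)" if "j < 2" for j
  proof -
    have "mat_delete A 0 j \<in> carrier_mat 1 1" using A mat_delete_carrier[of A 2 2 0 j] by simp
    then have "Determinant.det (mat_delete A 0 j) = mat_delete A 0 j $$ (0,0)" by (rule det_single)
    also have "\<dots> = A $$ (1, 1 - j)" using A that by (auto simp: mat_delete_def less_Suc_eq numeral_2_eq_2)
    finally show ?thesis .
  qed
  show ?thesis
    using laplace_expansion_row[OF A, of 0] by (simp add: s cofactor_def d)
qed

text \<open>The rows 0, 1 and the columns 2, 3 belong to different functions, so the first and
  second arguments of the densities can be chosen independently although the matrix uses one list
  for both.\<close>

lemma rank_le_1_minor:
  fixes M :: "real mat"
  assumes M: "M \<in> carrier_mat 4 4" and rank: "vec_space.rank 4 M \<le> 1"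
  shows "M $$ (0,2) * M $$ (1,3) = M $$ (0,3) * M $$ (1,2)"
proof -
  interpret vec_space "TYPE(real)" 4 .
  define B where "B = submatrix M {0,1} {2,3}"
  have c: "{i. i < dim_row M \<and> i \<in> {0,1}} = {0,1}" "{j. j < dim_col M \<and> j \<in> {2,3}} = {2,3}"
    using M by auto
  \<comment> \<open>\<open>pick\<close> enumerates an index set in increasing order, counting from
    0; the entries of a submatrix are addressed through it.\<close>
  have p0: "pick {0,1} 0 = 0" "pick {2,3} 0 = 2"
    unfolding pick.simps by (auto intro!: Least_equality)
  have p1: "pick {0,1} (Suc 0) = 1" "pick {2,3} (Suc 0) = 3"
    unfolding pick.simps(2) p0 by (auto intro!: Least_equality)
  have "dim_row B = 2" "dim_col B = 2" unfolding B_def dim_submatrix c by simp_all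
  then have B: "B \<in> carrier_mat 2 2" by auto
  have "{j. j < 4 \<and> j \<in> {2, 3::nat}} = {2, 3}" by auto
  then have "Determinant.det B = 0"
    using rank_gt_minor[OF M, of "{0,1}" "{2,3}"] rank unfolding B_def by force
  moreover have "B $$ (i, j) = M $$ (pick {0,1} i, pick {2,3} j)" if "i < 2" "j < 2" for i j
    unfolding B_def by (rule submatrix_index; unfold c) (use that in simp_all)
  ultimately show ?thesis using det_2_mat[OF B] p0 p1 by simp
qed

context compact_form
begin

text \<open>Indexed sums rather than \<open>span elems\<close>, because the densities below are
  written in terms of the functions themselves.\<close>

definition simple_vec :: "nat \<Rightarrow> (nat \<Rightarrow> 'x \<Rightarrow> real) \<Rightarrow> (nat \<Rightarrow> 'x \<Rightarrow> real) \<Rightarrow> 'h" where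
  "simple_vec n g f = (\<Sum>i<n. elem (g i) (f i))"

definition simple_vecs :: "'h set" where
  "simple_vecs = {simple_vec n g f | n g f. \<forall>i<n. g i \<in> Cc \<and> f i \<in> Alg S}"

lemma closure_simple_vecs: "closure simple_vecs = UNIV"
proof -
  have "Cls S ` one_form_span (Alg S) \<subseteq> simple_vecs"
  proof safe
    fix a assume "a \<in> one_form_span (Alg S)"
    then obtain n :: nat and g f where a: "a = (\<lambda>z. \<Sum>i<n. avg (g i) z * du (f i) z)"
      and gf: "\<And>i. i < n \<Longrightarrow> g i \<in> Cc \<and> f i \<in> Alg S" unfolding one_form_span_def by blast
    have "Cls S a = simple_vec n g f" unfolding a simple_vec_def by (rule Cls_sum) (rule gf)
    then show "Cls S a \<in> simple_vecs" unfolding simple_vecs_def using gf by blast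
  qed
  from closure_mono[OF this] show ?thesis
    using fos by (auto simp: first_order_structure_def hilbert_space_of_forms_def)
qed

text \<open>The choice in \<open>signed_density\<close> finds a genuine density. Energy dominance
  concerns the measures of single functions, so a density of the mixed measure is obtained by
  polarization from the sum and the difference.\<close>

lemma signed_density_spec:
  assumes ed: "energy_dominant S \<nu>" and f: "f \<in> Alg S" and g: "g \<in> Alg S"
  shows "integrable \<nu> (signed_density \<nu> (Nu S f g))"
    "A \<in> sets borel \<Longrightarrow> Nu S f g A = (LINT x|\<nu>. signed_density \<nu> (Nu S f g) x * indicator A x)"
proof -
  have \<nu>: "sigma_finite_measure \<nu>" "sets \<nu> = sets borel"
    and ac: "absolutely_continuous \<nu> (nu_vec S (grad S k))" if "k \<in> Alg S" for k
    using ed that nu_vec_grad by (auto simp: energy_dominant_def)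
  have rn: "\<exists>d. integrable \<nu> d \<and> (\<forall>A\<in>sets borel. NuH S (grad S k) (grad S k) A = (LINT x|\<nu>. d x * indicator A x))"
    if "k \<in> Alg S" for k
    using real_Radon_Nikodym[OF \<nu>[OF that] nu_vec_measure(1,2) ac[OF that]] by (auto simp: nu_vec_measure)
  obtain d1 d2 where d1: "integrable \<nu> d1" "\<forall>A\<in>sets borel. NuH S (grad S f + grad S g) (grad S f + grad S g) A =
      (LINT x|\<nu>. d1 x * indicator A x)"
    and d2: "integrable \<nu> d2" "\<forall>A\<in>sets borel. NuH S (grad S f - grad S g) (grad S f - grad S g) A =
      (LINT x|\<nu>. d2 x * indicator A x)"
    using rn[OF Alg_add[OF f g]] rn[OF Alg_diff[OF f g]]
    unfolding grad_add[OF f g] grad_diff[OF f g] by blast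
  have "integrable \<nu> (\<lambda>x. (d1 x - d2 x) / 4)" using d1 d2 by auto
  moreover have "Nu S f g A = (LINT x:A|\<nu>. (d1 x - d2 x) / 4)" if A: "A \<in> sets borel" for A
  proof -
    interpret N: bounded_bilinear "\<lambda>v w. NuH S v w A" by (rule NuH_bilinear)
    have i: "integrable \<nu> (\<lambda>x. d1 x * indicator A x)" "integrable \<nu> (\<lambda>x. d2 x * indicator A x)"
      using d1 d2 A \<nu>(2)[OF f] by (auto intro!: integrable_real_mult_indicator)
    have "4 * Nu S f g A = NuH S (grad S f + grad S g) (grad S f + grad S g) A
      - NuH S (grad S f - grad S g) (grad S f - grad S g) A"
      by (simp add: Nu_NuH f g N.add_left N.add_right N.diff_left N.diff_right NuH_sym[of "grad S g" "grad S f"])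
    also have "\<dots> = (LINT x|\<nu>. d1 x * indicator A x - d2 x * indicator A x)"
      using d1 d2 A i by simp
    finally have "Nu S f g A = (LINT x|\<nu>. d1 x * indicator A x - d2 x * indicator A x) / 4" by simp
    also have "\<dots> = (LINT x|\<nu>. (d1 x * indicator A x - d2 x * indicator A x) / 4)" by simp
    also have "\<dots> = (LINT x:A|\<nu>. (d1 x - d2 x) / 4)"
      unfolding set_lebesgue_integral_def by (intro Bochner_Integration.integral_cong) (auto simp: indicator_def)
    finally show ?thesis .
  qed
  ultimately have "\<exists>d. integrable \<nu> d \<and> (\<forall>A\<in>sets borel. Nu S f g A = (LINT x:A|\<nu>. d x))" by blast
  from someI_ex[OF this, folded signed_density_def]
  have "integrable \<nu> (signed_density \<nu> (Nu S f g))"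
    "\<And>A. A \<in> sets borel \<Longrightarrow> Nu S f g A = (LINT x:A|\<nu>. signed_density \<nu> (Nu S f g) x)" by auto
  then show "integrable \<nu> (signed_density \<nu> (Nu S f g))"
    "A \<in> sets borel \<Longrightarrow> Nu S f g A = (LINT x|\<nu>. signed_density \<nu> (Nu S f g) x * indicator A x)"
    by (simp_all add: set_lebesgue_integral_def mult.commute)
qed

text \<open>The density of the mixed measure of two simple vectors with respect to
  \<open>\<nu>\<close>, expanded by bilinearity.\<close>

definition dens where
  "dens \<nu> n g f m g' f' x =
    (\<Sum>i<n. \<Sum>j<m. g i x * g' j x * signed_density \<nu> (Nu S (f i) (f' j)) x)"
  for n m :: nat and g f g' f' :: "nat \<Rightarrow> 'x \<Rightarrow> real"

lemma dens_spec:
  fixes n m :: nat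
  assumes ed: "energy_dominant S \<nu>"
    and gf: "\<And>i. i < n \<Longrightarrow> g i \<in> Cc \<and> f i \<in> Alg S"
    and gf': "\<And>i. i < m \<Longrightarrow> g' i \<in> Cc \<and> f' i \<in> Alg S"
  shows "integrable \<nu> (dens \<nu> n g f m g' f')"
    "A \<in> sets borel \<Longrightarrow> NuH S (simple_vec n g f) (simple_vec m g' f') A =
       (LINT x|\<nu>. dens \<nu> n g f m g' f' x * indicator A x)"
proof -
  have sets: "sets \<nu> = sets borel" using ed by (simp add: energy_dominant_def)
  have int: "integrable \<nu> (\<lambda>x. d x * k x)" if d: "integrable \<nu> d" and "bounded_borel k" for d k :: "'x \<Rightarrow> real"
  proof -
    obtain K where K: "k \<in> borel_measurable borel" "\<And>x. \<bar>k x\<bar> \<le> K" "0 \<le> K" using \<open>bounded_borel k\<close> bounded_borelE by metis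
    have [measurable]: "k \<in> borel_measurable \<nu>" using K(1) measurable_cong_sets[OF sets refl] by blast
    show ?thesis
    proof (rule Bochner_Integration.integrable_bound)
      show "integrable \<nu> (\<lambda>x. K * d x)" using d by simp
      show "(\<lambda>x. d x * k x) \<in> borel_measurable \<nu>" using d by measurable
      have "\<bar>d x * k x\<bar> \<le> \<bar>K * d x\<bar>" for x
        using K(2)[of x] K(3) by (simp add: abs_mult mult.commute[of K] mult_left_mono)
      then show "AE x in \<nu>. norm (d x * k x) \<le> norm (K * d x)" by simp
    qed
  qed
  let ?t = "\<lambda>i j x. g i x * g' j x * signed_density \<nu> (Nu S (f i) (f' j)) x"
  have summand: "integrable \<nu> (\<lambda>x. ?t i j x)"
    "A \<in> sets borel \<Longrightarrow> integrable \<nu> (\<lambda>x. ?t i j x * indicator A x)"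
    "A \<in> sets borel \<Longrightarrow> NuH S (elem (g i) (f i)) (elem (g' j) (f' j)) A =
      (LINT x|\<nu>. ?t i j x * indicator A x)"
    if "i < n" "j < m" for i j A
  proof -
    let ?d = "signed_density \<nu> (Nu S (f i) (f' j))"
    have m: "g i \<in> Cc" "f i \<in> Alg S" "g' j \<in> Cc" "f' j \<in> Alg S" using gf gf' that by auto
    note d = signed_density_spec[OF ed m(2,4)]
    note gg = Cc_bounded_borel[OF Cc_mult[OF m(1,3)]]
    show 1: "integrable \<nu> (\<lambda>x. g i x * g' j x * ?d x)"
      using int[OF d(1) gg] by (simp add: mult_ac)
    assume A: "A \<in> sets borel"
    show "integrable \<nu> (\<lambda>x. (g i x * g' j x * ?d x) * indicator A x)"
      by (rule int[OF 1 bounded_borel_indicator[OF A]])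
    have b: "bounded_borel (\<lambda>x. (g i x * g' j x) * indicator A x)"
      by (rule bounded_borel_mult[OF gg bounded_borel_indicator[OF A]])
    obtain K where k: "(\<lambda>x. (g i x * g' j x) * indicator A x) \<in> borel_measurable borel"
      "\<And>x. \<bar>(g i x * g' j x) * indicator A x\<bar> \<le> K" using b bounded_borelE by metis
    have "NuH S (elem (g i) (f i)) (elem (g' j) (f' j)) A =
      signed_integral (Nu S (f i) (f' j)) (\<lambda>x. (g i x * g' j x) * indicator A x)"
      using int_NuH_elem[OF m bounded_borel_indicator[OF A]] int_NuH_indicator[OF A] by simp
    also have "\<dots> = (LINT x|\<nu>. ?d x * ((g i x * g' j x) * indicator A x))"
      by (rule signed_integral_density[OF fsm_Nu[OF m(2,4)] d(1) sets d(2) k])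
    finally show "NuH S (elem (g i) (f i)) (elem (g' j) (f' j)) A =
      (LINT x|\<nu>. (g i x * g' j x * ?d x) * indicator A x)" by (simp add: mult_ac)
  qed
  show "integrable \<nu> (dens \<nu> n g f m g' f')"
    unfolding dens_def[abs_def] using summand(1) by (intro Bochner_Integration.integrable_sum) auto
  assume A: "A \<in> sets borel"
  interpret N: bounded_bilinear "\<lambda>v w. NuH S v w A" by (rule NuH_bilinear)
  have "NuH S (simple_vec n g f) (simple_vec m g' f') A =
    (\<Sum>i<n. \<Sum>j<m. NuH S (elem (g i) (f i)) (elem (g' j) (f' j)) A)"
    by (simp only: simple_vec_def N.sum_left) (simp only: N.sum_right)
  also have "\<dots> = (\<Sum>i<n. \<Sum>j<m.
      LINT x|\<nu>. ?t i j x * indicator A x)"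
    using summand(3)[OF _ _ A] by (intro sum.cong refl) auto
  also have "\<dots> = (LINT x|\<nu>. (\<Sum>i<n. \<Sum>j<m.
      ?t i j x * indicator A x))"
  proof (subst Bochner_Integration.integral_sum)
    show "integrable \<nu> (\<lambda>x. \<Sum>j<m. ?t i j x * indicator A x)"
      if "i \<in> {..<n}" for i
      using that summand(2)[OF _ _ A] by (intro Bochner_Integration.integrable_sum) auto
    show "(\<Sum>i<n. \<Sum>j<m. LINT x|\<nu>. ?t i j x * indicator A x) =
      (\<Sum>i<n. LINT x|\<nu>. (\<Sum>j<m. ?t i j x * indicator A x))"
      using summand(2)[OF _ _ A] by (intro sum.cong refl Bochner_Integration.integral_sum[symmetric]) auto
  qed
  also have "\<dots> = (LINT x|\<nu>. dens \<nu> n g f m g' f' x * indicator A x)"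
    by (simp add: dens_def sum_distrib_right)
  finally show "NuH S (simple_vec n g f) (simple_vec m g' f') A =
       (LINT x|\<nu>. dens \<nu> n g f m g' f' x * indicator A x)" .
qed

lemma density_minor:
  assumes br: "bounds_rank S \<nu> p" and p: "AE x in \<nu>. p x \<le> 1"
    and f: "f1 \<in> Alg S" "f2 \<in> Alg S" "f3 \<in> Alg S" "f4 \<in> Alg S"
  shows "AE x in \<nu>. signed_density \<nu> (Nu S f1 f3) x * signed_density \<nu> (Nu S f2 f4) x =
    signed_density \<nu> (Nu S f1 f4) x * signed_density \<nu> (Nu S f2 f3) x"
proof -
  define F where "F i = [f1, f2, f3, f4] ! i" for i
  have F: "F i \<in> Alg S" if "i < 4" for i
  proof -
    have "F i \<in> set [f1, f2, f3, f4]" unfolding F_def using that by (intro nth_mem) simp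
    then show ?thesis using f by auto
  qed
  let ?M = "\<lambda>x. Matrix.mat 4 4 (\<lambda>(i, j). signed_density \<nu> (Nu S (F i) (F j)) x)"
  have "AE x in \<nu>. enat (vec_space.rank 4 (?M x)) \<le> p x"
    using br F unfolding bounds_rank_def by blast
  then show ?thesis using p
  proof eventually_elim
    case (elim x)
    from order_trans[OF elim] have "vec_space.rank 4 (?M x) \<le> 1" by (simp add: one_enat_def)
    from rank_le_1_minor[OF _ this] show ?case by (simp add: F_def eval_nat_numeral)
  qed
qed

text \<open>Equality in Cauchy-Schwarz for densities. The square is a fourfold sum; in each term the
  minor identity exchanges arguments so that functions of the same vector are paired, and then the
  sum factors.\<close>

lemma dens_rank_one:
  fixes n m :: nat
  assumes br: "bounds_rank S \<nu> p" and p: "AE x in \<nu>. p x \<le> 1"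
    and gf: "\<And>i. i < n \<Longrightarrow> g i \<in> Cc \<and> f i \<in> Alg S"
    and gf': "\<And>i. i < m \<Longrightarrow> g' i \<in> Cc \<and> f' i \<in> Alg S"
  shows "AE x in \<nu>. (dens \<nu> n g f m g' f' x)\<^sup>2 = dens \<nu> n g f n g f x * dens \<nu> m g' f' m g' f' x"
proof -
  define d where "d f f' = signed_density \<nu> (Nu S f f')" for f f'
  \<comment> \<open>There are finitely many minors, so one null set serves all of them.\<close>
  have "AE x in \<nu>. \<forall>i\<in>{..<n}. \<forall>j\<in>{..<m}. \<forall>k\<in>{..<n}. \<forall>l\<in>{..<m}.
      d (f i) (f' j) x * d (f' l) (f k) x = d (f i) (f k) x * d (f' l) (f' j) x"
  proof (intro AE_finite_allI finite_lessThan)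
    fix i j k l assume "i \<in> {..<n}" "j \<in> {..<m}" "k \<in> {..<n}" "l \<in> {..<m}"
    then have "f i \<in> Alg S" "f' l \<in> Alg S" "f' j \<in> Alg S" "f k \<in> Alg S" using gf gf' by auto
    from density_minor[OF br p this]
    show "AE x in \<nu>. d (f i) (f' j) x * d (f' l) (f k) x = d (f i) (f k) x * d (f' l) (f' j) x"
      by (simp add: d_def)
  qed
  then show ?thesis
  proof eventually_elim
    case (elim x)
    have sym: "d (f' l) (f k) = d (f k) (f' l)" "d (f' l) (f' j) = d (f' j) (f' l)"
      if "k < n" "l < m" "j < m" for k l j
      using Nu_sym gf gf' that by (auto simp: d_def)
    have "(dens \<nu> n g f m g' f' x)\<^sup>2 =
      (\<Sum>i<n. \<Sum>j<m. g i x * g' j x * d (f i) (f' j) x) * (\<Sum>k<n. \<Sum>l<m. g k x * g' l x * d (f k) (f' l) x)"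
      by (simp add: dens_def d_def power2_eq_square)
    also have "\<dots> = (\<Sum>i<n. \<Sum>k<n. \<Sum>j<m. \<Sum>l<m.
        (g i x * g' j x * d (f i) (f' j) x) * (g k x * g' l x * d (f k) (f' l) x))"
      by (simp add: sum_product)
    also have "\<dots> = (\<Sum>i<n. \<Sum>k<n. \<Sum>j<m. \<Sum>l<m.
        (g i x * g k x * d (f i) (f k) x) * (g' j x * g' l x * d (f' j) (f' l) x))"
    proof (intro sum.cong refl)
      fix i k j l assume "i \<in> {..<n}" "k \<in> {..<n}" "j \<in> {..<m}" "l \<in> {..<m}"
      then have "d (f i) (f' j) x * d (f k) (f' l) x = d (f i) (f k) x * d (f' j) (f' l) x"
        using elim sym by (metis lessThan_iff)
      then show "(g i x * g' j x * d (f i) (f' j) x) * (g k x * g' l x * d (f k) (f' l) x) =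
        (g i x * g k x * d (f i) (f k) x) * (g' j x * g' l x * d (f' j) (f' l) x)"
        by (metis (no_types, opaque_lifting) mult.assoc mult.left_commute)
    qed
    also have "\<dots> = (\<Sum>i<n. \<Sum>k<n. g i x * g k x * d (f i) (f k) x) *
        (\<Sum>j<m. \<Sum>l<m. g' j x * g' l x * d (f' j) (f' l) x)"
      by (simp only: sum_distrib_right) (simp only: sum_distrib_left)
    finally show ?case by (simp add: dens_def d_def)
  qed
qed

end

lemma AE_density_nonneg:
  fixes d :: "'x::topological_space \<Rightarrow> real"
  assumes d: "integrable \<nu> d" "sets \<nu> = sets borel"
    and nn: "\<And>A. A \<in> sets borel \<Longrightarrow> 0 \<le> (LINT x|\<nu>. d x * indicator A x)"
  shows "AE x in \<nu>. 0 \<le> d x"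
proof -
  have [measurable]: "d \<in> borel_measurable \<nu>" using d by auto
  have sp: "space \<nu> = UNIV" using sets_eq_imp_space_eq[OF d(2)] by simp
  define A where "A = {x. d x < 0}"
  have A[measurable]: "A \<in> sets \<nu>"
  proof -
    have "{x \<in> space \<nu>. d x < 0} \<in> sets \<nu>" by measurable
    then show ?thesis by (simp add: A_def sp)
  qed
  then have "0 \<le> (LINT x|\<nu>. d x * indicator A x)" using nn d by simp
  then have neg: "(LINT x|\<nu>. - (d x * indicator A x)) \<le> 0" by simp
  have i: "integrable \<nu> (\<lambda>x. - (d x * indicator A x))"
    using d A by (intro integrable_minus integrable_real_mult_indicator)
  have pos: "0 \<le> - (d x * indicator A x)" for x by (auto simp: A_def indicator_def)
  have "(LINT x|\<nu>. - (d x * indicator A x)) = 0"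
    using neg integral_nonneg_AE[of "\<lambda>x. - (d x * indicator A x)" \<nu>] pos by (intro order_antisym) auto
  then have "AE x in \<nu>. - (d x * indicator A x) = 0"
    using integral_nonneg_eq_0_iff_AE[OF i] pos by auto
  then show ?thesis by eventually_elim (auto simp: A_def indicator_def split: if_splits)
qed

context compact_form
begin

text \<open>By the rank one identity the smaller of \<open>svv\<close> and \<open>sww\<close> is at
  most \<open>\<bar>svw\<bar>\<close>, and \<open>D\<close> is the set where \<open>sww\<close> is
  the smaller one. The integral of \<open>\<bar>svw\<bar>\<close> is at most \<open>2 * e\<close>:
  one \<open>e\<close> for the set where \<open>svw\<close> is nonnegative, one for its
  complement.\<close>

lemma singular_separation:
  assumes ed: "energy_dominant S \<nu>" and br: "bounds_rank S \<nu> p" and p: "AE x in \<nu>. p x \<le> 1"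
    and v: "v \<in> simple_vecs" and w: "w \<in> simple_vecs" and e: "\<And>A. \<bar>NuH S v w A\<bar> \<le> e"
  shows "\<exists>D\<in>sets borel. NuH S w w D \<le> 2 * e \<and> NuH S v v (- D) \<le> 2 * e"
proof -
  obtain n :: nat and g f where vs: "v = simple_vec n g f" and gf: "\<And>i. i < n \<Longrightarrow> g i \<in> Cc \<and> f i \<in> Alg S"
    using v unfolding simple_vecs_def by blast
  obtain m :: nat and g' f' where ws: "w = simple_vec m g' f'" and gf': "\<And>i. i < m \<Longrightarrow> g' i \<in> Cc \<and> f' i \<in> Alg S"
    using w unfolding simple_vecs_def by blast
  define svv svw sww where "svv = dens \<nu> n g f n g f" and "svw = dens \<nu> n g f m g' f'"
    and "sww = dens \<nu> m g' f' m g' f'"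
  have i: "integrable \<nu> svv" "integrable \<nu> svw" "integrable \<nu> sww"
    unfolding svv_def svw_def sww_def by (rule dens_spec(1)[OF ed]; use gf gf' in auto)+
  have N: "A \<in> sets borel \<Longrightarrow> NuH S v v A = (LINT x|\<nu>. svv x * indicator A x)"
    "A \<in> sets borel \<Longrightarrow> NuH S v w A = (LINT x|\<nu>. svw x * indicator A x)"
    "A \<in> sets borel \<Longrightarrow> NuH S w w A = (LINT x|\<nu>. sww x * indicator A x)" for A
    unfolding svv_def svw_def sww_def vs ws by (rule dens_spec(2)[OF ed]; use gf gf' in auto)+
  have sets: "sets \<nu> = sets borel" using ed by (simp add: energy_dominant_def)
  have sp: "space \<nu> = UNIV" using sets_eq_imp_space_eq[OF sets] by simp
  have [measurable]: "svv \<in> borel_measurable \<nu>" "svw \<in> borel_measurable \<nu>" "sww \<in> borel_measurable \<nu>"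
    using i by auto
  have nn: "AE x in \<nu>. 0 \<le> svv x" "AE x in \<nu>. 0 \<le> sww x"
    using AE_density_nonneg[OF i(1) sets] AE_density_nonneg[OF i(3) sets] by (simp_all add: NuH_nonneg flip: N)
  have sq: "AE x in \<nu>. (svw x)\<^sup>2 = svv x * sww x"
    unfolding svv_def svw_def sww_def by (rule dens_rank_one[OF br p]) (use gf gf' in auto)
  define D where "D = {x. sww x \<le> svv x}"
  define P where "P = {x. 0 \<le> svw x}"
  have "{x \<in> space \<nu>. sww x \<le> svv x} \<in> sets \<nu>" "{x \<in> space \<nu>. 0 \<le> svw x} \<in> sets \<nu>" by measurable
  then have D: "D \<in> sets borel" and P: "P \<in> sets borel" by (simp_all add: D_def P_def sp sets)
  have cD: "- D \<in> sets borel" and cP: "- P \<in> sets borel" using D P by auto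
  have ind: "integrable \<nu> (\<lambda>x. d x * indicator A x)" if "integrable \<nu> d" "A \<in> sets borel" for d :: "'x \<Rightarrow> real" and A
    using that sets by (intro integrable_real_mult_indicator) auto
  have abs: "(LINT x|\<nu>. \<bar>svw x\<bar>) \<le> 2 * e"
  proof -
    have "(LINT x|\<nu>. \<bar>svw x\<bar>) = (LINT x|\<nu>. svw x * indicator P x - svw x * indicator (- P) x)"
      by (intro Bochner_Integration.integral_cong) (auto simp: P_def indicator_def)
    also have "\<dots> = NuH S v w P - NuH S v w (- P)" using ind[OF i(2) P] ind[OF i(2) cP] N(2) P cP by simp
    also have "\<dots> \<le> 2 * e" using e[of P] e[of "- P"] by linarith
    finally show ?thesis .
  qed
  have sq_le: "a \<le> \<bar>c\<bar>" if "0 \<le> a" "a \<le> b" "c\<^sup>2 = b * a" for a b c :: real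
  proof -
    have "a\<^sup>2 \<le> \<bar>c\<bar>\<^sup>2" using that by (simp add: power2_eq_square mult_right_mono)
    then show ?thesis by (rule power2_le_imp_le) simp
  qed
  have "NuH S w w D \<le> (LINT x|\<nu>. \<bar>svw x\<bar>)" unfolding N(3)[OF D]
  proof (rule integral_mono_AE)
    show "AE x in \<nu>. sww x * indicator D x \<le> \<bar>svw x\<bar>"
      using nn sq by eventually_elim (auto simp: D_def indicator_def intro: sq_le)
  qed (use ind[OF i(3) D] i in auto)
  moreover have "NuH S v v (- D) \<le> (LINT x|\<nu>. \<bar>svw x\<bar>)" unfolding N(1)[OF cD]
  proof (rule integral_mono_AE)
    show "AE x in \<nu>. svv x * indicator (- D) x \<le> \<bar>svw x\<bar>"
      using nn sq
    proof eventually_elim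
      case (elim x)
      then show ?case using sq_le[of "svv x" "sww x" "svw x"] by (auto simp: D_def indicator_def mult.commute)
    qed
  qed (use ind[OF i(1) cD] i in auto)
  ultimately show ?thesis using abs D by (intro bexI[of _ D]) auto
qed

text \<open>Energy dominance speaks of gradients only. For \<open>elem h f\<close> the measure has
  density \<open>h\<^sup>2\<close>, Cauchy-Schwarz kills its mixed measure with any
  \<open>w\<close>, and density of the span lets the first vector become \<open>w\<close>
  itself.\<close>

lemma NuH_null:
  assumes ed: "energy_dominant S \<nu>" and A: "A \<in> null_sets \<nu>"
  shows "NuH S w w A = 0"
proof -
  have Ab: "A \<in> sets borel" using A ed by (auto simp: energy_dominant_def null_sets_def)
  interpret N: bounded_bilinear "\<lambda>v w. NuH S v w A" by (rule NuH_bilinear)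
  have el: "NuH S (elem h f) w A = 0" if h: "h \<in> Cc" and f: "f \<in> Alg S" for h f w
  proof -
    have "null_sets \<nu> \<subseteq> null_sets (to_measure (Nu S f f))"
      using ed f by (simp add: energy_dominant_def absolutely_continuous_def)
    then have "A \<in> null_sets (nu_vec S (grad S f))" using A unfolding nu_vec_grad[OF f] by blast
    then have AE: "AE x in nu_vec S (grad S f). x \<notin> A" by (rule AE_not_in)
    note b = bounded_borel_mult[OF Cc_bounded_borel[OF Cc_mult[OF h h]] bounded_borel_indicator[OF Ab]]
    have "NuH S (elem h f) (elem h f) A = signed_integral (Nu S f f) (\<lambda>x. (h x * h x) * indicator A x)"
      using int_NuH_elem[OF h f h f bounded_borel_indicator[OF Ab]] int_NuH_indicator[OF Ab] by simp
    also have "\<dots> = int_NuH (\<lambda>x. (h x * h x) * indicator A x) (grad S f) (grad S f)"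
      by (simp add: int_NuH_def Nu_NuH f)
    also have "\<dots> = (LINT x|nu_vec S (grad S f). (h x * h x) * indicator A x)" by (rule int_NuH_diag[OF b])
    also have "\<dots> = 0" using AE by (intro integral_eq_zero_AE) (auto elim!: eventually_mono)
    finally show ?thesis using NuH_Cauchy_Schwarz[of "elem h f" w A] by simp
  qed
  have "bounded_linear (\<lambda>v. NuH S v w A)" by (rule N.bounded_linear_left)
  have "NuH S v w A = 0" if "v \<in> span elems" for v
    using linear_eq_on_span[of "\<lambda>v. NuH S v w A" "\<lambda>_. 0" elems] el that
      bounded_linear.linear[OF N.bounded_linear_left] linear_zero by blast
  then have "closure (span elems) \<subseteq> {v. NuH S v w A = 0}"
    by (intro closure_minimal closed_Collect_eq N.continuous_on continuous_intros) auto
  then show ?thesis using closure_span_elems by blast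
qed

lemma orthogonal_imp_zero:
  assumes md: "martingale_dimension S 1" and b: "minimal_energy_dominant S (nu_vec S b)"
    and orth: "\<And>A. NuH S b w A = 0"
  shows "w = 0"
proof -
  obtain \<nu> p where \<nu>: "minimal_energy_dominant S \<nu>" and pi: "pointwise_index S \<nu> p"
    and inf: "1 = Inf {c. AE x in \<nu>. p x \<le> c}" using md unfolding martingale_dimension_def by blast
  have ed: "energy_dominant S \<nu>" and edb: "energy_dominant S (nu_vec S b)"
    using \<nu> b by (auto simp: minimal_energy_dominant_def)
  have br: "bounds_rank S \<nu> p" using pi by (simp add: pointwise_index_def)
  have p1: "AE x in \<nu>. p x \<le> 1"
  proof -
    \<comment> \<open>An infimum of a nonempty set in \<open>enat\<close> is attained;
      \<open>\<infinity>\<close> belongs to the set.\<close>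
    have "Inf {c. AE x in \<nu>. p x \<le> c} \<in> {c. AE x in \<nu>. p x \<le> c}"
      unfolding Inf_enat_def by (rule LeastI2_ex) (auto intro: exI[of _ \<infinity>])
    then show ?thesis by (simp flip: inf)
  qed
  have "\<exists>s. \<forall>n. s n \<in> simple_vecs \<and> s \<longlonglongrightarrow> v" for v
    using closure_simple_vecs unfolding closure_sequential set_eq_iff by blast
  then obtain bn wn where bn: "\<And>n. bn n \<in> simple_vecs" "bn \<longlonglongrightarrow> b"
    and wn: "\<And>n. wn n \<in> simple_vecs" "wn \<longlonglongrightarrow> w" by meson
  interpret N: bounded_bilinear "\<lambda>v w. NuH S v w A" for A by (rule NuH_bilinear)
  \<comment> \<open>The mixed measure of \<open>b\<close> and \<open>w\<close> vanishes, so that of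
    the approximants is bounded by the approximation error, uniformly over sets.\<close>
  define e where "e n = norm (bn n - b) * norm (wn n) + norm b * norm (wn n - w)" for n
  have e0: "e \<longlonglongrightarrow> 0"
  proof -
    have "(\<lambda>n. norm (bn n - b) * norm (wn n) + norm b * norm (wn n - w)) \<longlonglongrightarrow>
      norm (b - b) * norm w + norm b * norm (w - w)"
      by (intro tendsto_intros bn wn)
    then show ?thesis by (simp add: e_def[abs_def])
  qed
  have "\<bar>NuH S (bn n) (wn n) A\<bar> \<le> e n" for n A
  proof -
    have "NuH S (bn n) (wn n) A = NuH S (bn n - b) (wn n) A + NuH S b (wn n - w) A"
      by (simp add: N.diff_left N.diff_right orth)
    then show ?thesis using NuH_le_norm[of "bn n - b" "wn n" A] NuH_le_norm[of b "wn n - w" A]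
      by (simp add: e_def)
  qed
  then have "\<exists>D\<in>sets borel. NuH S (wn n) (wn n) D \<le> 2 * e n \<and> NuH S (bn n) (bn n) (- D) \<le> 2 * e n" for n
    by (intro singular_separation[OF ed br p1 bn(1) wn(1)])
  then obtain D where D: "\<And>n. D n \<in> sets borel" "\<And>n. NuH S (wn n) (wn n) (D n) \<le> 2 * e n"
    "\<And>n. NuH S (bn n) (bn n) (- D n) \<le> 2 * e n" by metis
  have close: "(\<lambda>n. NuH S v v (A n)) \<longlonglongrightarrow> 0"
    if vn: "vn \<longlonglongrightarrow> v" and le: "\<And>n. NuH S (vn n) (vn n) (A n) \<le> 2 * e n" for vn v and A :: "nat \<Rightarrow> 'x set"
  proof (rule tendsto_sandwich[OF _ _ tendsto_const])
    have "NuH S v v (A n) \<le> 2 * e n + norm (v - vn n) * norm v + norm (vn n) * norm (v - vn n)" for n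
    proof -
      have "NuH S v v (A n) = NuH S (vn n) (vn n) (A n) + NuH S (v - vn n) v (A n) + NuH S (vn n) (v - vn n) (A n)"
        by (simp add: N.diff_left N.diff_right)
      then show ?thesis
        using le[of n] NuH_le_norm[of "v - vn n" v "A n"] NuH_le_norm[of "vn n" "v - vn n" "A n"] by linarith
    qed
    then show "\<forall>\<^sub>F n in sequentially. NuH S v v (A n) \<le>
      2 * e n + norm (v - vn n) * norm v + norm (vn n) * norm (v - vn n)" by simp
    have "(\<lambda>n. 2 * e n + norm (v - vn n) * norm v + norm (vn n) * norm (v - vn n)) \<longlonglongrightarrow>
      2 * 0 + norm (v - v) * norm v + norm v * norm (v - v)"
      by (intro tendsto_intros vn e0)
    then show "(\<lambda>n. 2 * e n + norm (v - vn n) * norm v + norm (vn n) * norm (v - vn n)) \<longlonglongrightarrow> 0" by simp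
  qed (simp add: NuH_nonneg)
  note wD = close[OF wn(2) D(2)] and bD = close[OF bn(2) D(3)]
  \<comment> \<open>This transfers smallness on \<open>- D n\<close> from the measure of
    \<open>b\<close> to that of \<open>w\<close>, which is already small on
    \<open>D n\<close>.\<close>
  have "absolutely_continuous (nu_vec S b) (nu_vec S w)"
    unfolding absolutely_continuous_def
  proof
    fix A assume A: "A \<in> null_sets (nu_vec S b)"
    then have "A \<in> sets (nu_vec S w)" by (auto simp: null_sets_def nu_vec_measure)
    moreover have "measure (nu_vec S w) A = 0" using NuH_null[OF edb A] by (simp add: nu_vec_measure)
    ultimately show "A \<in> null_sets (nu_vec S w)"
      using finite_measure.emeasure_eq_measure[OF nu_vec_measure(1)] by (simp add: null_sets_def)
  qed
  then have "(\<lambda>n. measure (nu_vec S w) (- D n)) \<longlonglongrightarrow> 0"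
  proof (rule absolutely_continuous_tendsto_0[OF nu_vec_measure(1,2) nu_vec_measure(1,2)])
    show "- D n \<in> sets borel" for n using D(1)[of n] by auto
    show "(\<lambda>n. measure (nu_vec S b) (- D n)) \<longlonglongrightarrow> 0" unfolding nu_vec_measure(3) by (rule bD)
  qed
  then have wcD: "(\<lambda>n. NuH S w w (- D n)) \<longlonglongrightarrow> 0" unfolding nu_vec_measure(3) .
  have split: "NuH S w w UNIV = NuH S w w (D n) + NuH S w w (- D n)" for n
  proof -
    have "measure (nu_vec S w) (D n \<union> - D n) = measure (nu_vec S w) (D n) + measure (nu_vec S w) (- D n)"
      using D(1)[of n] by (intro finite_measure.finite_measure_Union nu_vec_measure(1))
        (simp_all add: nu_vec_measure(2) borel_comp)
    then show ?thesis by (simp add: nu_vec_measure(3))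
  qed
  have "(\<lambda>n. NuH S w w UNIV) \<longlonglongrightarrow> 0 + 0"
    using tendsto_add[OF wD wcD] by (simp only: split[symmetric])
  then have "NuH S w w UNIV = 0" by (simp add: LIMSEQ_const_iff)
  then have "(norm w)\<^sup>2 = 0" by (simp add: norm_sq_NuH)
  then show ?thesis by simp
qed

text \<open>Subtracting from \<open>v\<close> its projection to the closure of all
  \<open>k b\<close> leaves a vector whose mixed measure with \<open>b\<close> is 0, hence the zero
  vector. If \<open>s n b\<close> tends to \<open>v\<close>, the isometry makes \<open>s\<close>
  Cauchy in L2, and its limit is the preimage.\<close>

lemma star_surj:
  assumes md: "martingale_dimension S 1" and b: "minimal_energy_dominant S (nu_vec S b)"
  shows "\<exists>g\<in>L2 (nu_vec S b). star S b g = v"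
proof -
  note M = nu_vec_measure(1)[of b]
  define V0 where "V0 = {mult S k b | k. k \<in> Cc}"
  have V0_add: "x + c *\<^sub>R y \<in> V0" if xy: "x \<in> V0" "y \<in> V0" for x y c
  proof -
    obtain k l where kl: "x = mult S k b" "y = mult S l b" "k \<in> Cc" "l \<in> Cc" using xy by (auto simp: V0_def)
    have "(\<lambda>x. k x + c * l x) \<in> Cc" by (intro Cc_add Cc_mult Cc_const kl)
    then show ?thesis unfolding V0_def kl(1,2) mult_lincomb_left[OF kl(3,4), symmetric] by blast
  qed
  have V0_plus: "x + y \<in> V0" if "x \<in> V0" "y \<in> V0" for x y
    using V0_add[OF that, of 1] by simp
  have V0_scale: "c *\<^sub>R x \<in> V0" if "x \<in> V0" for x c
    using V0_add[OF that that, of "c - 1"] by (simp add: algebra_simps)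
  let ?V = "closure V0"
  have "\<exists>y\<in>?V. \<forall>z\<in>?V. inner (v - y) z = 0"
  proof (rule orthogonal_decomposition_exists[OF closed_closure])
    have "0 *\<^sub>R mult S (\<lambda>x. 1) b \<in> V0" by (rule V0_scale) (auto simp: V0_def)
    then show "0 \<in> ?V" using closure_subset by auto
  qed (auto intro: closure_add closure_scaleR V0_plus V0_scale)
  then obtain y where y: "y \<in> ?V" "\<And>z. z \<in> ?V \<Longrightarrow> inner (v - y) z = 0" by blast
  have "v - y = 0"
  proof (rule orthogonal_imp_zero[OF md b])
    interpret N: bounded_bilinear "\<lambda>v w. NuH S v w A" for A by (rule NuH_bilinear)
    have "NuH S b (v - y) = NuH S b 0"
    proof (rule signed_measure_eqI[OF fsm_NuH fsm_NuH])
      fix h :: "'x \<Rightarrow> real" assume "continuous_on UNIV h"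
      then have h: "h \<in> Cc" by (simp add: Cc_iff)
      then have "mult S h b \<in> ?V" using closure_subset[of V0] by (auto simp: V0_def)
      from y(2)[OF this] have "inner (mult S h b) (v - y) = inner (mult S h b) 0"
        by (metis inner_commute inner_zero_right)
      then show "signed_integral (NuH S b (v - y)) h = signed_integral (NuH S b 0) h"
        unfolding inner_mult[OF h] int_NuH_def .
    qed
    then show "NuH S b (v - y) A = 0" for A using N.zero_right by metis
  qed
  then have "v \<in> ?V" using y(1) by simp
  then obtain t where t: "\<And>n. t n \<in> V0" "t \<longlonglongrightarrow> v" unfolding closure_sequential by blast
  then have "\<forall>n. \<exists>k. k \<in> Cc \<and> t n = mult S k b" unfolding V0_def by blast
  then obtain s where s: "\<And>n. s n \<in> Cc" "\<And>n. t n = mult S (s n) b" by metis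
  have "\<exists>g\<in>L2 (nu_vec S b). (\<lambda>n. LINT x|nu_vec S b. (s n x - g x)\<^sup>2) \<longlonglongrightarrow> 0"
  proof (rule L2_complete[OF M])
    show "s n \<in> L2 (nu_vec S b)" for n by (rule Cc_L2[OF s(1)])
    fix e :: real assume "e > 0"
    then obtain N where N: "\<And>m n. m \<ge> N \<Longrightarrow> n \<ge> N \<Longrightarrow> norm (t m - t n) < sqrt e"
      using LIMSEQ_imp_Cauchy[OF t(2)] by (metis CauchyD real_sqrt_gt_0_iff)
    have "(LINT x|nu_vec S b. (s m x - s n x)\<^sup>2) < e" if "m \<ge> N" "n \<ge> N" for m n
    proof -
      have "(norm (t m - t n))\<^sup>2 < (sqrt e)\<^sup>2" using N[OF that] by (intro power_strict_mono) auto
      then show ?thesis using \<open>e > 0\<close>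
        by (simp add: s(2) norm_mult_diff_sq s(1))
    qed
    then show "\<exists>N. \<forall>m\<ge>N. \<forall>n\<ge>N. (LINT x|nu_vec S b. (s m x - s n x)\<^sup>2) < e" by blast
  qed
  then obtain g where g: "g \<in> L2 (nu_vec S b)" "(\<lambda>n. LINT x|nu_vec S b. (s n x - g x)\<^sup>2) \<longlonglongrightarrow> 0" by blast
  have "(\<lambda>n. mult S (s n) b) \<longlonglongrightarrow> v" using t(2) by (simp add: s(2)[symmetric])
  from star_eqI[OF g(1) s(1) g(2) this] show ?thesis using g(1) by blast
qed

end

section \<open>The Neumann representation\<close>

context compact_form
begin

lemma abs_le_sup_norm:
  fixes f :: "'x \<Rightarrow> real"
  assumes "f \<in> Cc" shows "\<bar>f x\<bar> \<le> sup_norm f"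
proof -
  obtain K where "\<forall>x. \<bar>f x\<bar> \<le> K" using Cc_bounded[OF assms] by blast
  then have "bdd_above (range (\<lambda>x. \<bar>f x\<bar>))" by (auto intro!: bdd_aboveI[of _ K])
  then show ?thesis unfolding sup_norm_def by (intro cSUP_upper) auto
qed

lemma Alg_dense:
  assumes "f \<in> Cc" "e > 0" shows "\<exists>g\<in>Alg S. \<forall>x. \<bar>f x - g x\<bar> < e"
proof -
  have "\<forall>f\<in>Cc. \<forall>e>0. \<exists>g\<in>Alg S. sup_norm (\<lambda>x. f x - g x) < e"
    using adm unfolding admissible_form_def by (elim conjE) assumption
  then obtain g where g: "g \<in> Alg S" "sup_norm (\<lambda>x. f x - g x) < e" using assms by blast
  have "\<bar>f x - g x\<bar> < e" for x
    using abs_le_sup_norm[OF Cc_diff[OF assms(1) Alg_Cc[OF g(1)]], of x] g(2) by linarith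
  then show ?thesis using g(1) by blast
qed

text \<open>This function vanishes where \<open>\<bar>g\<bar> \<le> e\<close>, which is how elements of \<open>\<C>\<^sub>B\<close> are found near a continuous
  function that vanishes on \<open>B\<close>.\<close>

lemma soft_threshold:
  assumes g: "g \<in> Alg S" and e: "e > 0"
  shows "(\<lambda>x. g x - max (min (g x) e) (- e)) \<in> Alg S"
proof -
  have clip: "\<forall>u\<in>Alg S. (\<lambda>x. max (min (u x) 1) 0) \<in> Alg S"
    using adm unfolding admissible_form_def by (elim conjE) blast
  \<comment> \<open>The affine map takes \<open>- e\<close> and \<open>e\<close> to 0 and 1, so the
    unit contraction of the form becomes truncation to [-e, e]. It requires constants in C.\<close>
  define u where "u x = 1 / (2 * e) * g x + 1 / 2" for x
  have "u \<in> Alg S" unfolding u_def by (intro Alg_add Alg_cmult Alg_const g)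
  then have "(\<lambda>x. max (min (u x) 1) 0) \<in> Alg S" using clip by blast
  then have m: "(\<lambda>x. 2 * e * max (min (u x) 1) 0 - e) \<in> Alg S" by (intro Alg_diff Alg_cmult Alg_const)
  have "2 * e * max (min (u x) 1) 0 - e = max (min (g x) e) (- e)" for x
  proof -
    have u: "2 * e * u x = g x + e" using e by (simp add: u_def field_simps)
    consider "g x \<le> - e" | "- e < g x" "g x < e" | "e \<le> g x" by linarith
    then show ?thesis
    proof cases
      case 1
      then have "u x \<le> 0" using u e by (smt (verit) mult_pos_pos)
      then show ?thesis using 1 e by auto
    next
      case 2
      then have "0 < u x" "u x < 1" using e by (auto simp: u_def field_simps)
      then show ?thesis using 2 u by auto
    next
      case 3
      then have "1 \<le> u x" using e by (auto simp: u_def field_simps)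
      then show ?thesis using 3 e by auto
    qed
  qed
  then show ?thesis using Alg_diff[OF g m] by simp
qed

lemma AlgB_empty: "AlgB S {} = Alg S" by (simp add: AlgB_def)

text \<open>Density of C_B in L2, the reason why adjoints have unique values. \<open>D\<close> is
  general because the fact is used for \<open>B\<close> and for the empty set.\<close>

lemma AlgB_orthogonal:
  assumes h: "h \<in> L2 (nu_vec S b)" and cl: "closed D" and null: "D \<in> null_sets (nu_vec S b)"
    and orth: "\<And>\<phi>. \<phi> \<in> AlgB S D \<Longrightarrow> (LINT x|nu_vec S b. h x * \<phi> x) = 0"
  shows "AE x in nu_vec S b. h x = 0"
proof -
  note M = nu_vec_measure(1,2)[of b]
  let ?M = "nu_vec S b"
  have hm[measurable]: "h \<in> borel_measurable ?M" using h by (simp add: L2_def)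
  have hi: "integrable ?M h" using L2_integrable(1)[OF M(1) h h] .
  have vanishing: "(LINT x|?M. h x * k x) = 0" if k: "k \<in> Cc" "\<And>x. x \<in> D \<Longrightarrow> k x = 0" for k
  proof -
    have "\<bar>LINT x|?M. h x * k x\<bar> \<le> 0"
    proof (rule field_le_epsilon)
      fix e :: real assume "e > 0"
      define X where "X = (LINT x|?M. \<bar>h x\<bar>)"
      \<comment> \<open>Chosen so that \<open>2 * d * X \<le> e\<close>; the added 1 covers
        \<open>X = 0\<close>.\<close>
      define d where "d = e / (2 * (X + 1))"
      have "0 \<le> X" by (simp add: X_def)
      then have nz: "0 < 2 * (X + 1)" by (simp add: add_nonneg_pos)
      then have d: "d > 0" unfolding d_def using \<open>e > 0\<close> by (rule divide_pos_pos[rotated])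
      obtain g where g: "g \<in> Alg S" "\<And>x. \<bar>k x - g x\<bar> < d" using Alg_dense[OF k(1) d] by blast
      define \<phi> where "\<phi> x = g x - max (min (g x) d) (- d)" for x
      \<comment> \<open>On \<open>D\<close> the function \<open>k\<close> is 0, so
        \<open>\<bar>g x\<bar> < d\<close> there and the threshold makes \<open>\<phi>\<close>
        vanish exactly.\<close>
      have "\<phi> x = 0" if "x \<in> D" for x using g(2)[of x] k(2)[OF that] by (auto simp: \<phi>_def)
      then have \<phi>: "\<phi> \<in> AlgB S D" using soft_threshold[OF g(1) d] by (auto simp: AlgB_def \<phi>_def[abs_def])
      then have \<phi>C: "\<phi> \<in> Cc" using Alg_Cc by (auto simp: AlgB_def)
      have close: "\<bar>k x - \<phi> x\<bar> \<le> 2 * d" for x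
      proof -
        have "\<bar>g x - \<phi> x\<bar> \<le> d" using d by (auto simp: \<phi>_def)
        then show ?thesis using g(2)[of x] by linarith
      qed
      have i: "integrable ?M (\<lambda>x. h x * k x)" "integrable ?M (\<lambda>x. h x * \<phi> x)"
        using L2_integrable(2)[OF M(1) h Cc_L2] k \<phi>C by auto
      have "\<bar>LINT x|?M. h x * k x\<bar> = \<bar>LINT x|?M. h x * k x - h x * \<phi> x\<bar>"
        using i orth[OF \<phi>] by simp
      also have "\<dots> \<le> (LINT x|?M. \<bar>h x * k x - h x * \<phi> x\<bar>)" by simp
      also have "\<dots> \<le> (LINT x|?M. 2 * d * \<bar>h x\<bar>)"
      proof (rule integral_mono)
        show "\<bar>h x * k x - h x * \<phi> x\<bar> \<le> 2 * d * \<bar>h x\<bar>" for x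
        proof -
          have "\<bar>h x * k x - h x * \<phi> x\<bar> = \<bar>h x\<bar> * \<bar>k x - \<phi> x\<bar>"
            by (simp only: right_diff_distrib[symmetric] abs_mult)
          also have "\<dots> \<le> \<bar>h x\<bar> * (2 * d)" by (intro mult_left_mono close) simp
          finally show ?thesis by (simp only: mult.commute)
        qed
      qed (use i hi in auto)
      also have "\<dots> = d * (2 * X)" by (simp add: X_def)
      also have "\<dots> \<le> d * (2 * (X + 1))" using d by (intro mult_left_mono) auto
      also have "\<dots> = e" unfolding d_def using nz by (metis nonzero_eq_divide_eq less_irrefl)
      finally show "\<bar>LINT x|?M. h x * k x\<bar> \<le> 0 + e" by simp
    qed
    then show ?thesis by simp
  qed
  have all: "(LINT x|?M. h x * k x) = 0" if k: "k \<in> Cc" for k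
  proof (cases "D = {}") \<comment> \<open>\<open>infdist x {} = 0\<close>\<close>
    case True
    then show ?thesis using vanishing[OF k] by simp
  next
    case False
    \<comment> \<open>Cutting off near \<open>D\<close> costs nothing in the limit: closedness gives
      convergence off \<open>D\<close>, and \<open>D\<close> is null.\<close>
    define t where "t n x = k x * min 1 (real n * infdist x D)" for n x
    have t: "t n \<in> Cc" for n
      using k unfolding t_def Cc_iff by (intro continuous_intros)
    have t0: "t n x = 0" if "x \<in> D" for n x using that by (simp add: t_def)
    have tk: "\<bar>t n x\<bar> \<le> \<bar>k x\<bar>" for n x
    proof -
      have "0 \<le> min 1 (real n * infdist x D)" by (simp add: infdist_nonneg)
      then have "\<bar>t n x\<bar> = \<bar>k x\<bar> * min 1 (real n * infdist x D)" by (simp add: t_def abs_mult)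
      also have "\<dots> \<le> \<bar>k x\<bar> * 1" by (intro mult_left_mono) auto
      finally show ?thesis by simp
    qed
    have lim: "(\<lambda>n. t n x) \<longlonglongrightarrow> k x" if "x \<notin> D" for x
    proof -
      have d: "infdist x D > 0"
        using that cl False by (metis in_closed_iff_infdist_zero infdist_nonneg less_eq_real_def)
      obtain N where N: "1 / infdist x D < real N" using reals_Archimedean2 by blast
      have "t n x = k x" if "n \<ge> N" for n
      proof -
        have "1 / infdist x D < real n" using N that by linarith
        then show ?thesis using d by (simp add: t_def field_simps)
      qed
      then show ?thesis by (intro tendsto_eventually) (auto simp: eventually_sequentially)
    qed
    have meas: "j \<in> borel_measurable ?M" if "j \<in> Cc" for j using Cc_L2[OF that, of b] by (simp add: L2_def)
    have "(\<lambda>n. LINT x|?M. h x * t n x) \<longlonglongrightarrow> (LINT x|?M. h x * k x)"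
    proof (rule integral_dominated_convergence)
      show "integrable ?M (\<lambda>x. \<bar>h x * k x\<bar>)" using L2_integrable(2)[OF M(1) h Cc_L2[OF k]] by simp
      show "AE x in ?M. (\<lambda>n. h x * t n x) \<longlonglongrightarrow> h x * k x"
        using AE_not_in[OF null] by eventually_elim (intro tendsto_intros lim)
      show "AE x in ?M. norm (h x * t n x) \<le> \<bar>h x * k x\<bar>" for n
        using tk by (simp add: abs_mult mult_left_mono)
    qed (use meas k t in auto)
    moreover have "(\<lambda>n. LINT x|?M. h x * t n x) = (\<lambda>n. 0)" using vanishing[OF t t0] by simp
    ultimately show ?thesis by (simp add: LIMSEQ_const_iff)
  qed
  \<comment> \<open>Continuous functions approximating \<open>h\<close> show that \<open>h\<close>
    is orthogonal to itself.\<close>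
  obtain s where s: "\<And>n. s n \<in> Cc" "(\<lambda>n. mult S (s n) b) \<longlonglongrightarrow> star S b h"
    by (rule star_obtain[OF h]) (rule that)
  have "inner (star S b h) (mult S (s n) b) = 0" for n
    using inner_star[OF h Cc_L2[OF s(1)[of n]]] all[OF s(1)[of n]] by (simp add: star_Cc s(1))
  moreover have "(\<lambda>n. inner (star S b h) (mult S (s n) b)) \<longlonglongrightarrow> inner (star S b h) (star S b h)"
    by (intro tendsto_intros s)
  ultimately have "inner (star S b h) (star S b h) = 0" by (simp add: LIMSEQ_const_iff)
  then have "(LINT x|?M. (h x)\<^sup>2) = 0" using inner_star[OF h h] by (simp add: power2_eq_square)
  then show ?thesis by (rule L2_AE_zero[OF h])
qed

section \<open>Adjoints, the orthogonal decomposition and normal parts\<close>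

lemma is_adj_lincomb:
  assumes v: "is_adj S b D v h" and w: "is_adj S b D w k"
  shows "is_adj S b D (c *\<^sub>R v + d *\<^sub>R w) (\<lambda>x. c * h x + d * k x)"
proof -
  note M = nu_vec_measure(1)[of b]
  have hk: "h \<in> L2 (nu_vec S b)" "k \<in> L2 (nu_vec S b)" using v w by (auto simp: is_adj_def)
  have "(LINT x|nu_vec S b. (c * h x + d * k x) * \<phi> x) =
    c * (LINT x|nu_vec S b. h x * \<phi> x) + d * (LINT x|nu_vec S b. k x * \<phi> x)" if "\<phi> \<in> AlgB S D" for \<phi>
  proof -
    have "\<phi> \<in> L2 (nu_vec S b)" using that Cc_L2 Alg_Cc by (auto simp: AlgB_def)
    then have "integrable (nu_vec S b) (\<lambda>x. h x * \<phi> x)" "integrable (nu_vec S b) (\<lambda>x. k x * \<phi> x)"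
      using L2_integrable(2)[OF M] hk by auto
    then show ?thesis by (simp add: distrib_right mult.assoc)
  qed
  then show ?thesis using v w L2_add[OF M L2_cmult L2_cmult] hk
    by (auto simp: is_adj_def inner_add)
qed

lemma is_adj_zero: "v \<in> ker_adj S D \<Longrightarrow> is_adj S b D v (\<lambda>x. 0)"
  by (auto simp: is_adj_def ker_adj_def L2_def)

lemma is_adj_adj: "v \<in> dom_adj S b D \<Longrightarrow> is_adj S b D v (adj S b D v)"
  using someI_ex[of "is_adj S b D v"] by (simp add: dom_adj_def adj_def)

lemma inner_mult_swap:
  assumes k: "k \<in> Cc" shows "inner (mult S k v) w = inner v (mult S k w)"
proof -
  have "inner (mult S k v) w = int_NuH k w v" unfolding inner_mult[OF k] by (rule int_NuH_sym)
  also have "\<dots> = inner v (mult S k w)" unfolding inner_mult[OF k, symmetric] by (rule inner_commute)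
  finally show ?thesis .
qed

end

locale complete_form_duality = compact_form S
  for S :: "('x::metric_space, 'h::{real_inner, complete_space}) form_structure" +
  fixes B :: "'x set" and p :: 'x and b :: 'h
  assumes md: "martingale_dimension S 1"
    and cl: "closed B" and null: "form_null_set S B"
    and compl: "complete_wrt S p"
    and b_ker: "b \<in> ker_adj S B" and b_min: "minimal_energy_dominant S (nu_vec S b)"
begin

abbreviation \<nu> where "\<nu> \<equiv> nu_vec S b"

lemmas fin = nu_vec_measure(1)[of b]

lemma B_null: "B \<in> null_sets \<nu>"
proof -
  obtain \<mu> where \<mu>: "minimal_energy_dominant S \<mu>" "B \<in> null_sets \<mu>"
    using null by (auto simp: form_null_set_def)
  then have "absolutely_continuous \<mu> \<nu>" using b_min by (auto simp: minimal_energy_dominant_def)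
  then show ?thesis using \<mu> by (auto simp: absolutely_continuous_def)
qed

lemma star_inv: "star_inv S b v \<in> L2 \<nu>" "star S b (star_inv S b v) = v"
proof -
  have "\<exists>g. g \<in> L2 \<nu> \<and> star S b g = v" using star_surj[OF md b_min] by blast
  from someI_ex[OF this, folded star_inv_def]
  show "star_inv S b v \<in> L2 \<nu>" "star S b (star_inv S b v) = v" by auto
qed

lemma is_adj_unique:
  assumes D: "closed D" "D \<in> null_sets \<nu>" and h: "is_adj S b D v h" "is_adj S b D v k"
  shows "AE x in \<nu>. h x = k x"
proof -
  from is_adj_lincomb[OF h, of 1 "-1"] have d: "is_adj S b D 0 (\<lambda>x. h x - k x)" by simp
  have "AE x in \<nu>. h x - k x = 0"
  proof (rule AlgB_orthogonal[OF _ D])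
    show "(\<lambda>x. h x - k x) \<in> L2 \<nu>" using d by (simp add: is_adj_def)
    show "(LINT x|\<nu>. (h x - k x) * \<phi> x) = 0" if "\<phi> \<in> AlgB S D" for \<phi>
    proof -
      have "inner 0 (grad S \<phi>) = (LINT x|\<nu>. (h x - k x) * \<phi> x)"
        using d that unfolding is_adj_def by blast
      then show ?thesis by simp
    qed
  qed
  then show ?thesis by simp
qed

text \<open>Subtracting the value at \<open>p\<close> does not change a gradient, so all gradients
  come from C_p. There the form norm is the norm of the gradient, and completeness of C_p becomes
  closedness of the range.\<close>

lemma closed_grad: "closed (grad S ` Alg S)"
proof (rule closed_sequential_limits[THEN iffD2], intro allI impI, elim conjE)
  fix t x assume "\<forall>n. t n \<in> grad S ` Alg S" and tx: "t \<longlonglongrightarrow> x"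
  then have "\<forall>n. \<exists>f. f \<in> Alg S \<and> t n = grad S f" by blast
  then obtain f where f: "\<And>n. f n \<in> Alg S" "\<And>n. t n = grad S (f n)" by metis
  define s where "s n x = f n x - f n p" for n x
  have sA: "s n \<in> Alg S" for n unfolding s_def[abs_def] by (intro Alg_diff f Alg_const)
  have st: "grad S (s n) = t n" for n
    unfolding s_def[abs_def] by (simp add: grad_diff f(1) Alg_const grad_const f(2))
  let ?Cp = "{f \<in> Alg S. f p = 0}"
  have sCp: "s n \<in> ?Cp" for n using sA by (simp add: s_def)
  have E: "sqrt (Form S (\<lambda>x. u x - w x) (\<lambda>x. u x - w x)) = norm (grad S u - grad S w)"
    if "u \<in> Alg S" "w \<in> Alg S" for u w
    using that by (simp add: Form_inner Alg_diff grad_diff norm_eq_sqrt_inner)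
  have conv: "\<forall>s. (\<forall>n. s n \<in> ?Cp) \<and>
          (\<forall>\<epsilon>>0. \<exists>n\<^sub>0. \<forall>m\<ge>n\<^sub>0. \<forall>n\<ge>n\<^sub>0. sqrt (Form S (\<lambda>x. s m x - s n x) (\<lambda>x. s m x - s n x)) < \<epsilon>) \<longrightarrow>
          (\<exists>f\<in>?Cp. (\<lambda>n. sqrt (Form S (\<lambda>x. s n x - f x) (\<lambda>x. s n x - f x))) \<longlonglongrightarrow> 0)"
    using compl unfolding complete_wrt_def Let_def by (elim conjE) assumption
  have "\<forall>\<epsilon>>0. \<exists>n\<^sub>0. \<forall>m\<ge>n\<^sub>0. \<forall>n\<ge>n\<^sub>0. sqrt (Form S (\<lambda>x. s m x - s n x) (\<lambda>x. s m x - s n x)) < \<epsilon>"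
    using LIMSEQ_imp_Cauchy[OF tx] by (simp add: E sA st Cauchy_iff)
  then obtain u where u: "u \<in> ?Cp" "(\<lambda>n. sqrt (Form S (\<lambda>x. s n x - u x) (\<lambda>x. s n x - u x))) \<longlonglongrightarrow> 0"
    using conv sCp by blast
  then have "(\<lambda>n. norm (t n - grad S u)) \<longlonglongrightarrow> 0" by (simp add: E sA st)
  then have "t \<longlonglongrightarrow> grad S u" by (simp add: LIM_zero_cancel tendsto_norm_zero_iff)
  then have "x = grad S u" using tx LIMSEQ_unique by blast
  then show "x \<in> grad S ` Alg S" using u by blast
qed

lemma decomposition: "\<exists>u\<in>Alg S. v - grad S u \<in> ker_adj S {}"
proof -
  have "\<exists>y\<in>grad S ` Alg S. \<forall>z\<in>grad S ` Alg S. inner (v - y) z = 0"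
  proof (rule orthogonal_decomposition_exists[OF closed_grad])
    show "0 \<in> grad S ` Alg S" using grad_const[of 0] Alg_zero by (metis image_eqI)
    show "x + y \<in> grad S ` Alg S" if "x \<in> grad S ` Alg S" "y \<in> grad S ` Alg S" for x y
      using that Alg_add grad_add by (auto simp: image_iff) metis
    show "c *\<^sub>R x \<in> grad S ` Alg S" if "x \<in> grad S ` Alg S" for c x
      using that Alg_cmult grad_cmult by (auto simp: image_iff) metis
  qed
  then show ?thesis by (auto simp: ker_adj_def AlgB_empty)
qed

text \<open>The difference of the two gradients is orthogonal to all gradients. Only
  \<open>grad S u\<close> is determined; \<open>u\<close> itself is free up to a constant.\<close>

lemma decomposition_unique:
  assumes "u \<in> Alg S" "u' \<in> Alg S" "v \<in> ker_adj S {}" "v' \<in> ker_adj S {}"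
    "grad S u + v = grad S u' + v'"
  shows "grad S u = grad S u'" "v = v'"
proof -
  have d: "grad S (\<lambda>x. u x - u' x) = v' - v"
    using assms by (simp add: grad_diff algebra_simps)
  have "inner (v' - v) (grad S (\<lambda>x. u x - u' x)) = 0"
    using assms Alg_diff[OF assms(1,2)] by (simp add: ker_adj_def AlgB_empty inner_diff)
  then have "v' - v = 0" by (simp add: d)
  then show "v = v'" by simp
  then show "grad S u = grad S u'" using assms(5) by simp
qed

lemma Alg_L2: "f \<in> Alg S \<Longrightarrow> f \<in> L2 \<nu>" by (rule Cc_L2[OF Alg_Cc])

lemma inner_mult_grad:
  assumes "\<phi> \<in> Alg S"
  shows "inner (mult S \<phi> b) v = (LINT x|\<nu>. star_inv S b v x * \<phi> x)"
  using inner_star[OF Alg_L2[OF assms] star_inv(1)[of v]]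
  by (simp add: star_inv(2) star_Cc Alg_Cc assms mult.commute)

text \<open>Self-adjointness of \<open>mult\<close> moves the factors onto \<open>b\<close>, and the
  isometry turns the second term into an integral.\<close>

lemma inner_b_grad_mult:
  assumes g: "g \<in> Alg S" and \<phi>: "\<phi> \<in> Alg S"
  shows "inner b (grad S (\<lambda>x. g x * \<phi> x)) =
    inner (mult S g b) (grad S \<phi>) + (LINT x|\<nu>. star_inv S b (grad S g) x * \<phi> x)"
  using inner_mult_grad[OF \<phi>, of "grad S g"]
  by (simp add: grad_mult g \<phi> inner_add inner_mult_swap[symmetric] Alg_Cc)

text \<open>For \<open>\<phi>\<close> in C_B the product with \<open>g\<close> is again in C_B, so
  \<open>b\<close> is orthogonal to its gradient. Thus C lies in \<open>dom_perp\<close>, where the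
  operator acts as the gradient read through \<open>star_inv\<close>.\<close>

lemma is_adj_mult:
  assumes g: "g \<in> Alg S"
  shows "is_adj S b B (mult S g b) (\<lambda>x. - star_inv S b (grad S g) x)"
  unfolding is_adj_def
proof (intro conjI ballI)
  show "(\<lambda>x. - star_inv S b (grad S g) x) \<in> L2 \<nu>"
    using L2_cmult[OF star_inv(1), of "-1" "grad S g"] by simp
  fix \<phi> assume \<phi>: "\<phi> \<in> AlgB S B"
  then have \<phi>A: "\<phi> \<in> Alg S" by (simp add: AlgB_def)
  have "(\<lambda>x. g x * \<phi> x) \<in> AlgB S B" using \<phi> Alg_mult[OF g] by (simp add: AlgB_def)
  then have "inner b (grad S (\<lambda>x. g x * \<phi> x)) = 0" using b_ker by (simp add: ker_adj_def)
  then show "inner (mult S g b) (grad S \<phi>) = (LINT x|\<nu>. - star_inv S b (grad S g) x * \<phi> x)"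
    using inner_b_grad_mult[OF g \<phi>A] by simp
qed

text \<open>Any version \<open>h\<close> of the adjoint may replace the chosen one. For empty
  \<open>B\<close> the right-hand side is 0 as well, every \<open>\<phi>\<close> being a test
  function, so later steps need no case distinction.\<close>

lemma normal_part_eq:
  assumes v: "is_adj S b B v h" and \<phi>: "\<phi> \<in> Alg S"
  shows "normal_part S b B v \<phi> = inner v (grad S \<phi>) - (LINT x|\<nu>. h x * \<phi> x)"
proof -
  have a: "is_adj S b B v (adj S b B v)" using v by (intro is_adj_adj) (auto simp: dom_adj_def)
  have hL: "h \<in> L2 \<nu>" "adj S b B v \<in> L2 \<nu>" using v a by (auto simp: is_adj_def)
  have "(LINT x|\<nu>. adj S b B v x * \<phi> x) = (LINT x|\<nu>. h x * \<phi> x)"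
  proof (rule integral_cong_AE)
    show "AE x in \<nu>. adj S b B v x * \<phi> x = h x * \<phi> x"
      using is_adj_unique[OF cl B_null a v] by eventually_elim simp
  qed (use L2_integrable(2)[OF fin _ Alg_L2[OF \<phi>]] hL in auto)
  moreover have "inner v (grad S \<phi>) = (LINT x|\<nu>. h x * \<phi> x)" if "B = {}"
    using v \<phi> that by (auto simp: is_adj_def AlgB_empty)
  ultimately show ?thesis by (auto simp: normal_part_def)
qed

lemma dom_perp_is_adj:
  assumes "f \<in> dom_perp S b B"
  shows "is_adj S b B (star S b f) (\<lambda>x. - perp S b B f x)"
  using assms is_adj_adj[of "star S b f" b B] by (simp add: dom_perp_def perp_def)

lemma dom_perp_L2:
  assumes "f \<in> dom_perp S b B" shows "f \<in> L2 \<nu>" "perp S b B f \<in> L2 \<nu>"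
proof -
  show "f \<in> L2 \<nu>" using assms by (simp add: dom_perp_def)
  have "(\<lambda>x. - perp S b B f x) \<in> L2 \<nu>" using dom_perp_is_adj[OF assms] by (simp add: is_adj_def)
  from L2_cmult[OF this, of "-1"] show "perp S b B f \<in> L2 \<nu>" by simp
qed

lemma ker_perp_iff: "w \<in> ker_perp S b {} \<longleftrightarrow> w \<in> L2 \<nu> \<and> star S b w \<in> ker_adj S {}"
proof
  assume w: "w \<in> ker_perp S b {}"
  then have d: "w \<in> L2 \<nu>" "star S b w \<in> dom_adj S b {}" "AE x in \<nu>. adj S b {} (star S b w) x = 0"
    by (auto simp: ker_perp_def dom_perp_def perp_def)
  have a: "is_adj S b {} (star S b w) (adj S b {} (star S b w))" by (rule is_adj_adj[OF d(2)])
  have "inner (star S b w) (grad S \<phi>) = 0" if "\<phi> \<in> AlgB S {}" for \<phi>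
  proof -
    have "inner (star S b w) (grad S \<phi>) = (LINT x|\<nu>. adj S b {} (star S b w) x * \<phi> x)"
      using a that by (simp add: is_adj_def)
    also have "\<dots> = 0" using d(3) by (intro integral_eq_zero_AE) (auto elim!: eventually_mono)
    finally show ?thesis .
  qed
  then show "w \<in> L2 \<nu> \<and> star S b w \<in> ker_adj S {}" using d by (simp add: ker_adj_def)
next
  assume w: "w \<in> L2 \<nu> \<and> star S b w \<in> ker_adj S {}"
  then have z: "is_adj S b {} (star S b w) (\<lambda>x. 0)" by (intro is_adj_zero) simp
  then have d: "star S b w \<in> dom_adj S b {}" by (auto simp: dom_adj_def)
  have "AE x in \<nu>. adj S b {} (star S b w) x = 0"
    by (rule is_adj_unique[OF _ _ is_adj_adj[OF d] z]) auto
  then show "w \<in> ker_perp S b {}" using w d by (simp add: ker_perp_def dom_perp_def perp_def)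
qed

text \<open>Stated for every \<open>g\<close>, since two choices are needed: the zero function for
  membership in the domain, and the one given by the projection.\<close>

lemma representation_exists:
  assumes f: "f \<in> dom_perp S b B" and g: "g \<in> Alg S"
  shows "\<exists>u w. neumann_representation S b B f g u w"
proof -
  obtain u where u: "u \<in> Alg S" and ker: "(star S b f - mult S g b) - grad S u \<in> ker_adj S {}"
    using decomposition[of "star S b f - mult S g b"] by blast
  define v where "v = star S b f - mult S g b - grad S u"
  define w where "w = star_inv S b v"
  define k where "k x = perp S b B f x - star_inv S b (grad S g) x" for x
  define G where "G \<phi> = normal_part S b B (star S b f) \<phi> - normal_part S b B b (\<lambda>x. g x * \<phi> x)" for \<phi>
  have fL: "f \<in> L2 \<nu>" "perp S b B f \<in> L2 \<nu>" using dom_perp_L2[OF f] .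
  have kL: "k \<in> L2 \<nu>" unfolding k_def[abs_def] by (intro L2_diff fin fL star_inv)
  \<comment> \<open>The integrals contained in the two normal parts cancel against the integral of
    \<open>k\<close>; what remains is the decomposition of \<open>(f - g) b\<close> tested with a
    gradient.\<close>
  have eq: "Form S u \<phi> = G \<phi> - (LINT x|\<nu>. k x * \<phi> x)" if \<phi>: "\<phi> \<in> Alg S" for \<phi>
  proof -
    have "inner v (grad S \<phi>) = 0" using ker \<phi> by (simp add: v_def ker_adj_def AlgB_empty)
    then have 1: "Form S u \<phi> = inner (star S b f) (grad S \<phi>) - inner (mult S g b) (grad S \<phi>)"
      using u \<phi> by (simp add: Form_inner v_def inner_diff)
    have 2: "normal_part S b B (star S b f) \<phi> = inner (star S b f) (grad S \<phi>) + (LINT x|\<nu>. perp S b B f x * \<phi> x)"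
      using normal_part_eq[OF dom_perp_is_adj[OF f] \<phi>] by simp
    have 3: "normal_part S b B b (\<lambda>x. g x * \<phi> x) = inner b (grad S (\<lambda>x. g x * \<phi> x))"
      using normal_part_eq[OF is_adj_zero[OF b_ker] Alg_mult[OF g \<phi>]] by simp
    have "(LINT x|\<nu>. k x * \<phi> x) = (LINT x|\<nu>. perp S b B f x * \<phi> x) - (LINT x|\<nu>. star_inv S b (grad S g) x * \<phi> x)"
      using L2_integrable(2)[OF fin fL(2) Alg_L2[OF \<phi>]] L2_integrable(2)[OF fin star_inv(1) Alg_L2[OF \<phi>]]
      by (simp add: k_def left_diff_distrib)
    then show ?thesis using 1 2 3 inner_b_grad_mult[OF g \<phi>] by (simp add: G_def)
  qed
  have G0: "G \<phi> = 0" if \<phi>: "\<phi> \<in> AlgB S B" for \<phi>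
  proof -
    have \<phi>A: "\<phi> \<in> Alg S" and "(\<lambda>x. g x * \<phi> x) \<in> AlgB S B"
      using \<phi> Alg_mult[OF g] by (simp_all add: AlgB_def)
    then have g\<phi>: "inner b (grad S (\<lambda>x. g x * \<phi> x)) = 0" using b_ker by (simp add: ker_adj_def)
    show ?thesis unfolding G_def
      using normal_part_eq[OF dom_perp_is_adj[OF f] \<phi>A] normal_part_eq[OF is_adj_zero[OF b_ker] Alg_mult[OF g \<phi>A]]
        g\<phi> dom_perp_is_adj[OF f] \<phi> by (simp add: is_adj_def)
  qed
  have k\<phi>: "integrable \<nu> (\<lambda>x. k x * \<phi> x)" if "\<phi> \<in> Alg S" for \<phi>
    using L2_integrable(2)[OF fin kL Alg_L2[OF that]] .
  \<comment> \<open>The weak equation solved for \<open>G\<close>: in this form linearity and the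
    bound in the dual norm are visible.\<close>
  have GF: "G \<phi> = inner (grad S u) (grad S \<phi>) + (LINT x|\<nu>. k x * \<phi> x)" if "\<phi> \<in> Alg S" for \<phi>
    using eq[OF that] Form_inner[OF u that] by simp
  have "fun_linear_on (Alg S) G"
    unfolding fun_linear_on_def
  proof (intro conjI ballI allI)
    fix \<phi> \<psi> assume a: "\<phi> \<in> Alg S" "\<psi> \<in> Alg S"
    then show "G (\<lambda>x. \<phi> x + \<psi> x) = G \<phi> + G \<psi>"
      using k\<phi>[OF a(1)] k\<phi>[OF a(2)] by (simp add: GF Alg_add grad_add inner_add distrib_left)
  next
    fix c \<phi> assume a: "\<phi> \<in> Alg S"
    have "(LINT x|\<nu>. k x * (c * \<phi> x)) = c * (LINT x|\<nu>. k x * \<phi> x)" by (simp add: mult.left_commute)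
    then show "G (\<lambda>x. c * \<phi> x) = c *\<^sub>R G \<phi>"
      using a by (simp add: GF Alg_cmult grad_cmult distrib_left)
  qed
  moreover have "\<bar>G \<phi>\<bar> \<le> (norm (grad S u) + (LINT x|\<nu>. \<bar>k x\<bar>)) * (sqrt (Form S \<phi> \<phi>) + sup_norm \<phi>)"
    if \<phi>: "\<phi> \<in> Alg S" for \<phi>
  proof -
    have sp: "\<bar>\<phi> x\<bar> \<le> sup_norm \<phi>" for x by (rule abs_le_sup_norm[OF Alg_Cc[OF \<phi>]])
    then have s0: "0 \<le> sup_norm \<phi>" using abs_ge_zero order_trans by blast
    have n: "sqrt (Form S \<phi> \<phi>) = norm (grad S \<phi>)" by (simp add: Form_inner \<phi> norm_eq_sqrt_inner)
    have ki: "integrable \<nu> (\<lambda>x. \<bar>k x\<bar>)" using L2_integrable(1)[OF fin kL kL] by simp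
    have "\<bar>LINT x|\<nu>. k x * \<phi> x\<bar> \<le> (LINT x|\<nu>. \<bar>k x * \<phi> x\<bar>)" by simp
    also have "\<dots> \<le> (LINT x|\<nu>. \<bar>k x\<bar> * sup_norm \<phi>)"
    proof (rule integral_mono)
      show "integrable \<nu> (\<lambda>x. \<bar>k x * \<phi> x\<bar>)" by (rule integrable_abs[OF k\<phi>[OF \<phi>]])
    qed (use ki sp in \<open>auto simp: abs_mult intro: mult_left_mono\<close>)
    finally have 2: "\<bar>LINT x|\<nu>. k x * \<phi> x\<bar> \<le> (LINT x|\<nu>. \<bar>k x\<bar>) * sup_norm \<phi>" by simp
    have "\<bar>G \<phi>\<bar> \<le> norm (grad S u) * norm (grad S \<phi>) + (LINT x|\<nu>. \<bar>k x\<bar>) * sup_norm \<phi>"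
      unfolding GF[OF \<phi>] using 2 Cauchy_Schwarz_ineq2[of "grad S u" "grad S \<phi>"] by linarith
    also have "\<dots> \<le> (norm (grad S u) + (LINT x|\<nu>. \<bar>k x\<bar>)) * (norm (grad S \<phi>) + sup_norm \<phi>)"
      using s0 by (simp add: algebra_simps)
    finally show ?thesis by (simp add: n)
  qed
  ultimately have G: "G \<in> dual_Alg S" unfolding dual_Alg_def by blast
  have AE: "AE x in \<nu>. f x = g x + star_inv S b (grad S u) x + w x"
  proof -
    have gu: "(\<lambda>x. g x + star_inv S b (grad S u) x) \<in> L2 \<nu>"
      by (intro L2_add fin Alg_L2 g star_inv)
    have wL: "w \<in> L2 \<nu>" unfolding w_def by (rule star_inv)
    have "star S b (\<lambda>x. g x + star_inv S b (grad S u) x + w x) = mult S g b + grad S u + v"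
      using star_add[OF gu wL] star_add[OF Alg_L2[OF g] star_inv(1)]
      by (simp add: star_inv(2) star_Cc Alg_Cc g w_def)
    then have "star S b f = star S b (\<lambda>x. g x + star_inv S b (grad S u) x + w x)" by (simp add: v_def)
    then show ?thesis using star_eq_iff[OF fL(1) L2_add[OF fin gu wL]] by blast
  qed
  have "w \<in> ker_perp S b {}" unfolding ker_perp_iff w_def using star_inv ker by (simp add: v_def)
  moreover have "u \<in> dom_laplacian S b B"
    unfolding dom_laplacian_def using u kL eq G0 by (auto intro!: bexI[of _ k] simp: AlgB_def)
  moreover have "weak_neumann_solution S b B k G u"
    unfolding weak_neumann_solution_def using kL G G0 u eq by blast
  ultimately have "neumann_representation S b B f g u w"
    unfolding neumann_representation_def k_def[abs_def] G_def[abs_def] using AE g by blast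
  then show ?thesis by blast
qed

lemma representation_star:
  assumes f: "f \<in> L2 \<nu>" and r: "neumann_representation S b B f g u w"
  shows "star S b f = mult S g b + grad S u + star S b w" "g \<in> Alg S" "u \<in> Alg S" "w \<in> L2 \<nu>"
    "star S b w \<in> ker_adj S {}"
proof -
  show g: "g \<in> Alg S" and u: "u \<in> Alg S" and w: "w \<in> L2 \<nu>" "star S b w \<in> ker_adj S {}"
    using r ker_perp_iff by (auto simp: neumann_representation_def dom_laplacian_def)
  have AE: "AE x in \<nu>. f x = g x + star_inv S b (grad S u) x + w x"
    using r by (simp add: neumann_representation_def)
  have gu: "(\<lambda>x. g x + star_inv S b (grad S u) x) \<in> L2 \<nu>"
    by (intro L2_add fin Alg_L2 g star_inv)
  have "star S b f = star S b (\<lambda>x. g x + star_inv S b (grad S u) x + w x)"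
    using AE star_eq_iff[OF f L2_add[OF fin gu w(1)]] by blast
  then show "star S b f = mult S g b + grad S u + star S b w"
    using star_add[OF gu w(1)] star_add[OF Alg_L2[OF g] star_inv(1)]
    by (simp add: star_inv(2) star_Cc Alg_Cc g)
qed

text \<open>Each summand of \<open>star S b f\<close> lies in the domain of the adjoint: the first
  by \<open>is_adj_mult\<close>, the gradient because \<open>u\<close> has a Laplacian, the last
  because it is orthogonal to the gradients of all of C.\<close>

lemma representation_imp_dom:
  assumes f: "f \<in> L2 \<nu>" and r: "neumann_representation S b B f g u w"
  shows "f \<in> dom_perp S b B"
proof -
  note R = representation_star[OF f r]
  have "u \<in> dom_laplacian S b B" using r by (simp add: neumann_representation_def)
  then obtain k where k: "k \<in> L2 \<nu>" "\<And>\<phi>. \<phi> \<in> AlgB S B \<Longrightarrow> Form S u \<phi> = - (LINT x|\<nu>. k x * \<phi> x)"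
    by (auto simp: dom_laplacian_def)
  have "is_adj S b B (grad S u) (\<lambda>x. - k x)"
    unfolding is_adj_def using L2_cmult[OF k(1), of "-1"] k(2) Form_inner[OF R(3)]
    by (auto simp: AlgB_def)
  from is_adj_lincomb[OF is_adj_mult[OF R(2)] this, of 1 1]
  have gu: "is_adj S b B (mult S g b + grad S u) (\<lambda>x. - star_inv S b (grad S g) x + - k x)" by simp
  have "star S b w \<in> ker_adj S B" using R(5) by (auto simp: ker_adj_def AlgB_def)
  from is_adj_lincomb[OF gu is_adj_zero[OF this], of 1 1]
  have "star S b f \<in> dom_adj S b B" unfolding dom_adj_def R(1) by auto
  then show ?thesis using f by (simp add: dom_perp_def)
qed

section \<open>The copy of the completion inside H and the projection\<close>

lemma Alg_dom_perp: "g \<in> Alg S \<Longrightarrow> g \<in> dom_perp S b B"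
  using is_adj_mult[of g] Alg_L2[of g] by (auto simp: dom_perp_def dom_adj_def star_Cc Alg_Cc)

definition pstar :: "('x \<Rightarrow> real) \<Rightarrow> 'h" where
  "pstar f = star S b (perp S b B f)"

text \<open>Uniqueness of adjoints removes the choice hidden in \<open>perp\<close>; linearity of
  \<open>pstar\<close> and its value on C are obtained this way.\<close>

lemma pstar_eqI:
  assumes f: "f \<in> dom_perp S b B" and h: "is_adj S b B (star S b f) (\<lambda>x. - h x)" "h \<in> L2 \<nu>"
  shows "pstar f = star S b h"
proof -
  have "AE x in \<nu>. - perp S b B f x = - h x"
    by (rule is_adj_unique[OF cl B_null dom_perp_is_adj[OF f] h(1)])
  then show ?thesis unfolding pstar_def star_eq_iff[OF dom_perp_L2(2)[OF f] h(2)] by simp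
qed

lemma pstar_Alg: "g \<in> Alg S \<Longrightarrow> pstar g = grad S g"
  using pstar_eqI[OF Alg_dom_perp, of g "star_inv S b (grad S g)"] is_adj_mult[of g]
  by (simp add: star_inv star_Cc Alg_Cc)

lemma pstar_lincomb:
  assumes f: "f \<in> dom_perp S b B" and g: "g \<in> dom_perp S b B"
  shows "(\<lambda>x. f x + c * g x) \<in> dom_perp S b B" "pstar (\<lambda>x. f x + c * g x) = pstar f + c *\<^sub>R pstar g"
proof -
  note fL = dom_perp_L2[OF f] and gL = dom_perp_L2[OF g]
  have st: "star S b (\<lambda>x. f x + c * g x) = 1 *\<^sub>R star S b f + c *\<^sub>R star S b g"
    by (simp add: star_add[OF fL(1) L2_cmult[OF gL(1)]] star_cmult[OF gL(1)])
  from is_adj_lincomb[OF dom_perp_is_adj[OF f] dom_perp_is_adj[OF g], of 1 c]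
  have a: "is_adj S b B (star S b (\<lambda>x. f x + c * g x)) (\<lambda>x. - (perp S b B f x + c * perp S b B g x))"
    unfolding st by (simp add: algebra_simps)
  show d: "(\<lambda>x. f x + c * g x) \<in> dom_perp S b B"
    using a L2_add[OF fin fL(1) L2_cmult[OF gL(1)]] by (auto simp: dom_perp_def dom_adj_def)
  show "pstar (\<lambda>x. f x + c * g x) = pstar f + c *\<^sub>R pstar g"
    using pstar_eqI[OF d a L2_add[OF fin fL(2) L2_cmult[OF gL(2)]]]
    by (simp add: star_add[OF fL(2) L2_cmult[OF gL(2)]] star_cmult[OF gL(2)] pstar_def)
qed

text \<open>Polarization of the norm identity that characterizes \<open>J\<close>.\<close>

lemma inner_completion:
  fixes J :: "('x \<Rightarrow> real) \<Rightarrow> 'k::{real_inner, complete_space}"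
  assumes J: "perp_completion S b B J" and f: "f \<in> dom_perp S b B" and g: "g \<in> dom_perp S b B"
  shows "inner (J f) (J g) = inner (pstar f) (pstar g)"
proof -
  have n: "(norm (J k))\<^sup>2 = (norm (pstar k))\<^sup>2" if "k \<in> dom_perp S b B" for k
    using J that norm_star[OF dom_perp_L2(2)[OF that]] by (simp add: perp_completion_def pstar_def)
  have fg: "(\<lambda>x. f x + g x) \<in> dom_perp S b B" "pstar (\<lambda>x. f x + g x) = pstar f + pstar g"
    using pstar_lincomb[OF f g, of 1] by simp_all
  have "J (\<lambda>x. f x + g x) = J f + J g"
    using J f g by (simp add: perp_completion_def fun_linear_on_def)
  then have "(norm (J f + J g))\<^sup>2 = (norm (pstar f + pstar g))\<^sup>2" using n[OF fg(1)] fg(2) by simp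
  then show ?thesis using n[OF f] n[OF g]
    by (simp add: power2_norm_eq_inner inner_add inner_commute)
qed

lemma projection_iff:
  fixes J :: "('x \<Rightarrow> real) \<Rightarrow> 'k::{real_inner, complete_space}"
  assumes J: "perp_completion S b B J" and f: "f \<in> dom_perp S b B" and g: "g \<in> Alg S"
  shows "orthogonal_projection (J ` Alg S) (J f) (J g) \<longleftrightarrow> pstar f - grad S g \<in> ker_adj S {}"
proof -
  have "inner (J f - J g) (J y) = inner (pstar f - grad S g) (grad S y)" if "y \<in> Alg S" for y
    using inner_completion[OF J] f Alg_dom_perp[OF g] Alg_dom_perp[OF that]
    by (simp add: inner_diff pstar_Alg g that)
  then show ?thesis using g by (simp add: orthogonal_projection_def ker_adj_def AlgB_empty)
qed

lemma kernel_const: "f \<in> Alg S \<Longrightarrow> grad S f = 0 \<Longrightarrow> \<exists>c. f = (\<lambda>x. c)"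
  using compl unfolding complete_wrt_def Let_def by blast

text \<open>Both projections have the same gradient, so \<open>g'\<close> and \<open>g\<close>
  differ by a constant \<open>c\<close>. The other two terms must then absorb \<open>c b\<close>,
  and uniqueness of the orthogonal decomposition assigns the gradient part to one and the part in
  the kernel to the other.\<close>

lemma representation_unique:
  fixes J :: "('x \<Rightarrow> real) \<Rightarrow> 'k::{real_inner, complete_space}"
  assumes J: "perp_completion S b B J" and f: "f \<in> dom_perp S b B"
    and h: "h \<in> Alg S" and v: "v \<in> ker_adj S {}" and b: "b = grad S h + v"
    and r: "neumann_representation S b B f g u w"
    and r': "neumann_representation S b B f g' u' w'"
    and o: "orthogonal_projection (J ` Alg S) (J f) (J g)"
    and o': "orthogonal_projection (J ` Alg S) (J f) (J g')"
  shows "\<exists>c. g' = (\<lambda>x. g x + c)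
    \<and> (AE x in \<nu>. star_inv S b (grad S u') x = star_inv S b (grad S u) x - c * star_inv S b (grad S h) x)
    \<and> (AE x in \<nu>. w' x = w x - c * star_inv S b v x)"
proof -
  note fL = dom_perp_L2(1)[OF f]
  note R = representation_star[OF fL r] and R' = representation_star[OF fL r']
  have "grad S g = grad S g'"
    by (rule decomposition_unique(1)[OF R(2) R'(2), of "pstar f - grad S g" "pstar f - grad S g'"])
      (use o o' projection_iff[OF J f] R(2) R'(2) in auto)
  then have "grad S (\<lambda>x. g' x - g x) = 0" by (simp add: grad_diff R(2) R'(2))
  from kernel_const[OF Alg_diff[OF R'(2) R(2)] this] obtain c where "(\<lambda>x. g' x - g x) = (\<lambda>x. c)" by blast
  then have c: "g' x = g x + c" for x by (metis add.commute diff_add_cancel)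
  then have g': "g' = (\<lambda>x. g x + c)" by auto
  have "mult S g' b = mult S g b + c *\<^sub>R b"
  proof -
    have "star S b g' = star S b g + c *\<^sub>R star S b (\<lambda>x. 1)"
      unfolding g' using star_add[OF Alg_L2[OF R(2)] L2_cmult[OF Alg_L2[OF one], of c]]
        star_cmult[OF Alg_L2[OF one], of c] by simp
    then show ?thesis by (simp add: star_Cc Alg_Cc R(2) R'(2) mult_one)
  qed
  then have "grad S u + star S b w = grad S u' + star S b w' + c *\<^sub>R b"
    using R(1) R'(1) by (simp add: algebra_simps)
  then have eq: "grad S u' + star S b w' = grad S (\<lambda>x. u x - c * h x) + (star S b w - c *\<^sub>R v)"
    by (simp add: grad_diff Alg_cmult grad_cmult R(3) h b algebra_simps)
  have uh: "(\<lambda>x. u x - c * h x) \<in> Alg S" by (intro Alg_diff Alg_cmult R(3) h)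
  have wv: "star S b w - c *\<^sub>R v \<in> ker_adj S {}" using R(5) v by (simp add: ker_adj_def inner_diff)
  note E = decomposition_unique[OF R'(3) uh R'(5) wv eq]
  have "star S b (star_inv S b (grad S u')) =
    star S b (\<lambda>x. star_inv S b (grad S u) x - c * star_inv S b (grad S h) x)"
    unfolding star_diff[OF star_inv(1) L2_cmult[OF star_inv(1)]] star_cmult[OF star_inv(1)] star_inv(2) E(1)
    by (simp add: grad_diff Alg_cmult grad_cmult R(3) h)
  then have 1: "AE x in \<nu>. star_inv S b (grad S u') x = star_inv S b (grad S u) x - c * star_inv S b (grad S h) x"
    using star_eq_iff[OF star_inv(1) L2_diff[OF fin star_inv(1) L2_cmult[OF star_inv(1)]]] by blast
  have "star S b w' = star S b (\<lambda>x. w x - c * star_inv S b v x)"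
    unfolding star_diff[OF R(4) L2_cmult[OF star_inv(1)]] star_cmult[OF star_inv(1)] star_inv(2) E(2) ..
  then have 2: "AE x in \<nu>. w' x = w x - c * star_inv S b v x"
    using star_eq_iff[OF R'(4) L2_diff[OF fin R(4) L2_cmult[OF star_inv(1)]]] by blast
  show ?thesis using g' 1 2 by blast
qed

lemma projection_exists:
  fixes J :: "('x \<Rightarrow> real) \<Rightarrow> 'k::{real_inner, complete_space}"
  assumes J: "perp_completion S b B J" and f: "f \<in> dom_perp S b B"
  shows "\<exists>g u w. neumann_representation S b B f g u w \<and> orthogonal_projection (J ` Alg S) (J f) (J g)"
proof -
  obtain g where g: "g \<in> Alg S" "pstar f - grad S g \<in> ker_adj S {}" using decomposition by blast
  then show ?thesis using representation_exists[OF f g(1)] projection_iff[OF J f g(1)] by blast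
qed

end

text \<open>As every \<open>g\<close> in C occurs in some representation, uniqueness is claimed
  among those whose \<open>g\<close> has the projected class; the last part provides such a
  representation.\<close>

theorem theorem8p6:
  fixes S :: "('x::metric_space, 'h::{real_inner, complete_space}) form_structure"
    and B :: "'x set" and p :: 'x and b :: 'h
    and J :: "('x \<Rightarrow> real) \<Rightarrow> 'k::{real_inner, complete_space}"
  assumes "locally_compact_space (euclidean :: 'x topology)"
    and "separable_space (euclidean :: 'x topology)"
    and "admissible_form (Alg S) (Form S)"
    and "first_order_structure S"
    and "martingale_dimension S 1"
    and "closed B" and "form_null_set S B"
    and "p \<notin> B" and "complete_wrt S p"
    and "b \<in> ker_adj S B" and "minimal_energy_dominant S (nu_vec S b)"
    and "perp_completion S b B J"
  shows
    "(\<forall>f \<in> L2 (nu_vec S b). f \<in> dom_perp S b B \<longleftrightarrow>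
        (\<exists>g u w. neumann_representation S b B f g u w))
   \<and> (\<exists>h \<in> Alg S. \<exists>v \<in> ker_adj S {}. b = grad S h + v
       \<and> (\<forall>h' \<in> Alg S. \<forall>v' \<in> ker_adj S {}. b = grad S h' + v' \<longrightarrow> grad S h' = grad S h \<and> v' = v)
       \<and> (\<forall>f \<in> dom_perp S b B. \<forall>g u w g' u' w'.
            neumann_representation S b B f g u w
          \<and> orthogonal_projection (J ` Alg S) (J f) (J g)
          \<and> neumann_representation S b B f g' u' w'
          \<and> orthogonal_projection (J ` Alg S) (J f) (J g') \<longrightarrow>
            (\<exists>c::real. g' = (\<lambda>x. g x + c)
              \<and> (AE x in nu_vec S b. star_inv S b (grad S u') x =
                    star_inv S b (grad S u) x - c * star_inv S b (grad S h) x)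
              \<and> (AE x in nu_vec S b. w' x = w x - c * star_inv S b v x))))
   \<and> (\<forall>f \<in> dom_perp S b B. \<exists>g u w. neumann_representation S b B f g u w
          \<and> orthogonal_projection (J ` Alg S) (J f) (J g))"
proof -
  have "(\<lambda>x. 1) \<in> Alg S" using assms(9) by (simp add: complete_wrt_def Let_def)
  then interpret complete_form_duality S B p b
    using assms by unfold_locales
  note J = assms(12)
  obtain h where h: "h \<in> Alg S" "b - grad S h \<in> ker_adj S {}" using decomposition by blast
  have b: "b = grad S h + (b - grad S h)" by simp
  show ?thesis
  proof (intro conjI bexI[of _ h] bexI[of _ "b - grad S h"] ballI allI impI)
    fix f assume "f \<in> L2 (nu_vec S b)"
    then show "f \<in> dom_perp S b B \<longleftrightarrow> (\<exists>g u w. neumann_representation S b B f g u w)"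
      \<comment> \<open>The representation with \<open>g = 0\<close> suffices for this
        direction.\<close>
      using representation_exists[OF _ Alg_zero] representation_imp_dom by blast
  next
    fix h' v' assume a: "h' \<in> Alg S" "v' \<in> ker_adj S {}" "b = grad S h' + v'"
    show "grad S h' = grad S h" "v' = b - grad S h"
      by (rule decomposition_unique[OF a(1) h(1) a(2) h(2) trans[OF a(3)[symmetric] b]])+
  next
    fix f g u w g' u' w'
    assume f: "f \<in> dom_perp S b B" and r: "neumann_representation S b B f g u w
      \<and> orthogonal_projection (J ` Alg S) (J f) (J g) \<and> neumann_representation S b B f g' u' w'
      \<and> orthogonal_projection (J ` Alg S) (J f) (J g')"
    from representation_unique[OF J f h b] r show "\<exists>c. g' = (\<lambda>x. g x + c)
      \<and> (AE x in \<nu>. star_inv S b (grad S u') x = star_inv S b (grad S u) x - c * star_inv S b (grad S h) x)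
      \<and> (AE x in \<nu>. w' x = w x - c * star_inv S b (b - grad S h) x)" by blast
  qed (use h b projection_exists[OF J] in auto)
qed

end
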